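(* Assume $X$ has paths of finite variation. For every Borel $h:(-\infty,0]\to[0,\infty]$, $$\mathbb E_0\bigl[h(X_G-\overline X_{\mathsf e})\bigr]=\frac{1}{\Phi(p)\mathsf d}\left[p\,h(0)+\int h(z)\bigl(1-e^{\Phi(p)z}\bigr)\nu(dz)\right];$$ in other words, for every Borel $g:(0,1]\to[0,\infty]$, $$\mathbb E^Q_1[g(J)]=\frac{1}{\Phi(p)\mathsf d}\left[p\,g(1)+\int g(e^z)\bigl(1-e^{\Phi(p)z}\bigr)\nu(dz)\right].$$
   Context: Conventions: $\inf\emptyset=\infty$. The process $X$. $X=(X_t)_{t\in[0,\infty)}$ is a spectrally negative Lévy process under probabilities $(P_x)_{x\in\mathbb R}$ in a filtration $\mathcal F=(\mathcal F_t)_{t\in[0,\infty)}$: it is càdlàg, real-valued, $\mathcal F$-adapted, with stationary independent increments relative to $\mathcal F$, no positive jumps and non-monotone paths; $X_0=0$ a.s. under $P_0$; and for each $x\in\mathbb R$ the law of $X$ under $P_x$ is that of $x+X$ under $P_0$. $\mathbb E_x$ is expectation under $P_x$. $\mathsf e$ is an a.s. strictly positive $\mathcal F$-stopping time such that for some $p\in[0,\infty)$, for all $x\in\mathbb R$, $s,t\in[0,\infty)$ and Borel $g:\mathbb R\to[0,\infty]$, $\mathbb E_x[g(X_{t+s}-X_t)\mathbf 1_{\{\mathsf e>t+s\}}\mid\mathcal F_t]=\mathbb E_0[g(X_s)]e^{-ps}\mathbf 1_{\{t<\mathsf e\}}$ $P_x$-a.s. (so $\mathsf e$ is exponential of rate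 $p$, independent of $X$; $\mathsf e=\infty$ a.s. if $p=0$). Let $\alpha\in(0,\infty)$. The Laplace exponent is $\psi(\lambda)=\log\mathbb E_0[e^{\lambda X_1}]=\frac{\sigma^2}{2}\lambda^2+\mu\lambda+\int(e^{\lambda y}-\mathbf 1_{[-1,0)}(y)\lambda y-1)\nu(dy)$, $\lambda\in[0,\infty)$, with $\mu\in\mathbb R$, $\sigma^2\in[0,\infty)$ and $\nu$ a measure on $\mathbb R$ carried by $(-\infty,0)$ with $\int(1\wedge y^2)\nu(dy)<\infty$. $X$ has paths of finite variation iff $\sigma^2=0$ and $\int(1\wedge|y|)\nu(dy)<\infty$, and then $\mathsf d:=\mu+\int_{[-1,0)}|y|\nu(dy)\in(0,\infty)$. Set $\Phi(q):=\inf\{\lambda\in[0,\infty):\psi(\lambda)>q\}$ for $q\in[0,\infty)$. Standing assumption: if $p=0$, then $X$ drifts to $-\infty$; equivalently $\Phi(p)>0$. The process $Y$ (Lamperti transform). Put $I_t:=\int_0^te^{\alpha X_u}du$ for $t\in[0,\infty]$, $\phi_s:=\inf\{t\in[0,\infty):I_t>s\}$ for $s\in[0,\infty)$, and $Y_s:=e^{X_{\phi_s}}$ for $s\in[0,I_{\mathsf e})$, $Y_s:=0$ for $s\in[I_{\mathsf e},\infty)$. Let $T_0:=\inf\{t\in(0,\infty):Y_t=0\}=I_{\mathsf e}$. For $y\in(0,\infty)$ let $Q_y:=P_{\log y}$, with expectation $\mathbb E^Q_y$. $\overline X$ and $\overline Y$ are the running suprema of $X$ and $Y$ (with $\overline Y_\infty$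 the overall supremum of $Y$). $L:=\sup\{s\in[0,\infty):\overline Y_s=Y_s\}$, $G:=\sup\{t\in[0,\mathsf e):\overline X_t=X_t\}$, $J:=\frac{Y_L}{\overline Y_\infty}\mathbf 1_{\{L<T_0\}}+\mathbf 1_{\{L=T_0\}}$. Under the standing assumption, a.s., $\overline Y_\infty=e^{\overline X_{\mathsf e}}$, $L=I_G$ and $T_0$ are finite, and $J=e^{X_G-\overline X_{\mathsf e}}$. *)

theory Defs
  imports "HOL-Probability.Probability"
begin

section \<open>Path properties\<close>

text \<open>Paths are functions on \<open>[0,\<infinity>)\<close>, represented as functions on the reals whose values at
  negative arguments are never used.\<close>

definition cadlag :: "(real \<Rightarrow> real) \<Rightarrow> bool" where
  "cadlag f \<longleftrightarrow> (\<forall>t\<ge>0. continuous (at_right t) f) \<and> (\<forall>t>0. \<exists>l. (f \<longlongrightarrow> l) (at_left t))"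

definition no_positive_jumps :: "(real \<Rightarrow> real) \<Rightarrow> bool" where
  "no_positive_jumps f \<longleftrightarrow> (\<forall>t>0. \<forall>l. (f \<longlongrightarrow> l) (at_left t) \<longrightarrow> f t \<le> l)"

definition bounded_variation_on :: "real \<Rightarrow> real \<Rightarrow> (real \<Rightarrow> real) \<Rightarrow> bool" where
  "bounded_variation_on a b f \<longleftrightarrow>
     bdd_above {\<Sum>i<n. \<bar>f (\<tau> (Suc i)) - f (\<tau> i)\<bar> | (\<tau> :: nat \<Rightarrow> real) n.
       mono_on {..n} \<tau> \<and> \<tau> ` {..n} \<subseteq> {a..b}}"

definition finite_variation :: "(real \<Rightarrow> real) \<Rightarrow> bool" where
  "finite_variation f \<longleftrightarrow> (\<forall>t\<ge>0. bounded_variation_on 0 t f)"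


section \<open>Spectrally negative Levy processes\<close>

text \<open>The time index of the filtration is \<open>[0,\<infinity>]\<close>, so that \<open>stopping_time\<close> applies to
  \<open>[0,\<infinity>]\<close>-valued times. The member at \<open>\<infinity>\<close> is not used by any other condition, and a
  filtration on \<open>[0,\<infinity>)\<close> can always be extended by the \<open>\<sigma>\<close>-algebra generated by its union.

  The path properties are required almost surely only.\<close>

locale spectrally_negative_levy = filtration "space (P 0)" F
  for P :: "real \<Rightarrow> 'a measure" and F :: "ennreal \<Rightarrow> 'a measure" +
  fixes X :: "real \<Rightarrow> 'a \<Rightarrow> real"
  assumes prob: "prob_space (P x)"
    and sets_P: "sets (P x) = sets (P 0)"
    and subalg: "subalgebra (P 0) (F t)"
    and adapted: "u \<ge> 0 \<Longrightarrow> X u \<in> borel_measurable (F (ennreal u))"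
    and cadlag: "AE \<omega> in P x. cadlag (\<lambda>u. X u \<omega>)"
    and no_positive_jumps: "AE \<omega> in P x. no_positive_jumps (\<lambda>u. X u \<omega>)"
    and non_monotone:
      "AE \<omega> in P x. \<not> mono_on {0..} (\<lambda>u. X u \<omega>) \<and> \<not> antimono_on {0..} (\<lambda>u. X u \<omega>)"
    and indep_increments:
      "0 \<le> u \<Longrightarrow> u \<le> v \<Longrightarrow> prob_space.indep_set (P x) (sets (F (ennreal u)))
         (sets (vimage_algebra (space (P x)) (\<lambda>\<omega>. X v \<omega> - X u \<omega>) borel))"
    and stationary_increments:
      "0 \<le> u \<Longrightarrow> u \<le> v \<Longrightarrow> distr (P x) borel (\<lambda>\<omega>. X v \<omega> - X u \<omega>)
         = distr (P x) borel (\<lambda>\<omega>. X (v - u) \<omega> - X 0 \<omega>)"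
    and start: "AE \<omega> in P 0. X 0 \<omega> = 0"
    and law_shift:
      "distr (P x) (\<Pi>\<^sub>M u\<in>{0..}. borel) (\<lambda>\<omega>. \<lambda>u\<in>{0..}. X u \<omega>)
         = distr (P 0) (\<Pi>\<^sub>M u\<in>{0..}. borel) (\<lambda>\<omega>. \<lambda>u\<in>{0..}. x + X u \<omega>)"

locale killed_spectrally_negative_levy = spectrally_negative_levy P F X
  for P :: "real \<Rightarrow> 'a measure" and F :: "ennreal \<Rightarrow> 'a measure" and X :: "real \<Rightarrow> 'a \<Rightarrow> real" +
  fixes e :: "'a \<Rightarrow> ennreal" and p :: real
  assumes stopping: "stopping_time F e"
    and e_pos: "AE \<omega> in P x. 0 < e \<omega>"
    and p_nonneg: "p \<ge> 0"
    and killing: "\<And>x s t (g :: real \<Rightarrow> ennreal). s \<ge> 0 \<Longrightarrow> t \<ge> 0 \<Longrightarrow> g \<in> borel_measurable borel \<Longrightarrow>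
      AE \<omega> in P x.
        nn_cond_exp (P x) (F (ennreal t))
          (\<lambda>\<omega>. g (X (t + s) \<omega> - X t \<omega>) * indicator {\<omega>. ennreal (t + s) < e \<omega>} \<omega>) \<omega>
        = (\<integral>\<^sup>+ \<omega>'. g (X s \<omega>') \<partial>P 0) * ennreal (exp (- p * s)) * indicator {\<omega>. ennreal t < e \<omega>} \<omega>"

definition laplace_exponent :: "(real \<Rightarrow> 'a measure) \<Rightarrow> (real \<Rightarrow> 'a \<Rightarrow> real) \<Rightarrow> real \<Rightarrow> real" where
  "laplace_exponent P X l = ln (\<integral>\<omega>. exp (l * X 1 \<omega>) \<partial>P 0)"

text \<open>The integrability clause only says that \<open>E\<^sub>0[exp (l X\<^sub>1)]\<close> is finite, so that
  \<open>laplace_exponent\<close> is its genuine logarithm.\<close>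

definition levy_triplet ::
  "(real \<Rightarrow> 'a measure) \<Rightarrow> (real \<Rightarrow> 'a \<Rightarrow> real) \<Rightarrow> real \<Rightarrow> real \<Rightarrow> real measure \<Rightarrow> bool" where
  "levy_triplet P X \<mu> \<sigma> \<nu> \<longleftrightarrow>
     sets \<nu> = sets borel \<and> emeasure \<nu> {0..} = 0 \<and>
     (\<integral>\<^sup>+ y. ennreal (min 1 (y\<^sup>2)) \<partial>\<nu>) < \<infinity> \<and>
     (\<forall>l\<ge>0. integrable (P 0) (\<lambda>\<omega>. exp (l * X 1 \<omega>)) \<and>
        laplace_exponent P X l = \<sigma>\<^sup>2 / 2 * l\<^sup>2 + \<mu> * l
          + (\<integral>y. exp (l * y) - indicator {-1..<0} y * l * y - 1 \<partial>\<nu>))"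

text \<open>Under \<open>levy_triplet\<close> and non-monotonicity of the paths the exponent tends to \<open>\<infinity>\<close>,
  so the infimum is never taken over the empty set.\<close>

definition Phi :: "(real \<Rightarrow> 'a measure) \<Rightarrow> (real \<Rightarrow> 'a \<Rightarrow> real) \<Rightarrow> real \<Rightarrow> real" where
  "Phi P X q = Inf {l. 0 \<le> l \<and> laplace_exponent P X l > q}"

definition levy_drift :: "real \<Rightarrow> real measure \<Rightarrow> real" where
  "levy_drift \<mu> \<nu> = \<mu> + (LINT y:{-1..<0}|\<nu>. \<bar>y\<bar>)"


section \<open>Running suprema and the Lamperti transform\<close>

text \<open>The suprema of paths are taken in the reals; they are almost surely bounded
  whenever they are used below (for the overall suprema this needs \<open>p > 0\<close> or drift to \<open>-\<infinity>\<close>).\<close>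

definition run_sup :: "(real \<Rightarrow> 'a \<Rightarrow> real) \<Rightarrow> ennreal \<Rightarrow> 'a \<Rightarrow> real" where
  "run_sup Z t \<omega> = (SUP u\<in>{u. 0 \<le> u \<and> ennreal u \<le> t}. Z u \<omega>)"

definition last_max_time :: "(real \<Rightarrow> 'a \<Rightarrow> real) \<Rightarrow> ('a \<Rightarrow> ennreal) \<Rightarrow> 'a \<Rightarrow> ennreal" where
  "last_max_time X e \<omega> =
     Sup {ennreal t | t. 0 \<le> t \<and> ennreal t < e \<omega> \<and> run_sup X (ennreal t) \<omega> = X t \<omega>}"

definition exp_functional :: "real \<Rightarrow> (real \<Rightarrow> 'a \<Rightarrow> real) \<Rightarrow> ennreal \<Rightarrow> 'a \<Rightarrow> ennreal" where
  "exp_functional \<alpha> X t \<omega> =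
     (\<integral>\<^sup>+ u\<in>{u. 0 \<le> u \<and> ennreal u \<le> t}. ennreal (exp (\<alpha> * X u \<omega>)) \<partial>lborel)"

definition time_change :: "real \<Rightarrow> (real \<Rightarrow> 'a \<Rightarrow> real) \<Rightarrow> real \<Rightarrow> 'a \<Rightarrow> ennreal" where
  "time_change \<alpha> X s \<omega> = Inf {ennreal t | t. 0 \<le> t \<and> exp_functional \<alpha> X (ennreal t) \<omega> > ennreal s}"

text \<open>The time change is finite wherever \<open>enn2real\<close> is applied to it.\<close>

definition lamperti ::
  "real \<Rightarrow> (real \<Rightarrow> 'a \<Rightarrow> real) \<Rightarrow> ('a \<Rightarrow> ennreal) \<Rightarrow> real \<Rightarrow> 'a \<Rightarrow> real" where
  "lamperti \<alpha> X e s \<omega> =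
     (if ennreal s < exp_functional \<alpha> X (e \<omega>) \<omega>
      then exp (X (enn2real (time_change \<alpha> X s \<omega>)) \<omega>) else 0)"

definition hit_zero :: "(real \<Rightarrow> 'a \<Rightarrow> real) \<Rightarrow> 'a \<Rightarrow> ennreal" where
  "hit_zero Y \<omega> = Inf {ennreal t | t. 0 < t \<and> Y t \<omega> = 0}"

definition J_ratio :: "(real \<Rightarrow> 'a \<Rightarrow> real) \<Rightarrow> 'a \<Rightarrow> real" where
  "J_ratio Y \<omega> =
     (let L = last_max_time Y (\<lambda>_. \<infinity>) \<omega>; T\<^sub>0 = hit_zero Y \<omega> in
       Y (enn2real L) \<omega> / run_sup Y \<infinity> \<omega> * of_bool (L < T\<^sub>0) + of_bool (L = T\<^sub>0))"

definition Q_meas :: "(real \<Rightarrow> 'a measure) \<Rightarrow> real \<Rightarrow> 'a measure" where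
  "Q_meas P y = P (ln y)"

end

theory Submission
  imports Defs
begin

text \<open>Along the dyadic grid of mesh \<open>\<delta>\<close>, let \<open>R\<close> be the increment of \<open>X\<close> over the grid step that follows the
  last grid record before \<open>e\<close>, with \<open>R = 0\<close> if \<open>e\<close> falls into that step. By the Markov property at grid
  times, \<open>E[exp (l R)]\<close> is proportional to
  \<open>P(e \<le> \<delta>) + E[exp (l X\<^sub>\<delta>) (1 - exp (\<Phi> X\<^sub>\<delta>)); X\<^sub>\<delta> < 0, \<delta> < e]\<close>
  up to \<open>o(\<delta>)\<close>: from a depth \<open>z < 0\<close> the record level is regained before \<open>e\<close> with probability \<open>exp (\<Phi> z)\<close>,
  except for the overshoot over the level on the grid, which is at most \<open>d \<delta>\<close> because
  \<open>X\<^sub>t - X\<^sub>s \<le> d (t - s)\<close>. Since \<open>E[exp (l X\<^sub>\<delta>)] = exp (\<delta> \<psi> l)\<close> and \<open>X\<^sub>\<delta> / \<delta>\<close> tends to \<open>d\<close>, the limit after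
  normalisation at \<open>l = 0\<close> is \<open>(p + \<psi> l - \<psi> (l + \<Phi>) + \<Phi> d) / (\<Phi> d)\<close>, the Laplace transform of the claimed
  law; neither the Levy-Ito decomposition nor the compensation formula is needed. Finally \<open>R\<close> tends to the
  drop of \<open>X\<close> from its maximum at time \<open>G\<close>, since the supremum is almost surely approached at one time only.\<close>



section \<open>Dyadic grids and the last record of a path\<close>

text \<open>At every grid record the future starts afresh, so the expected number of records is a
  common factor for all l and cancels; only the relative error matters. Since
  \<open>weight 0 n\<close> has the exact order of the mesh, an overshoot correction of the order of
  the mesh would be fatal. It is harmless because it occurs only after a negative step, and with
  positive drift and finite variation the probability of a negative step tends to 0. The bound d on
  the slope of the paths comes from \<psi> l \<le> d l for all l \<ge> 0 through exponential moments
  of every order, and finite variation enters through the linear growth of \<psi>. Two things can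
  spoil the limit from the grid to the path: the record level may be approached again between grid
  times only, and the path may jump down at the killing time, which the supremum in the statement
  includes. Both events have probability tending to 0, but no summable rate is established; hence
  the passage to a subsequence, which does not affect the limit law.\<close>

definition grid :: "nat \<Rightarrow> nat \<Rightarrow> real" where
  "grid n k = real k / 2 ^ n"

lemma grid_nonneg [simp]: "0 \<le> grid n k"
  by (simp add: grid_def)

lemma grid_0 [simp]: "grid n 0 = 0"
  by (simp add: grid_def)

lemma grid_Suc: "grid n (Suc k) = grid n k + 1 / 2 ^ n"
  by (simp add: grid_def add_divide_distrib)

lemma grid_less_iff [simp]: "grid n i < grid n k \<longleftrightarrow> i < k"
  by (simp add: grid_def divide_less_cancel)

lemma grid_le_iff [simp]: "grid n i \<le> grid n k \<longleftrightarrow> i \<le> k"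
  by (simp add: grid_def divide_le_cancel)

lemma mesh_tendsto: "(\<lambda>n. 1 / 2 ^ n :: real) \<longlonglongrightarrow> 0"
  by real_asymp

text \<open>The \<open>+ 1\<close> puts the grid point strictly to the right of \<open>u\<close>, so
  that a right limit at \<open>u\<close> can be evaluated along it.\<close>

definition next_grid :: "nat \<Rightarrow> real \<Rightarrow> real" where
  "next_grid n u = grid n (nat \<lfloor>u * 2 ^ n\<rfloor> + 1)"

lemma next_grid:
  assumes "0 \<le> u"
  shows "u < next_grid n u" "next_grid n u \<le> u + 1 / 2 ^ n"
proof -
  have "real (nat \<lfloor>u * 2 ^ n\<rfloor> + 1) = of_int \<lfloor>u * 2 ^ n\<rfloor> + 1" using assms by (simp add: of_nat_nat)
  then have "u * 2 ^ n < real (nat \<lfloor>u * 2 ^ n\<rfloor> + 1)" "real (nat \<lfloor>u * 2 ^ n\<rfloor> + 1) \<le> u * 2 ^ n + 1" by linarith+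
  then show "u < next_grid n u" "next_grid n u \<le> u + 1 / 2 ^ n"
    by (simp_all add: next_grid_def grid_def field_simps)
qed

lemma next_grid_tendsto:
  assumes "0 \<le> u"
  shows "(\<lambda>n. next_grid n u) \<longlonglongrightarrow> u"
proof (rule tendsto_sandwich[OF _ _ tendsto_const])
  show "eventually (\<lambda>n. u \<le> next_grid n u) sequentially"
    using next_grid(1)[OF assms] by (intro always_eventually allI less_imp_le)
  show "eventually (\<lambda>n. next_grid n u \<le> u + 1 / 2 ^ n) sequentially"
    using next_grid(2)[OF assms] by (intro always_eventually allI)
  show "(\<lambda>n. u + 1 / 2 ^ n) \<longlonglongrightarrow> u" using tendsto_add[OF tendsto_const mesh_tendsto, of u] by simp
qed

lemma right_limit_next_grid:
  fixes f :: "real \<Rightarrow> real"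
  assumes "0 \<le> u" "(f \<longlongrightarrow> f u) (at_right u)"
  shows "(\<lambda>n. f (next_grid n u)) \<longlonglongrightarrow> f u"
  using next_grid(1)[OF assms(1)] next_grid_tendsto[OF assms(1)]
  by (intro filterlim_compose[OF assms(2)]) (simp add: filterlim_at less_imp_neq[symmetric] less_imp_le)

lemma grid_between:
  assumes "0 \<le> s" "s < t" "1 / 2 ^ n < t - s"
  shows "\<exists>k. s < grid n k \<and> grid n k < t"
proof -
  have "next_grid n s < t" using next_grid(2)[OF assms(1), of n] assms(3) by linarith
  then show ?thesis using next_grid(1)[OF assms(1), of n] unfolding next_grid_def by blast
qed

lemma eventually_grid_between:
  assumes "0 \<le> s" "s < t"
  shows "eventually (\<lambda>n. \<exists>k. s < grid n k \<and> grid n k < t) sequentially"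
proof -
  have "eventually (\<lambda>n. 1 / 2 ^ n < t - s) sequentially"
    using mesh_tendsto assms(2) by (intro order_tendstoD(2)) auto
  then show ?thesis by eventually_elim (use grid_between[OF assms] in blast)
qed

lemma ex_grid_between:
  assumes "0 \<le> s" "s < t"
  shows "\<exists>n k. s < grid n k \<and> grid n k < t"
  using eventually_grid_between[OF assms] unfolding eventually_sequentially by blast

text \<open>Ties go to the latest index: weak inequality up to \<open>k\<close>, strict afterwards.
  This is the last grid argmax, and the asymmetry makes it unique.\<close>

definition last_record :: "(real \<Rightarrow> real) \<Rightarrow> ennreal \<Rightarrow> nat \<Rightarrow> nat \<Rightarrow> bool" where
  "last_record f e n k \<longleftrightarrow> ennreal (grid n k) < e \<and>
     (\<forall>i. ennreal (grid n i) < e \<longrightarrow>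
       (if i \<le> k then f (grid n i) \<le> f (grid n k) else f (grid n i) < f (grid n k)))"

definition last_record_idx :: "(real \<Rightarrow> real) \<Rightarrow> ennreal \<Rightarrow> nat \<Rightarrow> nat" where
  "last_record_idx f e n = (LEAST k. last_record f e n k)"

text \<open>The default 0, taken when \<open>e\<close> falls into the next grid step, is where the
  atom at 0 of the limit law comes from.\<close>

definition record_drop :: "(real \<Rightarrow> real) \<Rightarrow> ennreal \<Rightarrow> nat \<Rightarrow> real" where
  "record_drop f e n = (let k = last_record_idx f e n in
     if ennreal (grid n (Suc k)) < e then f (grid n (Suc k)) - f (grid n k) else 0)"

lemma last_recordD:
  assumes "last_record f e n k"
  shows "ennreal (grid n k) < e"
    "ennreal (grid n i) < e \<Longrightarrow> i \<le> k \<Longrightarrow> f (grid n i) \<le> f (grid n k)"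
    "ennreal (grid n i) < e \<Longrightarrow> k < i \<Longrightarrow> f (grid n i) < f (grid n k)"
  using assms by (auto simp: last_record_def)

lemma last_record_unique:
  assumes "last_record f e n k" "last_record f e n l"
  shows "k = l"
proof -
  have *: "\<not> k < l" if "last_record f e n k" "last_record f e n l" for k l
  proof
    assume "k < l"
    have "f (grid n l) < f (grid n k)"
      by (rule last_recordD(3)[OF that(1) last_recordD(1)[OF that(2)] \<open>k < l\<close>])
    moreover have "f (grid n k) \<le> f (grid n l)"
      using last_recordD(2)[OF that(2) last_recordD(1)[OF that(1)]] \<open>k < l\<close> by simp
    ultimately show False by simp
  qed
  show ?thesis using *[OF assms] *[OF assms(2,1)] by simp
qed

lemma last_record_idx_eq: "last_record f e n k \<Longrightarrow> last_record_idx f e n = k"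
  unfolding last_record_idx_def by (metis LeastI last_record_unique)

section \<open>Deterministic analysis of a single killed path\<close>

locale killed_path =
  fixes f :: "real \<Rightarrow> real" and e :: ennreal and c :: real
  assumes right_cont: "\<And>t. 0 \<le> t \<Longrightarrow> (f \<longlongrightarrow> f t) (at_right t)"
    and e_gt_0: "0 < e"
    and upper: "\<And>s t. 0 \<le> s \<Longrightarrow> s \<le> t \<Longrightarrow> f t \<le> f s + c * (t - s)"
    and c_nonneg: "0 \<le> c"
    and drift: "e = \<infinity> \<Longrightarrow> filterlim f at_bot at_top"
begin

definition alive :: "real set" where
  "alive = {t. 0 \<le> t \<and> ennreal t < e}"

text \<open>The time set is open at \<open>e\<close>, whereas \<open>run_sup X (e \<omega>)\<close>
  includes \<open>e\<close>; \<open>SUP_closed\<close> reconciles the two.\<close>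

definition top_value :: real where
  "top_value = (SUP t\<in>alive. f t)"

lemma zero_alive: "0 \<in> alive"
  using e_gt_0 by (simp add: alive_def)

lemma alive_down: "t \<in> alive \<Longrightarrow> 0 \<le> s \<Longrightarrow> s \<le> t \<Longrightarrow> s \<in> alive"
  unfolding alive_def by (auto intro: le_less_trans[OF ennreal_leI])

lemma eventually_low:
  assumes "e = \<infinity>"
  shows "\<exists>T\<ge>0. \<forall>t\<ge>T. f t < y"
proof -
  have "eventually (\<lambda>t. f t < y) at_top"
    using drift[OF assms] by (simp add: filterlim_at_bot_dense)
  then obtain T where "\<And>t. t \<ge> T \<Longrightarrow> f t < y"
    by (auto simp: eventually_at_top_linorder)
  then show ?thesis by (intro exI[of _ "max 0 T"]) auto
qed

text \<open>Late times never compete for the supremum. For finite \<open>e\<close> the choice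
  \<open>T = e\<close> leaves nothing to check; for infinite \<open>e\<close> the path tends to
  minus infinity.\<close>

lemma alive_bounded_or_low: "\<exists>T\<ge>0. \<forall>t\<in>alive. T \<le> t \<longrightarrow> f t < y"
proof (cases "e = \<infinity>")
  case True
  then show ?thesis using eventually_low by (metis)
next
  case False
  then have *: "e = ennreal (enn2real e)" by (simp add: less_top)
  have "\<forall>t\<in>alive. t < enn2real e"
    using * unfolding alive_def by (metis (mono_tags, lifting) ennreal_less_iff mem_Collect_eq)
  then show ?thesis by (intro exI[of _ "enn2real e"]) force
qed

lemma upper_bound: "\<exists>b. \<forall>t\<in>alive. f t \<le> b"
proof -
  obtain T where T: "T \<ge> 0" "\<forall>t\<in>alive. T \<le> t \<longrightarrow> f t < 0"
    using alive_bounded_or_low by blast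
  have "f t \<le> max 0 (f 0 + c * T)" if "t \<in> alive" for t
  proof (cases "T \<le> t")
    case False
    have t0: "0 \<le> t" using that by (simp add: alive_def)
    have "f t \<le> f 0 + c * t" using upper[of 0 t] t0 by simp
    also have "\<dots> \<le> f 0 + c * T" using False c_nonneg by (simp add: mult_left_mono)
    finally show ?thesis by simp
  qed (use T that in force)
  then show ?thesis by blast
qed

lemma bdd_alive: "A \<subseteq> alive \<Longrightarrow> bdd_above (f ` A)"
  using upper_bound by (force simp: bdd_above_def)

lemma le_top: "t \<in> alive \<Longrightarrow> f t \<le> top_value"
  unfolding top_value_def by (intro cSUP_upper bdd_alive order.refl)

lemma near_top:
  assumes "y < top_value"
  shows "\<exists>t\<in>alive. y < f t"
  using assms zero_alive unfolding top_value_def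
  by (subst (asm) less_cSUP_iff) (auto intro: bdd_alive)

lemma alive_right:
  assumes "t \<in> alive"
  shows "\<exists>r>t. {t..<r} \<subseteq> alive"
proof (cases "e = \<infinity>")
  case True
  then have "alive = {0..}" unfolding alive_def by auto
  then have "{t..<t + 1} \<subseteq> alive" using assms by force
  then show ?thesis using less_add_one by blast
next
  case False
  then have *: "e = ennreal (enn2real e)" by (simp add: less_top)
  have "t < enn2real e" using assms * unfolding alive_def
    by (metis (mono_tags, lifting) ennreal_less_iff mem_Collect_eq)
  moreover have "{t..<enn2real e} \<subseteq> alive"
    using assms unfolding alive_def by (subst *) (auto simp: ennreal_less_iff)
  ultimately show ?thesis by blast
qed

lemma right_nbhd:
  assumes "t \<in> alive" "y < f t"
  shows "\<exists>r>t. {t..<r} \<subseteq> alive \<and> (\<forall>s\<in>{t..<r}. y < f s)"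
proof -
  obtain r where r: "r > t" "{t..<r} \<subseteq> alive" using alive_right[OF assms(1)] by blast
  have "0 \<le> t" using assms(1) by (simp add: alive_def)
  then have "eventually (\<lambda>s. y < f s) (at_right t)"
    using right_cont order_tendstoD(1) assms(2) by blast
  then obtain b where b: "b > t" "\<And>s. t < s \<Longrightarrow> s < b \<Longrightarrow> y < f s"
    unfolding eventually_at_right_field by blast
  show ?thesis
    by (rule exI[of _ "min b r"]) (use r b assms in \<open>force simp: not_less\<close>)
qed

lemma eventually_grid_above:
  assumes "t \<in> alive" "y < f t"
  shows "eventually (\<lambda>n. \<exists>k. grid n k \<in> alive \<and> t < grid n k \<and> y < f (grid n k)) sequentially"
proof -
  obtain r where r: "r > t" "{t..<r} \<subseteq> alive" "\<forall>s\<in>{t..<r}. y < f s"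
    using right_nbhd[OF assms] by blast
  have "0 \<le> t" using assms(1) by (simp add: alive_def)
  from eventually_grid_between[OF this r(1)] show ?thesis
    by eventually_elim (use r in force)
qed

text \<open>Only finitely many grid values can be as high as \<open>f 0\<close>, so the grid
  supremum is attained and has a last argmax.\<close>

lemma ex_last_record: "\<exists>k. last_record f e n k"
proof -
  obtain T where T: "T \<ge> 0" "\<forall>t\<in>alive. T \<le> t \<longrightarrow> f t < f 0"
    using alive_bounded_or_low by blast
  define K where "K = {k. grid n k \<in> alive \<and> f 0 \<le> f (grid n k)}"
  have "K \<subseteq> {k. grid n k \<le> T}" unfolding K_def using T(2) by force
  also have "\<dots> \<subseteq> {..nat \<lceil>T * 2 ^ n\<rceil>}"
    by (auto simp: grid_def field_simps) linarith
  finally have fin: "finite K" by (rule finite_subset) (rule finite_atMost)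
  have K0: "0 \<in> K" using zero_alive by (simp add: K_def)
  define m where "m = Max ((\<lambda>k. f (grid n k)) ` K)"
  define K' where "K' = {k\<in>K. f (grid n k) = m}"
  have "m \<in> (\<lambda>k. f (grid n k)) ` K" unfolding m_def using fin K0 by (intro Max_in) auto
  then have K': "K' \<noteq> {}" "finite K'" using fin by (auto simp: K'_def)
  define k where "k = Max K'"
  have kK: "k \<in> K'" unfolding k_def using K' by (intro Max_in)
  have le: "f (grid n i) \<le> m" if "grid n i \<in> alive" for i
  proof (cases "i \<in> K")
    case True then show ?thesis unfolding m_def using fin by auto
  next
    case False
    then have "f (grid n i) < f 0" using that by (auto simp: K_def)
    also have "f 0 \<le> m" unfolding m_def using fin K0 by (intro Max_ge) (auto intro: image_eqI[of _ _ 0])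
    finally show ?thesis by simp
  qed
  have lt: "f (grid n i) < m" if "grid n i \<in> alive" "k < i" for i
  proof (rule ccontr)
    assume "\<not> ?thesis"
    with le[OF that(1)] have eq: "f (grid n i) = m" by simp
    have "f 0 \<le> m" unfolding m_def using fin K0 by (intro Max_ge) (auto intro: image_eqI[of _ _ 0])
    then have "i \<in> K'" using eq that by (simp add: K'_def K_def)
    then show False using that(2) K'(2) unfolding k_def by (simp add: leD)
  qed
  show ?thesis
    unfolding last_record_def
    by (rule exI[of _ k]) (use kK le lt in \<open>auto simp: K'_def K_def alive_def\<close>)
qed

lemma last_record_idx: "last_record f e n (last_record_idx f e n)"
  using ex_last_record last_record_idx_eq by metis

text \<open>Right continuity keeps a nearly maximal value on a short interval, and every fine grid
  has a point in it.\<close>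

lemma last_record_tendsto: "(\<lambda>n. f (grid n (last_record_idx f e n))) \<longlonglongrightarrow> top_value"
proof (rule order_tendstoI)
  fix y assume "y < top_value"
  then obtain t where "t \<in> alive" "y < f t" using near_top by blast
  from eventually_grid_above[OF this]
  show "eventually (\<lambda>n. y < f (grid n (last_record_idx f e n))) sequentially"
  proof eventually_elim
    case (elim n)
    then obtain k where "grid n k \<in> alive" "y < f (grid n k)" by blast
    then have "f (grid n k) \<le> f (grid n (last_record_idx f e n))"
      using last_recordD(2,3)[OF last_record_idx[of n], of k]
      by (cases "k \<le> last_record_idx f e n") (auto simp: alive_def)
    then show ?case using \<open>y < f (grid n k)\<close> by simp
  qed
next
  fix y assume "top_value < y"
  have "grid n (last_record_idx f e n) \<in> alive" for n
    using last_recordD(1)[OF last_record_idx[of n]] by (simp add: alive_def)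
  then have "f (grid n (last_record_idx f e n)) < y" for n
    using \<open>top_value < y\<close> le_top by (meson le_less_trans)
  then show "eventually (\<lambda>n. f (grid n (last_record_idx f e n)) < y) sequentially" by simp
qed

end

context killed_path
begin

text \<open>Upward jumps are excluded by \<open>upper\<close>. A downward jump at \<open>t\<close>
  would make the grid step straddling \<open>t\<close> a decrease on all fine grids, which
  \<open>freq\<close> denies for infinitely many of them.\<close>

lemma no_jump:
  assumes e: "e = ennreal t" "0 < t" and left: "(f \<longlongrightarrow> l) (at_left t)"
    and freq: "\<exists>\<^sub>F n in sequentially. \<forall>k. grid n k < t \<and> t \<le> grid n (Suc k) \<longrightarrow>
      f (grid n k) \<le> f (grid n (Suc k))"
  shows "(f \<longlongrightarrow> f t) (at_left t)"
proof -
  \<comment> \<open>The index of the step with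
    \<open>grid n (k n) < t \<le> grid n (Suc (k n))\<close>. Its right end may equal
    \<open>t\<close>, a case that the right limit at \<open>t\<close> does not cover and that
    \<open>l2\<close> treats separately.\<close>
  define k where "k n = nat (\<lceil>t * 2 ^ n\<rceil> - 1)" for n
  have k: "grid n (k n) < t \<and> t \<le> grid n (Suc (k n))" for n
  proof -
    have "0 < \<lceil>t * 2 ^ n\<rceil>" using e(2) by simp
    then have "real (k n) = of_int \<lceil>t * 2 ^ n\<rceil> - 1" unfolding k_def by (simp add: of_nat_nat)
    then have "real (k n) < t * 2 ^ n" "t * 2 ^ n \<le> real (Suc (k n))" by linarith+
    then show ?thesis by (simp add: grid_def pos_divide_less_eq pos_le_divide_eq)
  qed
  have near: "(\<lambda>n. t - 1 / 2 ^ n) \<longlonglongrightarrow> t" "(\<lambda>n. t + 1 / 2 ^ n) \<longlonglongrightarrow> t"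
    using tendsto_diff[OF tendsto_const mesh_tendsto, of t]
      tendsto_add[OF tendsto_const mesh_tendsto, of t] by simp_all
  have g1: "(\<lambda>n. grid n (k n)) \<longlonglongrightarrow> t"
    using k by (intro tendsto_sandwich[OF _ _ near(1) tendsto_const])
      (auto intro!: always_eventually less_imp_le simp: grid_Suc algebra_simps)
  have g2: "(\<lambda>n. grid n (Suc (k n))) \<longlonglongrightarrow> t"
    using k by (intro tendsto_sandwich[OF _ _ tendsto_const near(2)])
      (auto intro!: always_eventually less_imp_le simp: grid_Suc)
  have l1: "(\<lambda>n. f (grid n (k n))) \<longlonglongrightarrow> l"
    using k g1 by (intro filterlim_compose[OF left]) (simp add: filterlim_at less_imp_neq)
  have l2: "(\<lambda>n. f (grid n (Suc (k n)))) \<longlonglongrightarrow> f t"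
  proof (rule tendstoI)
    fix \<epsilon> :: real assume "\<epsilon> > 0"
    then have "eventually (\<lambda>s. dist (f s) (f t) < \<epsilon>) (at_right t)"
      using right_cont[of t] e(2) tendstoD by fastforce
    then obtain b where b: "b > t" "\<And>s. t < s \<Longrightarrow> s < b \<Longrightarrow> dist (f s) (f t) < \<epsilon>"
      unfolding eventually_at_right_field by blast
    have "eventually (\<lambda>n. grid n (Suc (k n)) < b) sequentially"
      using order_tendstoD(2)[OF g2 b(1)] .
    then show "eventually (\<lambda>n. dist (f (grid n (Suc (k n)))) (f t) < \<epsilon>) sequentially"
    proof eventually_elim
      case (elim n)
      then show ?case using b(2)[of "grid n (Suc (k n))"] k[of n] \<open>\<epsilon> > 0\<close>
        by (cases "grid n (Suc (k n)) = t") auto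
    qed
  qed
  have "l \<le> f t"
  proof (rule ccontr)
    assume neg: "\<not> l \<le> f t"
    have "(\<lambda>n. f (grid n (k n)) - f (grid n (Suc (k n)))) \<longlonglongrightarrow> l - f t"
      by (intro tendsto_diff l1 l2)
    then have "eventually (\<lambda>n. f (grid n (k n)) - f (grid n (Suc (k n))) > 0) sequentially"
      using neg by (intro order_tendstoD(1)) auto
    then have "eventually (\<lambda>n. \<not> (\<forall>k. grid n k < t \<and> t \<le> grid n (Suc k) \<longrightarrow>
      f (grid n k) \<le> f (grid n (Suc k)))) sequentially"
    proof eventually_elim
      case (elim n)
      then have "\<not> f (grid n (k n)) \<le> f (grid n (Suc (k n)))" by simp
      then show ?case using k by blast
    qed
    with freq show False unfolding frequently_def by simp
  qed
  moreover have "f t \<le> l"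
  proof -
    have 1: "((\<lambda>s. f s + c * (t - s)) \<longlongrightarrow> l + c * (t - t)) (at_left t)"
      by (intro tendsto_intros left)
    have 2: "eventually (\<lambda>s. f t \<le> f s + c * (t - s)) (at_left t)"
      unfolding eventually_at_left_field using e(2) upper by (intro exI[of _ 0]) auto
    show ?thesis using tendsto_lowerbound[OF 1 2] by simp
  qed
  ultimately have "f t = l" by simp
  then show ?thesis using left by simp
qed

end

text \<open>Comparing the suprema at grid times is enough, since a grid time separates any two
  distinct places of approach. Suprema take the place of maximisers because at a downward jump the
  supremum may be approached from the left only.\<close>

locale killed_path_unique_max = killed_path +
  assumes unique_max: "\<And>n k. grid n k \<in> alive \<Longrightarrow>
      (SUP t\<in>{0..grid n k}. f t) \<noteq> (SUP t\<in>{t\<in>alive. grid n k \<le> t}. f t)"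
    and no_jump_at_e: "\<And>t. e = ennreal t \<Longrightarrow> 0 < t \<Longrightarrow> (f \<longlongrightarrow> f t) (at_left t)"
begin

text \<open>The form in which uniqueness is applied: approach of the supremum on both sides of a
  live grid time is contradictory, whether or not it is attained.\<close>

lemma unique_max':
  assumes q: "grid n k \<in> alive" and
    1: "\<And>y. y < top_value \<Longrightarrow> \<exists>t\<in>{0..grid n k}. y < f t" and
    2: "\<And>y. y < top_value \<Longrightarrow> \<exists>t\<in>alive. grid n k \<le> t \<and> y < f t"
  shows False
proof -
  have sub: "{0..grid n k} \<subseteq> alive" using q alive_down by auto
  have "(SUP t\<in>{0..grid n k}. f t) = top_value"
  proof (rule antisym)
    show "(SUP t\<in>{0..grid n k}. f t) \<le> top_value"
      using sub by (intro cSUP_least) (auto intro: le_top)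
    show "top_value \<le> (SUP t\<in>{0..grid n k}. f t)"
    proof (rule dense_le)
      fix y assume "y < top_value"
      then obtain t where "t\<in>{0..grid n k}" "y < f t" using 1 by blast
      then show "y \<le> (SUP t\<in>{0..grid n k}. f t)"
        by (intro cSUP_upper2[where x = t] bdd_alive[OF sub]) auto
    qed
  qed
  moreover have "(SUP t\<in>{t\<in>alive. grid n k \<le> t}. f t) = top_value"
  proof (rule antisym)
    show "(SUP t\<in>{t\<in>alive. grid n k \<le> t}. f t) \<le> top_value"
      using q by (intro cSUP_least) (auto intro: le_top)
    show "top_value \<le> (SUP t\<in>{t\<in>alive. grid n k \<le> t}. f t)"
    proof (rule dense_le)
      fix y assume "y < top_value"
      then obtain t where "t\<in>alive" "grid n k \<le> t" "y < f t" using 2 by blast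
      then show "y \<le> (SUP t\<in>{t\<in>alive. grid n k \<le> t}. f t)"
        by (intro cSUP_upper2[where x = t]) (auto intro: bdd_alive)
    qed
  qed
  ultimately show False using unique_max[OF q] by simp
qed

text \<open>\<open>t0\<close> is the infimum of the times by which values arbitrarily near the
  supremum have occurred. Up to a time left of \<open>t0\<close> there is no approach; a live grid
  time just right of \<open>t0\<close> has approach before it, hence none after it. So nearly
  maximal values sit near \<open>t0\<close>.\<close>

lemma ex_top_time:
  "\<exists>t0\<ge>0. ennreal t0 \<le> e \<and> (\<forall>\<kappa>>0. \<exists>y<top_value. \<forall>t\<in>alive. y < f t \<longrightarrow> \<bar>t - t0\<bar> < \<kappa>)"
proof -
  define S where "S = {t. 0 \<le> t \<and> (\<forall>y<top_value. \<exists>s\<in>alive. s \<le> t \<and> y < f s)}"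
  have S_up: "t \<in> S \<Longrightarrow> t \<le> u \<Longrightarrow> u \<in> S" for t u
    unfolding S_def mem_Collect_eq by (meson order_trans)
  obtain T where T: "T \<ge> 0" "\<forall>t\<in>alive. T \<le> t \<longrightarrow> f t < top_value - 1"
    using alive_bounded_or_low by blast
  have "T \<in> S"
    unfolding S_def
  proof (clarify, intro conjI allI impI T(1))
    fix y assume "y < top_value"
    then obtain t where "t \<in> alive" "max y (top_value - 1) < f t"
      using near_top[of "max y (top_value - 1)"] by auto
    then show "\<exists>s\<in>alive. s \<le> T \<and> y < f s" using T(2)
      by (metis dual_order.asym linorder_le_cases max_less_iff_conj)
  qed
  define t0 where "t0 = Inf S"
  have bdd: "bdd_below S" by (auto simp: S_def bdd_below_def)
  have t0_ge: "t0 \<ge> 0" unfolding t0_def using \<open>T \<in> S\<close> by (intro cInf_greatest) (auto simp: S_def)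
  have above: "t \<in> S" if "t0 < t" for t
    using that S_up \<open>T \<in> S\<close> bdd cInf_lessD[of S t] unfolding t0_def by fastforce
  have below: "t \<notin> S" if "t < t0" for t
    using that bdd cInf_lower[of t S] unfolding t0_def by force
  have "ennreal t0 \<le> e"
  proof (cases "e = \<infinity>")
    case False
    then have *: "e = ennreal (enn2real e)" by (simp add: less_top)
    have "s \<le> enn2real e" if "s \<in> alive" for s
      using that * unfolding alive_def
      by (metis (mono_tags, lifting) ennreal_less_iff mem_Collect_eq less_imp_le)
    then have "enn2real e \<in> S" using near_top unfolding S_def by auto
    then have "t0 \<le> enn2real e" unfolding t0_def using bdd by (intro cInf_lower)
    then show ?thesis by (subst *) (simp add: ennreal_leI)
  qed simp
  moreover have "\<exists>y<top_value. \<forall>t\<in>alive. y < f t \<longrightarrow> \<bar>t - t0\<bar> < \<kappa>" if kpos: "\<kappa> > 0" for \<kappa>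
  proof -
    have "\<exists>y1<top_value. \<forall>t\<in>alive. y1 < f t \<longrightarrow> t0 - \<kappa> < t"
    proof (cases "0 \<le> t0 - \<kappa>")
      case True
      have "t0 - \<kappa> \<notin> S" using below kpos by simp
      then obtain y where "y < top_value" "\<not> (\<exists>s\<in>alive. s \<le> t0 - \<kappa> \<and> y < f s)"
        using True unfolding S_def by blast
      then show ?thesis by (intro exI[of _ y]) (meson not_le)
    next
      case False
      then show ?thesis by (intro exI[of _ "top_value - 1"]) (auto simp: alive_def)
    qed
    then obtain y1 where y1: "y1<top_value" "\<forall>t\<in>alive. y1 < f t \<longrightarrow> t0 - \<kappa> < t" by blast
    obtain n k where q: "t0 < grid n k" "grid n k < t0 + \<kappa>"
      using ex_grid_between[OF t0_ge, of "t0 + \<kappa>"] kpos by auto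
    have "\<exists>y2<top_value. \<forall>t\<in>alive. y2 < f t \<longrightarrow> t < grid n k"
    proof (cases "grid n k \<in> alive")
      case True
      have 1: "\<exists>t\<in>{0..grid n k}. y < f t" if yt: "y < top_value" for y
      proof -
        obtain s where "s\<in>alive" "s \<le> grid n k" "y < f s"
          using above[OF q(1)] yt unfolding S_def by blast
        then show ?thesis by (intro bexI[of _ s]) (auto simp: alive_def)
      qed
      show ?thesis
      proof (rule ccontr)
        assume "\<not> ?thesis"
        then have "\<exists>t\<in>alive. grid n k \<le> t \<and> y < f t" if "y < top_value" for y
          using that by (meson not_le)
        from unique_max'[OF True 1 this] show False by blast
      qed
    next
      case False
      then have "t < grid n k" if "t \<in> alive" for t
        using alive_down[OF that grid_nonneg] by (meson not_le)
      then show ?thesis by (intro exI[of _ "top_value - 1"]) auto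
    qed
    then obtain y2 where "y2<top_value" "\<forall>t\<in>alive. y2 < f t \<longrightarrow> t < grid n k" by blast
    with y1 q show ?thesis
      by (intro exI[of _ "max y1 y2"]) (force simp: abs_less_iff)
  qed
  ultimately show ?thesis using t0_ge by blast
qed

definition top_time :: real where
  "top_time = (SOME t0. t0 \<ge> 0 \<and> ennreal t0 \<le> e \<and>
     (\<forall>\<kappa>>0. \<exists>y<top_value. \<forall>t\<in>alive. y < f t \<longrightarrow> \<bar>t - t0\<bar> < \<kappa>))"

lemma top_time:
  "top_time \<ge> 0" "ennreal top_time \<le> e"
  "\<And>\<kappa>. \<kappa> > 0 \<Longrightarrow> \<exists>y<top_value. \<forall>t\<in>alive. y < f t \<longrightarrow> \<bar>t - top_time\<bar> < \<kappa>"
  using someI_ex[OF ex_top_time] unfolding top_time_def[symmetric] by blast+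

lemma near_top_time:
  assumes "\<kappa> > 0" "y < top_value"
  shows "\<exists>t\<in>alive. y < f t \<and> \<bar>t - top_time\<bar> < \<kappa>"
proof -
  obtain y' where y': "y' < top_value" "\<forall>t\<in>alive. y' < f t \<longrightarrow> \<bar>t - top_time\<bar> < \<kappa>"
    using top_time(3)[OF assms(1)] by blast
  obtain t where "t \<in> alive" "max y y' < f t" using near_top[of "max y y'"] assms y' by auto
  then show ?thesis using y' by auto
qed

text \<open>A record after \<open>top_time\<close> would dominate the nearly maximal values before
  it, and the supremum would be approached on both sides of a grid time between
  \<open>top_time\<close> and \<open>t\<close>.\<close>

lemma record_le_top_time:
  assumes "t \<in> alive" "\<And>s. 0 \<le> s \<Longrightarrow> s \<le> t \<Longrightarrow> f s \<le> f t"
  shows "t \<le> top_time"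
proof (rule ccontr)
  assume "\<not> ?thesis"
  then obtain n k where q: "top_time < grid n k" "grid n k < t"
    using ex_grid_between[OF top_time(1), of t] by auto
  have 1: "\<exists>s\<in>{0..grid n k}. y < f s" if "y < top_value" for y
    using near_top_time[of "grid n k - top_time" y] that q
    by (auto simp: alive_def abs_less_iff)
  have "y < f t" if "y < top_value" for y
    using 1[OF that] assms(2) q by force
  then have 2: "\<exists>s\<in>alive. grid n k \<le> s \<and> y < f s" if "y < top_value" for y
    using assms(1) q that by (metis less_imp_le)
  have "grid n k \<in> alive" using alive_down[OF assms(1)] q by simp
  from unique_max'[OF this 1 2] show False .
qed

text \<open>The record is the first entry above a level \<open>y'\<close> that exceeds everything up
  to a grid time after \<open>t\<close> but stays below the supremum.\<close>

lemma ex_record_near_top_time: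
  assumes "0 \<le> t" "t < top_time"
  shows "\<exists>u\<in>alive. t < u \<and> u \<le> top_time \<and> (\<forall>s. 0 \<le> s \<longrightarrow> s \<le> u \<longrightarrow> f s \<le> f u)"
proof -
  obtain n k where q: "t < grid n k" "grid n k < top_time"
    using ex_grid_between[OF assms] by auto
  let ?q = "grid n k"
  have qa: "?q \<in> alive"
    using q top_time(2) unfolding alive_def
    by (auto intro: less_le_trans[of _ "ennreal top_time"] simp: ennreal_less_iff)
  have 2: "\<exists>s\<in>alive. ?q \<le> s \<and> y < f s" if yt: "y < top_value" for y
    proof -
    obtain s where "s\<in>alive" "y < f s" "\<bar>s - top_time\<bar> < top_time - ?q"
      using near_top_time[of "top_time - ?q" y] yt q by auto
    then show ?thesis by (intro bexI[of _ s]) auto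
  qed
  have "\<exists>y<top_value. \<forall>s\<in>{0..?q}. f s \<le> y"
    using unique_max'[OF qa _ 2] by (meson not_le)
  then obtain y where y: "y < top_value" "\<And>s. 0 \<le> s \<Longrightarrow> s \<le> ?q \<Longrightarrow> f s \<le> y" by auto
  obtain y' where y': "y < y'" "y' < top_value" using dense[OF y(1)] by blast
  define S where "S = {s\<in>alive. y' < f s}"
  define u where "u = Inf S"
  have Sne: "S \<noteq> {}" using near_top[OF y'(2)] by (auto simp: S_def)
  have Sq: "?q < s" if "s \<in> S" for s
    using that y(2)[of s] y'(1) unfolding S_def alive_def by force
  have bdd: "bdd_below S" using Sq by (intro bdd_belowI[of _ "?q"] less_imp_le)
  have uq: "?q \<le> u" unfolding u_def using Sne Sq by (intro cInf_greatest) force+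
  obtain s1 where "s1 \<in> S" using Sne by blast
  then have "u \<le> s1" unfolding u_def using bdd by (intro cInf_lower)
  then have ua: "u \<in> alive" using \<open>s1 \<in> S\<close> uq alive_down[of s1 u] order_trans[OF grid_nonneg uq]
    by (auto simp: S_def)
  have ut: "u \<le> top_time"
  proof (rule field_le_epsilon)
    fix \<kappa> :: real assume "\<kappa> > 0"
    from near_top_time[OF this y'(2)] obtain s where "s \<in> alive" "y' < f s" "s < top_time + \<kappa>"
      by (auto simp: abs_less_iff)
    moreover from this have "u \<le> s" unfolding u_def using bdd by (intro cInf_lower) (auto simp: S_def)
    ultimately show "u \<le> top_time + \<kappa>" by simp
  qed
  have low: "f s \<le> y'" if "0 \<le> s" "s < u" for s
  proof (rule ccontr)
    assume "\<not> ?thesis"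
    then have "s \<in> S" using alive_down[OF ua, of s] that by (simp add: S_def)
    then show False using cInf_lower[OF _ bdd, of s] that by (simp add: u_def)
  qed
  \<comment> \<open>\<open>u\<close> is an infimum and may lie outside \<open>S\<close>; right
    continuity carries the level over to it.\<close>
  have "y' \<le> f u"
  proof (rule ccontr)
    assume "\<not> ?thesis"
    moreover have "0 \<le> u" using ua by (simp add: alive_def)
    ultimately have "eventually (\<lambda>s. f s < y') (at_right u)"
      using right_cont order_tendstoD(2) by (metis not_le)
    then obtain b where b: "b > u" "\<And>s. u < s \<Longrightarrow> s < b \<Longrightarrow> f s < y'"
      unfolding eventually_at_right_field by blast
    obtain s where "s \<in> S" "s < b" using cInf_lessD[OF Sne, of b] b(1) unfolding u_def by auto
    moreover have "u \<le> s" unfolding u_def using bdd \<open>s \<in> S\<close> by (intro cInf_lower)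
    ultimately show False using b(2)[of s] \<open>\<not> y' \<le> f u\<close> unfolding S_def by force
  qed
  show ?thesis
  proof (intro bexI[OF _ ua] conjI allI impI)
    show "t < u" using q uq by simp
    fix s assume "0 \<le> s" "s \<le> u"
    then show "f s \<le> f u" using low[of s] \<open>y' \<le> f u\<close> by (cases "s = u") auto
  qed (rule ut)
qed

lemma alive_ennrealE:
  assumes "e \<noteq> \<infinity>"
  obtains t where "e = ennreal t" "0 < t" "alive = {0..<t}"
proof -
  have *: "e = ennreal (enn2real e)" using assms by (simp add: less_top)
  have "0 < enn2real e" using e_gt_0 assms by (simp add: enn2real_positive_iff less_top)
  moreover have "alive = {0..<enn2real e}" unfolding alive_def
    by (subst *) (auto simp: ennreal_less_iff)
  ultimately show ?thesis using * that by blast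
qed

text \<open>Identifies \<open>last_max_time\<close>: no record comes after \<open>top_time\<close>,
  and each earlier time is followed by a record no later than \<open>top_time\<close>.\<close>

lemma Sup_records:
  "Sup {ennreal t | t. 0 \<le> t \<and> ennreal t < e \<and> (SUP u\<in>{u. 0 \<le> u \<and> ennreal u \<le> ennreal t}. f u) = f t}
   = ennreal top_time" (is "Sup ?R = _")
proof -
  have interval: "{u. 0 \<le> u \<and> ennreal u \<le> ennreal t} = {0..t}" if "0 \<le> t" for t
    using that by auto
  have rec: "ennreal t \<in> ?R \<longleftrightarrow> t \<in> alive \<and> (\<forall>s. 0 \<le> s \<longrightarrow> s \<le> t \<longrightarrow> f s \<le> f t)" if "0 \<le> t" for t
  proof -
    have "(SUP u\<in>{0..t}. f u) = f t \<longleftrightarrow> (\<forall>s. 0 \<le> s \<longrightarrow> s \<le> t \<longrightarrow> f s \<le> f t)" if "t \<in> alive"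
    proof -
      have bdd: "bdd_above (f ` {0..t})" using alive_down[OF that] by (intro bdd_alive) auto
      show ?thesis
      proof
        assume "(SUP u\<in>{0..t}. f u) = f t"
        then show "\<forall>s. 0 \<le> s \<longrightarrow> s \<le> t \<longrightarrow> f s \<le> f t"
          using cSUP_upper[OF _ bdd] by (metis atLeastAtMost_iff)
      next
        assume "\<forall>s. 0 \<le> s \<longrightarrow> s \<le> t \<longrightarrow> f s \<le> f t"
        then show "(SUP u\<in>{0..t}. f u) = f t"
          using \<open>0 \<le> t\<close> bdd by (intro antisym cSUP_least cSUP_upper) auto
      qed
    qed
    then show ?thesis using that interval by (auto simp: alive_def)
  qed
  show ?thesis
  proof (rule antisym)
    show "Sup ?R \<le> ennreal top_time"
    proof (rule Sup_least)
      fix x assume x: "x \<in> ?R"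
      then obtain t where "x = ennreal t" "0 \<le> t" by blast
      then show "x \<le> ennreal top_time" using x rec[of t] record_le_top_time[of t]
        by (auto intro!: ennreal_leI)
    qed
    show "ennreal top_time \<le> Sup ?R"
    proof (rule dense_le)
      fix x assume "x < ennreal top_time"
      then obtain t where t: "x = ennreal t" "0 \<le> t" "t < top_time"
        by (metis ennreal_cases ennreal_less_iff infinity_ennreal_def less_top order_less_imp_not_less top.not_eq_extremum)
      then obtain u where "u\<in>alive" "t < u" "\<forall>s. 0 \<le> s \<longrightarrow> s \<le> u \<longrightarrow> f s \<le> f u"
        using ex_record_near_top_time by blast
      then have "ennreal u \<in> ?R" using rec[of u] by (auto simp: alive_def)
      then have "ennreal u \<le> Sup ?R" by (rule Sup_upper)
      then show "x \<le> Sup ?R" using t \<open>t < u\<close> by (meson ennreal_leI less_imp_le order_trans)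
    qed
  qed
qed

text \<open>Nearly maximal values occur just before \<open>e\<close>, and left continuity passes
  them to \<open>e\<close> itself. This is the case of zero drop.\<close>

lemma top_time_eq_e: "e = ennreal top_time \<Longrightarrow> f top_time = top_value"
proof -
  assume e: "e = ennreal top_time"
  then have "0 < top_time" using e_gt_0 top_time(1) by (cases "top_time = 0") auto
  have "ennreal t < e \<longleftrightarrow> t < top_time" if "0 \<le> t" for t
    by (subst e) (simp only: ennreal_less_iff that)
  then have alive: "alive = {0..<top_time}" unfolding alive_def by auto
  from no_jump_at_e[OF e \<open>0 < top_time\<close>] have lim: "(f \<longlongrightarrow> f top_time) (at_left top_time)" .
  show ?thesis
  proof (rule antisym)
    have "eventually (\<lambda>s. f s \<le> top_value) (at_left top_time)"
      unfolding eventually_at_left_field using \<open>0 < top_time\<close>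
      by (intro exI[of _ 0]) (auto intro!: le_top simp: alive)
    then show "f top_time \<le> top_value" using lim by (intro tendsto_upperbound[OF lim]) auto
    show "top_value \<le> f top_time"
    proof (rule ccontr)
      assume "\<not> ?thesis"
      then obtain y where y: "f top_time < y" "y < top_value" using dense by (meson not_le)
      have "eventually (\<lambda>s. f s < y) (at_left top_time)" by (rule order_tendstoD(2)[OF lim y(1)])
      then obtain b where b: "b < top_time" "\<And>s. b < s \<Longrightarrow> s < top_time \<Longrightarrow> f s < y"
        unfolding eventually_at_left_field by blast
      obtain t where "t \<in> alive" "y < f t" "\<bar>t - top_time\<bar> < top_time - b"
        using near_top_time[of "top_time - b" y] b y by auto
      moreover have "t < top_time" using \<open>t \<in> alive\<close> by (auto simp: alive)
      ultimately show False using b(2)[of t] by auto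
    qed
  qed
qed

text \<open>The only additional time is \<open>e\<close>, and its value is a left limit of values
  already counted.\<close>

lemma SUP_closed: "(SUP u\<in>{u. 0 \<le> u \<and> ennreal u \<le> e}. f u) = top_value"
proof (cases "e = \<infinity>")
  case True
  have "{u. 0 \<le> u \<and> ennreal u \<le> e} = alive" unfolding alive_def using True by auto
  then show ?thesis by (simp add: top_value_def)
next
  case False
  then obtain t where t: "e = ennreal t" "0 < t" "alive = {0..<t}" by (rule alive_ennrealE)
  then have *: "{u. 0 \<le> u \<and> ennreal u \<le> e} = {0..t}" by auto
  have "f t \<le> top_value"
  proof (rule tendsto_upperbound[OF no_jump_at_e[OF t(1,2)]])
    show "eventually (\<lambda>s. f s \<le> top_value) (at_left t)"
      unfolding eventually_at_left_field
    proof (intro exI[of _ 0] conjI allI impI t(2))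
      fix s assume "0 < s" "s < t"
      then show "f s \<le> top_value" by (intro le_top) (simp add: t(3))
    qed
  qed simp
  then have ub: "f s \<le> top_value" if "s \<in> {0..t}" for s
    using le_top[of s] that t(3) by (cases "s = t") auto
  show ?thesis unfolding *
  proof (rule antisym)
    show "(SUP u\<in>{0..t}. f u) \<le> top_value" using t ub by (intro cSUP_least) auto
    show "top_value \<le> (SUP u\<in>{0..t}. f u)"
      unfolding top_value_def using t ub
      by (intro cSUP_subset_mono) (auto intro!: bdd_aboveI2[of _ _ top_value])
  qed
qed

text \<open>The last grid record and the grid time after it both tend to \<open>top_time\<close>. By
  \<open>good\<close> the latter does not lie before \<open>top_time\<close>, so its value tends to
  \<open>f top_time\<close> by right continuity, while the record value tends to
  \<open>top_value\<close>. The difference thus sees the jump at the maximum.\<close>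

lemma record_drop_tendsto:
  assumes r: "filterlim r at_top sequentially"
    and good: "eventually (\<lambda>j. \<not> (\<exists>t\<in>alive. grid (r j) (Suc (last_record_idx f e (r j))) < t \<and>
      f (grid (r j) (last_record_idx f e (r j))) \<le> f t)) sequentially"
  shows "(\<lambda>j. record_drop f e (r j)) \<longlonglongrightarrow> f top_time - top_value"
proof (rule tendstoI)
  fix \<epsilon> :: real assume \<epsilon>: "\<epsilon> > 0"
  define g where "g n = grid n (last_record_idx f e n)" for n
  define h where "h n = grid n (Suc (last_record_idx f e n))" for n
  have ga: "g n \<in> alive" for n
    using last_recordD(1)[OF last_record_idx] by (simp add: g_def alive_def)
  have hg: "h n = g n + 1 / 2 ^ n" for n by (simp add: h_def g_def grid_Suc)
  have fg: "(\<lambda>n. f (g n)) \<longlonglongrightarrow> top_value" unfolding g_def by (rule last_record_tendsto)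
  have g_lim: "g \<longlonglongrightarrow> top_time"
  proof (rule tendstoI)
    fix \<kappa> :: real assume "\<kappa> > 0"
    then obtain y where y: "y < top_value" "\<forall>t\<in>alive. y < f t \<longrightarrow> \<bar>t - top_time\<bar> < \<kappa>"
      using top_time(3) by blast
    from order_tendstoD(1)[OF fg y(1)] show "eventually (\<lambda>n. dist (g n) top_time < \<kappa>) sequentially"
      by eventually_elim (use y ga in \<open>auto simp: dist_real_def\<close>)
  qed
  have h_lim: "h \<longlonglongrightarrow> top_time"
    using tendsto_add[OF g_lim mesh_tendsto] by (simp add: hg[abs_def])
  have "eventually (\<lambda>s. dist (f s) (f top_time) < \<epsilon> / 2) (at_right top_time)"
    using right_cont[OF top_time(1)] \<epsilon> tendstoD half_gt_zero by blast
  then obtain b where b: "b > top_time" "\<And>s. top_time < s \<Longrightarrow> s < b \<Longrightarrow> dist (f s) (f top_time) < \<epsilon> / 2"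
    unfolding eventually_at_right_field by blast
  have b': "dist (f s) (f top_time) < \<epsilon> / 2" if "top_time \<le> s" "s < b" for s
    using b(2)[of s] that \<epsilon> by (cases "s = top_time") auto
  have "eventually (\<lambda>n. ennreal top_time = e \<or> ennreal (h n) < e) sequentially"
  proof (cases "ennreal top_time = e")
    case False
    then have "ennreal top_time < e" using top_time(2) by simp
    then have "top_time \<in> alive" using top_time(1) by (simp add: alive_def)
    then obtain u where u: "u > top_time" "{top_time..<u} \<subseteq> alive" using alive_right by blast
    from order_tendstoD(2)[OF h_lim u(1)] show ?thesis
    proof eventually_elim
      case (elim n)
      have "max (h n) top_time \<in> alive" using u elim by auto
      then have "h n \<in> alive" using alive_down[of _ "h n"] by (auto simp: h_def)
      then show ?case by (simp add: alive_def)
    qed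
  qed simp
  then have "eventually (\<lambda>j. ennreal top_time = e \<or> ennreal (h (r j)) < e) sequentially"
    by (rule eventually_compose_filterlim[OF _ r])
  moreover have "eventually (\<lambda>j. h (r j) < b) sequentially"
    by (rule eventually_compose_filterlim[OF order_tendstoD(2)[OF h_lim b(1)] r])
  moreover have "eventually (\<lambda>j. dist (f (g (r j))) top_value < \<epsilon> / 2) sequentially"
    using \<epsilon> by (intro eventually_compose_filterlim[OF tendstoD[OF fg] r]) simp
  ultimately show "eventually (\<lambda>j. dist (record_drop f e (r j)) (f top_time - top_value) < \<epsilon>) sequentially"
    using good
  proof eventually_elim
    case (elim j)
    show ?case
    proof (cases "ennreal (h (r j)) < e")
      case False
      \<comment> \<open>If \<open>e\<close> falls into the step after the record, the maximum is at
        \<open>e\<close>; the default value and the limit are both 0.\<close>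
      then have "e = ennreal top_time" using elim by simp
      then have "f top_time - top_value = 0" using top_time_eq_e by simp
      moreover have "record_drop f e (r j) = 0" using False by (simp add: record_drop_def h_def)
      ultimately show ?thesis using \<epsilon> by simp
    next
      case True
      \<comment> \<open>Otherwise the path has a record after \<open>h (r j)\<close>, with a value
        at least that of the grid record, against \<open>good\<close>.\<close>
      have "top_time \<le> h (r j)"
      proof (rule ccontr)
        assume "\<not> ?thesis"
        then obtain u where u: "u \<in> alive" "h (r j) < u" "\<forall>s. 0 \<le> s \<longrightarrow> s \<le> u \<longrightarrow> f s \<le> f u"
          using ex_record_near_top_time[of "h (r j)"] by (auto simp: h_def)
        have "g (r j) \<le> h (r j)" unfolding g_def h_def by simp
        then have "g (r j) \<le> u" using u(2) by linarith
        then have "f (g (r j)) \<le> f u" using u(3) ga[of "r j"] by (auto simp: alive_def)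
        then show False using elim(4) u by (auto simp: g_def h_def)
      qed
      then have "dist (f (h (r j))) (f top_time) < \<epsilon> / 2" using b' elim by simp
      moreover have "record_drop f e (r j) = f (h (r j)) - f (g (r j))"
        using True by (simp add: record_drop_def h_def g_def Let_def)
      ultimately show ?thesis using elim(3) by (auto simp: dist_real_def abs_if split: if_splits)
    qed
  qed
qed

end



section \<open>Moments and Laplace transforms\<close>

text \<open>On the unit interval all moments are at most 1, so the Taylor polynomials of the
  characteristic function converge to it with error at most
  \<open>2 * \<bar>t\<bar> ^ n / fact n\<close>. The moments determine it, and it determines the
  law.\<close>

lemma moments_determine_distribution:
  fixes M N :: "real measure"
  assumes "real_distribution M" "real_distribution N"
    and "AE x in M. 0 \<le> x \<and> x \<le> 1" "AE x in N. 0 \<le> x \<and> x \<le> 1"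
    and moments: "\<And>k. (\<integral>\<^sup>+ x. ennreal (x ^ k) \<partial>M) = (\<integral>\<^sup>+ x. ennreal (x ^ k) \<partial>N)"
  shows "M = N"
proof -
  have char: "(\<lambda>n. \<Sum>k\<le>n. (\<i> * t) ^ k / fact k * complex_of_real (enn2real (\<integral>\<^sup>+ x. ennreal (x ^ k) \<partial>M)))
      \<longlonglongrightarrow> char M t"
    if M: "real_distribution M" and bnd: "AE x in M. 0 \<le> x \<and> x \<le> 1" for M :: "real measure" and t
  proof -
    interpret real_distribution M by fact
    have ae: "AE x in M. 0 \<le> x ^ k \<and> x ^ k \<le> 1" for k :: nat
      using bnd by eventually_elim (auto intro: power_le_one)
    have int: "integrable M (\<lambda>x. x ^ k)" for k
      using ae[of k] by (intro integrable_const_bound[where B = 1]) auto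
    have ex: "expectation (\<lambda>x. x ^ k) = enn2real (\<integral>\<^sup>+ x. ennreal (x ^ k) \<partial>M)" for k
      using ae[of k] by (intro integral_eq_nn_integral) auto
    have absle: "expectation (\<lambda>x. \<bar>x\<bar> ^ k) \<le> 1" for k
    proof -
      have "expectation (\<lambda>x. \<bar>x\<bar> ^ k) = expectation (\<lambda>x. x ^ k)"
        using bnd by (intro integral_cong_AE) auto
      also have "\<dots> \<le> expectation (\<lambda>x. 1)"
        using ae[of k] int by (intro integral_mono_AE) auto
      finally show ?thesis using prob_space by simp
    qed
    have "(\<lambda>n. 2 * \<bar>t\<bar> ^ n / fact n * 1) \<longlonglongrightarrow> 0"
      using tendsto_mult_right[OF summable_LIMSEQ_zero[OF summable_exp[of "\<bar>t\<bar>"]], of 2]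
      by (simp add: field_simps)
    then have "(\<lambda>n. char M t - (\<Sum>k\<le>n. (\<i> * t) ^ k / fact k * expectation (\<lambda>x. x ^ k))) \<longlonglongrightarrow> 0"
    proof (rule Lim_null_comparison[rotated])
      show "eventually (\<lambda>n. norm (char M t - (\<Sum>k\<le>n. (\<i> * t) ^ k / fact k * expectation (\<lambda>x. x ^ k)))
          \<le> 2 * \<bar>t\<bar> ^ n / fact n * 1) sequentially"
        using char_approx1[OF int, of t] absle
        by (intro always_eventually allI) (meson abs_ge_zero divide_nonneg_pos fact_gt_zero
            mult_left_mono mult_nonneg_nonneg order_trans zero_le_numeral zero_le_power)
    qed
    from tendsto_diff[OF tendsto_const[of "char M t"] this] show ?thesis
      by (simp add: ex)
  qed
  have "char M t = char N t" for t
    using LIMSEQ_unique[OF char[OF assms(1,3)]] char[OF assms(2,4), of t] by (simp add: moments)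
  then show ?thesis using assms(1,2) by (intro Levy_uniqueness) auto
qed

text \<open>The claimed law is built as a measure so that its moments can be compared with those of
  the law of the drop.\<close>

definition mixture :: "ennreal \<Rightarrow> real measure \<Rightarrow> (real \<Rightarrow> ennreal) \<Rightarrow> real measure" where
  "mixture a \<nu> \<rho> = measure_of UNIV (sets borel)
     (\<lambda>A. a * indicator A 0 + (\<integral>\<^sup>+ z. indicator A z * \<rho> z \<partial>\<nu>))"

lemma sets_mixture [simp, measurable_cong]: "sets (mixture a \<nu> \<rho>) = sets borel"
  unfolding mixture_def using sets.sigma_sets_eq[of borel]
  by (subst sets_measure_of) (auto simp: space_borel)

lemma space_mixture [simp]: "space (mixture a \<nu> \<rho>) = UNIV"
  using sets_eq_imp_space_eq[OF sets_mixture] by simp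

lemma nn_integral_mixture:
  assumes [measurable_cong]: "sets \<nu> = sets borel" and [measurable]: "\<rho> \<in> borel_measurable borel"
    and "h \<in> borel_measurable borel"
  shows "(\<integral>\<^sup>+ z. h z \<partial>mixture a \<nu> \<rho>) = a * h 0 + (\<integral>\<^sup>+ z. h z * \<rho> z \<partial>\<nu>)"
proof -
  have emeasure: "emeasure (mixture a \<nu> \<rho>) A = a * indicator A 0 + (\<integral>\<^sup>+ z. indicator A z * \<rho> z \<partial>\<nu>)"
    if "A \<in> sets borel" for A
    unfolding mixture_def
  proof (rule emeasure_measure_of_sigma)
    show "sigma_algebra UNIV (sets borel)" using sets.sigma_algebra_axioms[of borel] by simp
    show "positive (sets borel) (\<lambda>A. a * indicator A 0 + (\<integral>\<^sup>+ z. indicator A z * \<rho> z \<partial>\<nu>))"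
      by (simp add: positive_def)
    show "countably_additive (sets borel) (\<lambda>A. a * indicator A 0 + (\<integral>\<^sup>+ z. indicator A z * \<rho> z \<partial>\<nu>))"
    proof (rule countably_additiveI)
      fix A :: "nat \<Rightarrow> real set"
      assume A: "range A \<subseteq> sets borel" "disjoint_family A"
      then have [measurable]: "A i \<in> sets borel" for i by auto
      have "(\<Sum>i. a * indicator (A i) 0 + (\<integral>\<^sup>+ z. indicator (A i) z * \<rho> z \<partial>\<nu>))
        = (\<Sum>i. a * indicator (A i) 0) + (\<Sum>i. \<integral>\<^sup>+ z. indicator (A i) z * \<rho> z \<partial>\<nu>)"
        by (intro suminf_add[symmetric]) auto
      also have "(\<Sum>i. a * indicator (A i) 0) = a * indicator (\<Union>i. A i) 0"
        by (simp add: suminf_indicator[OF A(2)])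
      also have "(\<Sum>i. \<integral>\<^sup>+ z. indicator (A i) z * \<rho> z \<partial>\<nu>) = (\<integral>\<^sup>+ z. (\<Sum>i. indicator (A i) z * \<rho> z) \<partial>\<nu>)"
        by (intro nn_integral_suminf[symmetric]) measurable
      also have "\<dots> = (\<integral>\<^sup>+ z. indicator (\<Union>i. A i) z * \<rho> z \<partial>\<nu>)"
        by (simp add: suminf_indicator[OF A(2)])
      finally show "(\<Sum>i. a * indicator (A i) 0 + (\<integral>\<^sup>+ z. indicator (A i) z * \<rho> z \<partial>\<nu>)) =
        a * indicator (\<Union>i. A i) 0 + (\<integral>\<^sup>+ z. indicator (\<Union>i. A i) z * \<rho> z \<partial>\<nu>)" .
    qed
  qed fact
  show ?thesis
    using assms(3)
  proof (induction rule: borel_measurable_induct)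
    case (cong f g)
    then have "f = g" by auto
    then show ?case using cong by simp
  next
    case (set A)
    then show ?case by (simp add: emeasure)
  next
    case (mult u c)
    then show ?case by (simp add: nn_integral_cmult distrib_left mult_ac)
  next
    case (add u v)
    then have [measurable]: "u \<in> borel_measurable borel" "v \<in> borel_measurable borel" by auto
    have "(\<integral>\<^sup>+ z. (v z + u z) * \<rho> z \<partial>\<nu>) = (\<integral>\<^sup>+ z. v z * \<rho> z \<partial>\<nu>) + (\<integral>\<^sup>+ z. u z * \<rho> z \<partial>\<nu>)"
      by (simp add: distrib_right nn_integral_add)
    then show ?case using add by (simp add: nn_integral_add distrib_left add_ac)
  next
    case (seq U)
    then have [measurable]: "U i \<in> borel_measurable borel" for i by auto
    have inc: "incseq U" by fact
    have 1: "(\<integral>\<^sup>+ z. (SUP i. U i z) \<partial>mixture a \<nu> \<rho>) = (SUP i. \<integral>\<^sup>+ z. U i z \<partial>mixture a \<nu> \<rho>)"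
      by (intro nn_integral_monotone_convergence_SUP inc) measurable
    have 2: "(\<integral>\<^sup>+ z. (SUP i. U i z * \<rho> z) \<partial>\<nu>) = (SUP i. \<integral>\<^sup>+ z. U i z * \<rho> z \<partial>\<nu>)"
      using inc by (intro nn_integral_monotone_convergence_SUP)
        (auto simp: incseq_def le_fun_def intro!: mult_right_mono)
    have "(\<integral>\<^sup>+ z. (SUP i. U i z) \<partial>mixture a \<nu> \<rho>) = (SUP i. a * U i 0 + (\<integral>\<^sup>+ z. U i z * \<rho> z \<partial>\<nu>))"
      using 1 seq by simp
    also have "\<dots> = (SUP i. a * U i 0) + (SUP i. \<integral>\<^sup>+ z. U i z * \<rho> z \<partial>\<nu>)"
      using inc by (intro ennreal_SUP_add)
        (auto simp: incseq_def le_fun_def intro!: mult_left_mono mult_right_mono nn_integral_mono)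
    finally show ?case
      by (simp add: 2[symmetric] SUP_mult_left_ennreal SUP_mult_right_ennreal image_comp)
  qed
qed

text \<open>The Laplace transform is tested at the natural numbers only: these values are the moments
  of \<open>exp Z\<close>.\<close>

lemma (in prob_space) laplace_determines_mixture:
  assumes Z [measurable]: "Z \<in> borel_measurable M" and Z_le: "AE \<omega> in M. Z \<omega> \<le> (0::real)"
    and \<nu> [measurable_cong]: "sets \<nu> = sets borel" and \<nu>_neg: "AE z in \<nu>. z \<le> 0"
    and \<rho> [measurable]: "\<rho> \<in> borel_measurable borel"
    and laplace: "\<And>k :: nat. (\<integral>\<^sup>+ \<omega>. ennreal (exp (real k * Z \<omega>)) \<partial>M)
      = a + (\<integral>\<^sup>+ z. ennreal (exp (real k * z)) * \<rho> z \<partial>\<nu>)"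
    and h [measurable]: "h \<in> borel_measurable borel"
  shows "(\<integral>\<^sup>+ \<omega>. h (Z \<omega>) \<partial>M) = a * h 0 + (\<integral>\<^sup>+ z. h z * \<rho> z \<partial>\<nu>)"
proof -
  define K where "K = mixture a \<nu> \<rho>"
  have [measurable_cong]: "sets K = sets borel" by (simp add: K_def)
  have nnK: "(\<integral>\<^sup>+ z. h z \<partial>K) = a * h 0 + (\<integral>\<^sup>+ z. h z * \<rho> z \<partial>\<nu>)" if "h \<in> borel_measurable borel" for h
    unfolding K_def using that by (intro nn_integral_mixture \<nu> \<rho>)
  \<comment> \<open>The transform at \<open>k = 0\<close> already says that the candidate has mass
    1.\<close>
  have total: "emeasure K UNIV = 1"
    using laplace[of 0] nnK[of "\<lambda>_. 1"] by (simp add: emeasure_space_1 K_def)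
  interpret K: prob_space K by rule (simp add: K_def total[unfolded K_def])
  have K_neg: "AE z in K. z \<le> 0"
  proof -
    have "(\<integral>\<^sup>+ z. indicator {z. \<not> z \<le> 0} z \<partial>K) = (\<integral>\<^sup>+ z. indicator {z. \<not> z \<le> 0} z * \<rho> z \<partial>\<nu>)"
      by (subst nnK) auto
    also have "\<dots> = (\<integral>\<^sup>+ z. 0 \<partial>\<nu>)"
      using \<nu>_neg by (intro nn_integral_cong_AE) auto
    finally show ?thesis by (intro AE_I[where N = "{z. \<not> z \<le> 0}"]) (auto simp: K_def)
  qed
  have "distr M borel (\<lambda>\<omega>. exp (Z \<omega>)) = distr K borel exp"
  proof (rule moments_determine_distribution)
    show "real_distribution (distr M borel (\<lambda>\<omega>. exp (Z \<omega>)))" by (intro real_distribution_distr) simp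
    show "real_distribution (distr K borel exp)" by (intro K.real_distribution_distr) simp
    show "AE x in distr M borel (\<lambda>\<omega>. exp (Z \<omega>)). 0 \<le> x \<and> x \<le> 1"
      using Z_le by (subst AE_distr_iff) auto
    show "AE x in distr K borel exp. 0 \<le> x \<and> x \<le> 1"
      using K_neg by (subst AE_distr_iff) auto
    fix k :: nat
    have "(\<integral>\<^sup>+ x. ennreal (x ^ k) \<partial>distr K borel exp) = (\<integral>\<^sup>+ z. ennreal (exp (real k * z)) \<partial>K)"
      by (simp add: nn_integral_distr exp_of_nat_mult)
    also have "\<dots> = (\<integral>\<^sup>+ \<omega>. ennreal (exp (real k * Z \<omega>)) \<partial>M)"
      by (subst nnK) (auto simp: laplace)
    also have "\<dots> = (\<integral>\<^sup>+ x. ennreal (x ^ k) \<partial>distr M borel (\<lambda>\<omega>. exp (Z \<omega>)))"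
      by (simp add: nn_integral_distr exp_of_nat_mult)
    finally show "(\<integral>\<^sup>+ x. ennreal (x ^ k) \<partial>distr M borel (\<lambda>\<omega>. exp (Z \<omega>)))
      = (\<integral>\<^sup>+ x. ennreal (x ^ k) \<partial>distr K borel exp)" by simp
  qed
  then have "(\<integral>\<^sup>+ x. h (ln x) \<partial>distr M borel (\<lambda>\<omega>. exp (Z \<omega>))) = (\<integral>\<^sup>+ x. h (ln x) \<partial>distr K borel exp)"
    by simp
  then show ?thesis by (simp add: nn_integral_distr nnK)
qed



section \<open>The Laplace exponent\<close>

lemma exp_minus_linear_bounds:
  fixes x :: real
  assumes "x \<le> 0"
  shows "0 \<le> exp x - 1 - x" "exp x - 1 - x \<le> x\<^sup>2 / 2"
proof -
  show "0 \<le> exp x - 1 - x" using exp_ge_add_one_self[of x] by linarith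
  show "exp x - 1 - x \<le> x\<^sup>2 / 2"
  proof -
    have "(\<lambda>x. x\<^sup>2 / 2 - (exp x - 1 - x)) x \<ge> (\<lambda>x. x\<^sup>2 / 2 - (exp x - 1 - x)) 0"
    proof (rule DERIV_nonpos_imp_nonincreasing[OF assms])
      fix y :: real assume "y \<le> 0"
      have "((\<lambda>x. x\<^sup>2 / 2 - (exp x - 1 - x)) has_real_derivative (y - (exp y - 1))) (at y)"
        by (auto intro!: derivative_eq_intros simp: field_simps)
      moreover have "y - (exp y - 1) \<le> 0" using exp_ge_add_one_self[of y] by linarith
      ultimately show "\<exists>z. ((\<lambda>x. x\<^sup>2 / 2 - (exp x - 1 - x)) has_real_derivative z) (at y) \<and> z \<le> 0"
        by blast
    qed
    then show ?thesis by simp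
  qed
qed

section \<open>Exponents of general triplets\<close>

locale levy_exponent =
  fixes \<mu> \<sigma> :: real and \<nu> :: "real measure" and \<psi> :: "real \<Rightarrow> real"
  assumes sets_\<nu> [measurable_cong, simp]: "sets \<nu> = sets borel"
    and \<nu>_nonneg: "emeasure \<nu> {0..} = 0"
    and \<nu>_square: "(\<integral>\<^sup>+ y. ennreal (min 1 (y\<^sup>2)) \<partial>\<nu>) < \<infinity>"
    and \<psi>_triplet: "\<And>l. 0 \<le> l \<Longrightarrow> \<psi> l = \<sigma>\<^sup>2 / 2 * l\<^sup>2 + \<mu> * l
          + (\<integral>y. exp (l * y) - indicator {-1..<0} y * l * y - 1 \<partial>\<nu>)"
begin

lemma \<nu>_neg: "AE y in \<nu>. y < 0"
  using \<nu>_nonneg by (intro AE_I[where N = "{0..}"]) auto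

lemma integrable_square: "integrable \<nu> (\<lambda>y. min 1 (y\<^sup>2))"
  using \<nu>_square by (intro integrableI_bounded) auto

definition compensated :: "real \<Rightarrow> real \<Rightarrow> real" where
  "compensated l y = exp (l * y) - indicator {-1..<0} y * l * y - 1"

lemma compensated_measurable [measurable]: "compensated l \<in> borel_measurable borel"
  unfolding compensated_def[abs_def] by measurable

text \<open>For \<open>y \<ge> -1\<close> these are Taylor bounds at \<open>l * y \<le> 0\<close>;
  for \<open>y < -1\<close> nothing is compensated and the integrand lies between -1 and 0.\<close>

lemma compensated_bounds:
  assumes "0 \<le> l" "y < 0"
  shows "compensated l y \<le> l\<^sup>2 / 2 * min 1 (y\<^sup>2)" "- min 1 (y\<^sup>2) \<le> compensated l y"
proof -
  have ly: "l * y \<le> 0" using assms by (simp add: mult_nonneg_nonpos)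
  show "compensated l y \<le> l\<^sup>2 / 2 * min 1 (y\<^sup>2)"
  proof (cases "y \<ge> -1")
    case True
    then have "y\<^sup>2 \<le> 1" using assms by (simp add: abs_square_le_1 abs_le_iff)
    then show ?thesis using exp_minus_linear_bounds(2)[OF ly] assms True
      by (simp add: compensated_def power_mult_distrib)
  next
    case False
    then have "compensated l y \<le> 0" using ly by (simp add: compensated_def)
    then show ?thesis by (smt (verit) mult_nonneg_nonneg zero_le_power2 divide_nonneg_pos)
  qed
  show "- min 1 (y\<^sup>2) \<le> compensated l y"
  proof (cases "y \<ge> -1")
    case True
    then show ?thesis using exp_minus_linear_bounds(1)[OF ly] assms
      by (simp add: compensated_def) (smt (verit) zero_le_power2)
  next
    case False
    then have "1 < y\<^sup>2" using power_strict_mono[of 1 "-y" 2] by simp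
    then show ?thesis using False by (simp add: compensated_def)
  qed
qed

lemma integrable_compensated: "0 \<le> l \<Longrightarrow> integrable \<nu> (compensated l)"
proof (rule Bochner_Integration.integrable_bound)
  assume l: "0 \<le> l"
  show "integrable \<nu> (\<lambda>y. (l\<^sup>2 / 2 + 1) * min 1 (y\<^sup>2))" using integrable_square by simp
  show "AE y in \<nu>. norm (compensated l y) \<le> norm ((l\<^sup>2 / 2 + 1) * min 1 (y\<^sup>2))"
    using \<nu>_neg
  proof eventually_elim
    case (elim y)
    have "0 \<le> min 1 (y\<^sup>2)" "0 \<le> l\<^sup>2 / 2 * min 1 (y\<^sup>2)" by simp_all
    moreover have "(l\<^sup>2 / 2 + 1) * min 1 (y\<^sup>2) = l\<^sup>2 / 2 * min 1 (y\<^sup>2) + min 1 (y\<^sup>2)"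
      by (simp only: distrib_right mult_1_left)
    ultimately show ?case using compensated_bounds[OF l elim] unfolding real_norm_def by linarith
  qed
qed measurable

lemma \<psi>_eq: "0 \<le> l \<Longrightarrow> \<psi> l = \<sigma>\<^sup>2 / 2 * l\<^sup>2 + \<mu> * l + (\<integral>y. compensated l y \<partial>\<nu>)"
  using \<psi>_triplet by (simp add: compensated_def)

lemma \<psi>_0 [simp]: "\<psi> 0 = 0"
  using \<psi>_triplet[of 0] by simp

text \<open>A crude bound available for every triplet. It controls tilted exponential moments in the
  derivation of linear growth.\<close>

lemma \<psi>_quadratic: "\<exists>K\<ge>0. \<forall>l\<ge>1. \<psi> l \<le> K * l\<^sup>2"
proof -
  define I where "I = (\<integral>y. min 1 (y\<^sup>2) \<partial>\<nu>)"
  have I0: "0 \<le> I" unfolding I_def by (intro Bochner_Integration.integral_nonneg) auto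
  show ?thesis
  proof (intro exI[of _ "\<sigma>\<^sup>2 / 2 + \<bar>\<mu>\<bar> + I / 2"] conjI allI impI)
    show "0 \<le> \<sigma>\<^sup>2 / 2 + \<bar>\<mu>\<bar> + I / 2" using I0 by simp
    fix l :: real assume l: "1 \<le> l"
    have "(\<integral>y. compensated l y \<partial>\<nu>) \<le> (\<integral>y. l\<^sup>2 / 2 * min 1 (y\<^sup>2) \<partial>\<nu>)"
      using l \<nu>_neg integrable_square integrable_compensated[of l] compensated_bounds(1)[of l]
      by (intro integral_mono_AE) auto
    moreover have "\<mu> * l \<le> \<bar>\<mu>\<bar> * l\<^sup>2"
    proof -
      have "\<mu> * l \<le> \<bar>\<mu>\<bar> * l" using l by (intro mult_right_mono) auto
      also have "\<dots> \<le> \<bar>\<mu>\<bar> * l\<^sup>2" using l by (intro mult_left_mono) (auto simp: power2_eq_square)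
      finally show ?thesis .
    qed
    ultimately show "\<psi> l \<le> (\<sigma>\<^sup>2 / 2 + \<bar>\<mu>\<bar> + I / 2) * l\<^sup>2"
      using l by (simp add: \<psi>_eq I_def algebra_simps)
  qed
qed

end

text \<open>Linear growth of the exponent is how finite variation of the paths enters.\<close>

locale levy_exponent_fv = levy_exponent +
  assumes linear_growth: "\<exists>C. \<forall>l\<ge>1. \<psi> l \<le> C * l"
begin

text \<open>Dividing \<open>\<psi> l\<close> by \<open>l\<close> leaves a Gaussian term, \<mu> and
  an integral whose integrand on small jumps is the one displayed. Both displayed quantities are
  nonnegative, so linear growth bounds each of them uniformly in \<open>l\<close>.\<close>

lemma small_jumps_bound:
  "\<exists>B. \<forall>l\<ge>1. \<sigma>\<^sup>2 / 2 * l \<le> B \<and>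
     (\<integral>\<^sup>+ y. ennreal (indicator {-1..<0} y * (- y - (1 - exp (l * y)) / l)) \<partial>\<nu>) \<le> ennreal B"
proof -
  obtain C where C: "\<And>l. l \<ge> 1 \<Longrightarrow> \<psi> l \<le> C * l" using linear_growth by blast
  define I where "I = (\<integral>y. min 1 (y\<^sup>2) \<partial>\<nu>)"
  show ?thesis
  \<comment> \<open>\<open>C\<close> is the growth constant; \<open>I\<close> pays for the large
    jumps, where \<open>compensated l y / l\<close> may be negative but not below
    \<open>- min 1 (y\<^sup>2)\<close>.\<close>
  proof (intro exI[of _ "C - \<mu> + I"] allI impI conjI)
    fix l :: real assume l: "1 \<le> l"
    let ?q = "\<lambda>y. indicator {-1..<0} y * (- y - (1 - exp (l * y)) / l)"
    have le: "?q y \<le> compensated l y / l + min 1 (y\<^sup>2)" if "y < 0" for y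
    proof (cases "y \<ge> -1")
      case True
      then have "?q y = compensated l y / l" using that l by (simp add: compensated_def field_simps)
      then show ?thesis by simp
    next
      case False
      have "- min 1 (y\<^sup>2) \<le> compensated l y" using compensated_bounds(2)[of l y] l that by simp
      then have "- (min 1 (y\<^sup>2) / l) \<le> compensated l y / l" using l
        by (metis divide_right_mono minus_divide_left order.trans zero_le_one)
      moreover have "min 1 (y\<^sup>2) / l \<le> min 1 (y\<^sup>2) / 1"
        using l by (intro divide_left_mono) auto
      moreover have "?q y = 0" using False by simp
      ultimately show ?thesis by linarith
    qed
    have ge: "0 \<le> ?q y" for y
    proof -
      have "1 - exp (l * y) \<le> l * (- y)" using exp_ge_add_one_self[of "l * y"] by linarith
      then have "(1 - exp (l * y)) / l \<le> - y" using l by (simp add: pos_divide_le_eq mult.commute)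
      then show ?thesis by simp
    qed
    have int: "integrable \<nu> (\<lambda>y. compensated l y / l + min 1 (y\<^sup>2))"
      using l integrable_compensated[of l] integrable_square by simp
    have intq: "integrable \<nu> ?q"
    proof (rule Bochner_Integration.integrable_bound[OF int])
      show "AE y in \<nu>. norm (?q y) \<le> norm (compensated l y / l + min 1 (y\<^sup>2))"
        using \<nu>_neg
      proof eventually_elim
        case (elim y)
        show ?case using le[OF elim] ge[of y] by (simp only: real_norm_def)
      qed
    qed measurable
    have "(\<integral>y. ?q y \<partial>\<nu>) \<le> (\<integral>y. compensated l y / l + min 1 (y\<^sup>2) \<partial>\<nu>)"
      using \<nu>_neg le by (intro integral_mono_AE intq int) auto
    also have "\<dots> = (\<psi> l - \<sigma>\<^sup>2 / 2 * l\<^sup>2 - \<mu> * l) / l + I"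
      using l integrable_compensated[of l] integrable_square by (simp add: \<psi>_eq I_def)
    also have "\<dots> = \<psi> l / l - \<sigma>\<^sup>2 / 2 * l - \<mu> + I" using l by (simp add: field_simps power2_eq_square)
    also have "\<dots> \<le> C - \<sigma>\<^sup>2 / 2 * l - \<mu> + I" using C[OF l] l by (simp add: pos_divide_le_eq)
    finally have main: "(\<integral>y. ?q y \<partial>\<nu>) \<le> C - \<sigma>\<^sup>2 / 2 * l - \<mu> + I" .
    have "0 \<le> (\<integral>y. ?q y \<partial>\<nu>)" using ge by (intro Bochner_Integration.integral_nonneg)
    with main show "\<sigma>\<^sup>2 / 2 * l \<le> C - \<mu> + I" by simp
    have "(\<integral>\<^sup>+ y. ennreal (?q y) \<partial>\<nu>) = ennreal (\<integral>y. ?q y \<partial>\<nu>)"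
      using ge by (intro nn_integral_eq_integral intq) auto
    also have "\<dots> \<le> ennreal (C - \<mu> + I)"
    proof (rule ennreal_leI)
      have "0 \<le> \<sigma>\<^sup>2 / 2 * l" using l by simp
      then show "(\<integral>y. ?q y \<partial>\<nu>) \<le> C - \<mu> + I" using main by linarith
    qed
    finally show "(\<integral>\<^sup>+ y. ennreal (?q y) \<partial>\<nu>) \<le> ennreal (C - \<mu> + I)" .
  qed
qed

lemma no_gaussian_part: "\<sigma> = 0"
proof (rule ccontr)
  assume "\<sigma> \<noteq> 0"
  then have pos: "\<sigma>\<^sup>2 / 2 > 0" by simp
  obtain B where B: "\<And>l. l \<ge> 1 \<Longrightarrow> \<sigma>\<^sup>2 / 2 * l \<le> B" using small_jumps_bound by blast
  have "B + 1 \<le> \<sigma>\<^sup>2 / 2 * max 1 ((B + 1) / (\<sigma>\<^sup>2 / 2))"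
    using pos by (simp add: max_def field_simps)
  also have "\<dots> \<le> B" by (intro B) simp
  finally show False by simp
qed

text \<open>Fatou's lemma as \<open>l\<close> tends to infinity through the positive integers: the
  integrands in \<open>small_jumps_bound\<close> tend to the absolute value, and their bound is
  uniform.\<close>

lemma nn_integral_small_jumps: "(\<integral>\<^sup>+ y. ennreal (indicator {-1..<0} y * \<bar>y\<bar>) \<partial>\<nu>) < \<infinity>"
proof -
  obtain B where B: "\<And>l. l \<ge> 1 \<Longrightarrow>
     (\<integral>\<^sup>+ y. ennreal (indicator {-1..<0} y * (- y - (1 - exp (l * y)) / l)) \<partial>\<nu>) \<le> ennreal B"
    using small_jumps_bound by blast
  let ?q = "\<lambda>n y. indicator {-1..<0} y * (- y - (1 - exp (real (Suc n) * y)) / real (Suc n))"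
  have "(\<lambda>n. ?q n y) \<longlonglongrightarrow> indicator {-1..<0} y * \<bar>y\<bar>" for y :: real
  proof (cases "y \<in> {-1..<0}")
    case True
    have "(\<lambda>n. (1 - exp (real (Suc n) * y)) / real (Suc n)) \<longlonglongrightarrow> 0"
    proof (rule Lim_null_comparison)
      show "eventually (\<lambda>n. norm ((1 - exp (real (Suc n) * y)) / real (Suc n)) \<le> 1 / real (Suc n)) sequentially"
        using True by (intro always_eventually allI) (simp add: divide_right_mono mult_nonneg_nonpos)
      show "(\<lambda>n. 1 / real (Suc n)) \<longlonglongrightarrow> 0" by real_asymp
    qed
    from tendsto_diff[OF tendsto_const[of "-y"] this] show ?thesis using True by simp
  qed simp
  then have "ennreal (indicator {-1..<0} y * \<bar>y\<bar>) = liminf (\<lambda>n. ennreal (?q n y))" for y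
    by (intro lim_imp_Liminf[symmetric] tendsto_ennrealI) auto
  then have "(\<integral>\<^sup>+ y. ennreal (indicator {-1..<0} y * \<bar>y\<bar>) \<partial>\<nu>)
      = (\<integral>\<^sup>+ y. liminf (\<lambda>n. ennreal (?q n y)) \<partial>\<nu>)" by simp
  also have "\<dots> \<le> liminf (\<lambda>n. \<integral>\<^sup>+ y. ennreal (?q n y) \<partial>\<nu>)"
    by (intro nn_integral_liminf) measurable
  also have "\<dots> \<le> limsup (\<lambda>n. ennreal B)"
    using B by (intro order_trans[OF Liminf_le_Limsup] Limsup_mono always_eventually) auto
  also have "\<dots> < \<infinity>" by (simp add: Limsup_const)
  finally show ?thesis .
qed

lemma integrable_small_jumps: "integrable \<nu> (\<lambda>y. indicator {-1..<0} y * \<bar>y\<bar>)"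
  using nn_integral_small_jumps by (intro integrableI_bounded) (auto simp: abs_mult)

lemma integrable_min_abs: "integrable \<nu> (\<lambda>y. min 1 \<bar>y\<bar>)"
proof (rule Bochner_Integration.integrable_bound)
  show "integrable \<nu> (\<lambda>y. indicator {-1..<0} y * \<bar>y\<bar> + min 1 (y\<^sup>2))"
    using integrable_small_jumps integrable_square by simp
  show "AE y in \<nu>. norm (min 1 \<bar>y\<bar>) \<le> norm (indicator {-1..<0} y * \<bar>y\<bar> + min 1 (y\<^sup>2))"
    using \<nu>_neg
  proof eventually_elim
    case (elim y)
    show ?case
    proof (cases "y \<ge> -1")
      case False
      then have "1 < y\<^sup>2" using power_strict_mono[of 1 "-y" 2] by simp
      then show ?thesis using False by simp
    next
      case True
      then have "min 1 \<bar>y\<bar> \<le> indicator {-1..<0} y * \<bar>y\<bar>" "0 \<le> min 1 (y\<^sup>2)" "0 \<le> min 1 \<bar>y\<bar>"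
        using elim by simp_all
      then show ?thesis unfolding real_norm_def by linarith
    qed
  qed
qed measurable

definition d :: real where "d = levy_drift \<mu> \<nu>"

definition jump_part :: "real \<Rightarrow> real" where
  "jump_part l = (\<integral>y. 1 - exp (l * y) \<partial>\<nu>)"

lemma jump_part_bounds:
  fixes l y :: real
  assumes "0 \<le> l" "y < 0"
  shows "0 \<le> 1 - exp (l * y)" "1 - exp (l * y) \<le> max 1 l * min 1 \<bar>y\<bar>"
proof -
  have "l * y \<le> 0" using assms by (simp add: mult_nonneg_nonpos)
  then show "0 \<le> 1 - exp (l * y)" by simp
  have "1 - exp (l * y) \<le> - (l * y)" using exp_ge_add_one_self[of "l * y"] by linarith
  then have "1 - exp (l * y) \<le> l * \<bar>y\<bar>" using assms by simp
  also have "\<dots> \<le> max 1 l * \<bar>y\<bar>" by (intro mult_right_mono) auto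
  finally have "1 - exp (l * y) \<le> max 1 l * \<bar>y\<bar>" .
  moreover have "1 - exp (l * y) \<le> max 1 l * 1" by (smt (verit) exp_ge_zero max.cobounded1)
  ultimately show "1 - exp (l * y) \<le> max 1 l * min 1 \<bar>y\<bar>"
    by (cases "1 \<le> \<bar>y\<bar>") (simp_all only: min.absorb1 min.absorb2 linear not_le less_imp_le)
qed

lemma integrable_jump_part: "0 \<le> l \<Longrightarrow> integrable \<nu> (\<lambda>y. 1 - exp (l * y))"
proof (rule Bochner_Integration.integrable_bound)
  assume l: "0 \<le> l"
  show "integrable \<nu> (\<lambda>y. max 1 l * min 1 \<bar>y\<bar>)" using integrable_min_abs by simp
  show "AE y in \<nu>. norm (1 - exp (l * y)) \<le> norm (max 1 l * min 1 \<bar>y\<bar>)"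
    using \<nu>_neg
  proof eventually_elim
    case (elim y)
    from jump_part_bounds[OF l this] show ?case unfolding real_norm_def by linarith
  qed
qed measurable

text \<open>Once small jumps are integrable, their compensator can be moved into the drift.\<close>

lemma \<psi>_drift: "0 \<le> l \<Longrightarrow> \<psi> l = d * l - jump_part l"
proof -
  assume l: "0 \<le> l"
  have "(\<integral>y. compensated l y \<partial>\<nu>) = (\<integral>y. l * (indicator {-1..<0} y * \<bar>y\<bar>) - (1 - exp (l * y)) \<partial>\<nu>)"
    by (intro Bochner_Integration.integral_cong) (auto simp: compensated_def indicator_def)
  also have "\<dots> = l * (\<integral>y. indicator {-1..<0} y * \<bar>y\<bar> \<partial>\<nu>) - jump_part l"
    unfolding jump_part_def using integrable_small_jumps integrable_jump_part[OF l]
    by (subst Bochner_Integration.integral_diff) auto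
  finally show ?thesis
    using l no_gaussian_part
    by (simp add: \<psi>_eq d_def levy_drift_def set_lebesgue_integral_def algebra_simps)
qed

lemma jump_part_nonneg: "0 \<le> l \<Longrightarrow> 0 \<le> jump_part l"
proof (unfold jump_part_def, rule integral_nonneg_AE)
  assume "0 \<le> l"
  with \<nu>_neg show "AE y in \<nu>. 0 \<le> 1 - exp (l * y)"
    by (auto elim!: eventually_mono simp: mult_nonneg_nonpos)
qed

lemma \<psi>_le: "0 \<le> l \<Longrightarrow> \<psi> l \<le> d * l"
  using \<psi>_drift jump_part_nonneg by simp

text \<open>The points \<open>2 ^ n\<close> are the inverse mesh sizes:
  \<open>exp (\<psi> (2 ^ n) / 2 ^ n)\<close> is the mean of the exponential of the step divided by
  the mesh. The limit will show that this quotient is close to \<open>d\<close>.\<close>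

lemma \<psi>_mesh_tendsto: "(\<lambda>n. \<psi> (2 ^ n) / 2 ^ n) \<longlonglongrightarrow> d"
proof -
  have "(\<lambda>n. \<integral>y. (1 - exp (2 ^ n * y)) / 2 ^ n \<partial>\<nu>) \<longlonglongrightarrow> (\<integral>y. 0 \<partial>\<nu>)"
  proof (rule integral_dominated_convergence)
    show "integrable \<nu> (\<lambda>y. min 1 \<bar>y\<bar>)" by (rule integrable_min_abs)
    show "AE y in \<nu>. (\<lambda>n. (1 - exp (2 ^ n * y)) / 2 ^ n) \<longlonglongrightarrow> 0"
      using \<nu>_neg
    proof eventually_elim
      case (elim y)
      show ?case
      proof (rule Lim_null_comparison[OF _ mesh_tendsto])
        show "eventually (\<lambda>n. norm ((1 - exp (2 ^ n * y)) / 2 ^ n) \<le> 1 / 2 ^ n) sequentially"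
          using elim by (intro always_eventually allI)
            (simp add: divide_right_mono mult_nonneg_nonpos)
      qed
    qed
    fix n :: nat
    show "AE y in \<nu>. norm ((1 - exp (2 ^ n * y)) / 2 ^ n) \<le> min 1 \<bar>y\<bar>"
      using \<nu>_neg
    proof eventually_elim
      case (elim y)
      have "max 1 (2 ^ n) = (2 ^ n :: real)" by (simp add: max_def)
      then have 1: "0 \<le> 1 - exp (2 ^ n * y)" "1 - exp (2 ^ n * y) \<le> min 1 \<bar>y\<bar> * 2 ^ n"
        using jump_part_bounds[of "2 ^ n" y] elim by (simp_all add: mult.commute)
      from 1(2) have "(1 - exp (2 ^ n * y)) / 2 ^ n \<le> min 1 \<bar>y\<bar>"
        by (subst pos_divide_le_eq) auto
      moreover have "0 \<le> (1 - exp (2 ^ n * y)) / 2 ^ n" using 1(1) by (intro divide_nonneg_pos) auto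
      ultimately show ?case by (simp only: real_norm_def abs_of_nonneg)
    qed
  qed measurable
  moreover have "(\<integral>y. (1 - exp (2 ^ n * y)) / 2 ^ n \<partial>\<nu>) = d - \<psi> (2 ^ n) / 2 ^ n" for n
    by (simp add: \<psi>_drift jump_part_def field_simps)
  ultimately have "(\<lambda>n. d - \<psi> (2 ^ n) / 2 ^ n) \<longlonglongrightarrow> 0" by simp
  from tendsto_diff[OF tendsto_const[of d] this] show ?thesis by simp
qed

lemma continuous_\<psi>: "continuous_on {0..} \<psi>"
proof -
  have "continuous_on {0..} (\<lambda>l. d * l - jump_part l)"
  proof (intro continuous_intros)
    show "continuous_on {0..} jump_part"
    proof (rule continuous_on_sequentiallyI)
      fix u :: "nat \<Rightarrow> real" and a :: real
      assume u: "\<forall>n. u n \<in> {0..}" "a \<in> {0..}" "u \<longlonglongrightarrow> a"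
      obtain L where L: "\<And>n. \<bar>u n\<bar> \<le> L"
        using convergent_imp_bounded[OF u(3)] by (auto simp: bounded_iff)
      show "(\<lambda>n. jump_part (u n)) \<longlonglongrightarrow> jump_part a"
        unfolding jump_part_def
      proof (rule integral_dominated_convergence)
        show "integrable \<nu> (\<lambda>y. max 1 L * min 1 \<bar>y\<bar>)" using integrable_min_abs by simp
        show "AE y in \<nu>. (\<lambda>n. 1 - exp (u n * y)) \<longlonglongrightarrow> 1 - exp (a * y)"
          by (intro AE_I2 tendsto_intros u)
        fix n
        show "AE y in \<nu>. norm (1 - exp (u n * y)) \<le> max 1 L * min 1 \<bar>y\<bar>"
          using \<nu>_neg
        proof eventually_elim
          case (elim y)
          have "0 \<le> u n" using u by simp
          note jump_part_bounds[OF this elim]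
          moreover have "max 1 (u n) * min 1 \<bar>y\<bar> \<le> max 1 L * min 1 \<bar>y\<bar>"
            using L[of n] by (intro mult_right_mono) auto
          ultimately show ?case by simp
        qed
      qed measurable
    qed
  qed
  then show ?thesis by (rule continuous_on_eq) (simp add: \<psi>_drift)
qed

text \<open>The slope \<open>d > 0\<close> at infinity makes the set nonempty, and continuity gives
  equality at its infimum. The third claim supplies points above the level arbitrarily close to the
  infimum, which excludes a zero root when the level is 0 and the path drifts to minus
  infinity.\<close>

lemma \<psi>_root:
  assumes "0 < d" "0 \<le> q"
  defines "\<Phi> \<equiv> Inf {l. 0 \<le> l \<and> \<psi> l > q}"
  shows "0 \<le> \<Phi>" "\<psi> \<Phi> = q" "\<And>\<epsilon>. 0 < \<epsilon> \<Longrightarrow> \<exists>l. \<Phi> \<le> l \<and> l < \<Phi> + \<epsilon> \<and> q < \<psi> l"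
proof -
  let ?S = "{l. 0 \<le> l \<and> \<psi> l > q}"
  have "eventually (\<lambda>n. d / 2 < \<psi> (2 ^ n) / 2 ^ n) sequentially"
    using \<psi>_mesh_tendsto assms(1) by (intro order_tendstoD(1)) auto
  moreover have "eventually (\<lambda>n. q < d / 2 * 2 ^ n) sequentially"
    using assms(1) by real_asymp
  ultimately have "eventually (\<lambda>n. q < \<psi> (2 ^ n)) sequentially"
  proof eventually_elim
    case (elim n)
    then have "d / 2 * 2 ^ n < \<psi> (2 ^ n)" by (simp add: pos_less_divide_eq)
    then show ?case using elim by simp
  qed
  then obtain n where "q < \<psi> (2 ^ n)" by (auto simp: eventually_sequentially)
  then have ne: "?S \<noteq> {}" by (auto intro!: exI[of _ "2 ^ n"])
  have bdd: "bdd_below ?S" by (auto simp: bdd_below_def)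
  show \<Phi>0: "0 \<le> \<Phi>" unfolding \<Phi>_def using ne by (intro cInf_greatest) auto
  show near: "\<exists>l. \<Phi> \<le> l \<and> l < \<Phi> + \<epsilon> \<and> q < \<psi> l" if "0 < \<epsilon>" for \<epsilon>
    using cInf_lessD[OF ne, of "\<Phi> + \<epsilon>"] that cInf_lower[OF _ bdd] unfolding \<Phi>_def by auto
  have cont: "\<exists>\<epsilon>>0. \<forall>l\<ge>0. \<bar>l - \<Phi>\<bar> < \<epsilon> \<longrightarrow> \<bar>\<psi> l - \<psi> \<Phi>\<bar> < \<eta>" if "0 < \<eta>" for \<eta>
    using continuous_\<psi>[unfolded continuous_on_iff, rule_format, of \<Phi> \<eta>] \<Phi>0 that
    by (auto simp: dist_real_def)
  show "\<psi> \<Phi> = q"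
  proof (rule ccontr)
    assume "\<psi> \<Phi> \<noteq> q"
    then consider "\<psi> \<Phi> < q" | "q < \<psi> \<Phi>" by linarith
    then show False
    proof cases
      case 1
      then obtain \<epsilon> where \<epsilon>: "\<epsilon> > 0" "\<forall>l\<ge>0. \<bar>l - \<Phi>\<bar> < \<epsilon> \<longrightarrow> \<bar>\<psi> l - \<psi> \<Phi>\<bar> < q - \<psi> \<Phi>"
        using cont[of "q - \<psi> \<Phi>"] by auto
      obtain l where "\<Phi> \<le> l" "l < \<Phi> + \<epsilon>" "q < \<psi> l" using near[OF \<epsilon>(1)] by blast
      moreover from this have "\<bar>\<psi> l - \<psi> \<Phi>\<bar> < q - \<psi> \<Phi>" using \<epsilon>(2) \<Phi>0 by auto
      ultimately show False by linarith
    next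
      case 2
      \<comment> \<open>Because \<open>\<psi> 0 = 0 \<le> q\<close>, there is room to the left of
        \<open>\<Phi>\<close>, and continuity puts a smaller point into the set.\<close>
      then have "\<Phi> \<noteq> 0" using assms(2) by auto
      then have "\<Phi> > 0" using \<Phi>0 by simp
      obtain \<epsilon> where \<epsilon>: "\<epsilon> > 0" "\<forall>l\<ge>0. \<bar>l - \<Phi>\<bar> < \<epsilon> \<longrightarrow> \<bar>\<psi> l - \<psi> \<Phi>\<bar> < \<psi> \<Phi> - q"
        using cont[of "\<psi> \<Phi> - q"] 2 by auto
      define l where "l = max 0 (\<Phi> - \<epsilon> / 2)"
      have l: "0 \<le> l" "l < \<Phi>" "\<bar>l - \<Phi>\<bar> < \<epsilon>"
        using \<epsilon>(1) \<open>\<Phi> > 0\<close> unfolding l_def by auto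
      then have "q < \<psi> l" using \<epsilon>(2) by fastforce
      then have "\<Phi> \<le> l" unfolding \<Phi>_def using l bdd by (intro cInf_lower) auto
      then show False using l by simp
    qed
  qed
qed

text \<open>The integrand is the difference of the jump parts at \<open>l + \<Phi>\<close> and at
  \<open>l\<close>, so the drift form of \<psi> gives the transform of the claimed jump law.\<close>

lemma
  assumes "0 \<le> l" "0 \<le> \<Phi>"
  shows jump_integral: "(\<integral>\<^sup>+ z. ennreal (exp (l * z)) * ennreal (1 - exp (\<Phi> * z)) \<partial>\<nu>)
    = ennreal (\<psi> l - \<psi> (l + \<Phi>) + d * \<Phi>)"
    and jump_integral_nonneg: "0 \<le> \<psi> l - \<psi> (l + \<Phi>) + d * \<Phi>"
proof -
  have nn: "AE z in \<nu>. 0 \<le> exp (l * z) * (1 - exp (\<Phi> * z))"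
    using \<nu>_neg by eventually_elim (use assms in \<open>simp add: mult_nonneg_nonpos\<close>)
  have eq: "exp (l * z) * (1 - exp (\<Phi> * z)) = (1 - exp ((l + \<Phi>) * z)) - (1 - exp (l * z))" for z
    by (simp add: algebra_simps exp_add)
  have int: "integrable \<nu> (\<lambda>z. exp (l * z) * (1 - exp (\<Phi> * z)))"
    unfolding eq using assms by (intro Bochner_Integration.integrable_diff integrable_jump_part) auto
  have val: "(\<integral>z. exp (l * z) * (1 - exp (\<Phi> * z)) \<partial>\<nu>) = \<psi> l - \<psi> (l + \<Phi>) + d * \<Phi>"
  proof -
    have "(\<integral>z. exp (l * z) * (1 - exp (\<Phi> * z)) \<partial>\<nu>) = jump_part (l + \<Phi>) - jump_part l"
      unfolding eq jump_part_def using assms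
      by (intro Bochner_Integration.integral_diff integrable_jump_part) auto
    then show ?thesis using assms by (simp add: \<psi>_drift algebra_simps)
  qed
  show "0 \<le> \<psi> l - \<psi> (l + \<Phi>) + d * \<Phi>" unfolding val[symmetric] using nn by (rule integral_nonneg_AE)
  have "(\<integral>\<^sup>+ z. ennreal (exp (l * z)) * ennreal (1 - exp (\<Phi> * z)) \<partial>\<nu>)
      = (\<integral>\<^sup>+ z. ennreal (exp (l * z) * (1 - exp (\<Phi> * z))) \<partial>\<nu>)"
    by (simp add: ennreal_mult')
  also have "\<dots> = ennreal (\<integral>z. exp (l * z) * (1 - exp (\<Phi> * z)) \<partial>\<nu>)"
    by (rule nn_integral_eq_integral[OF int nn])
  finally show "(\<integral>\<^sup>+ z. ennreal (exp (l * z)) * ennreal (1 - exp (\<Phi> * z)) \<partial>\<nu>)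
    = ennreal (\<psi> l - \<psi> (l + \<Phi>) + d * \<Phi>)" unfolding val .
qed

end



section \<open>Increments of the process\<close>

lemma (in prob_space) indep_set_nn_integral:
  fixes D :: "'a \<Rightarrow> real" and Y g :: "_ \<Rightarrow> ennreal"
  assumes indep: "indep_set (sets N) (sets (vimage_algebra (space M) D borel))"
    and sub: "subalgebra M N" and D [measurable]: "D \<in> borel_measurable M"
    and Y: "Y \<in> borel_measurable N" and g [measurable]: "g \<in> borel_measurable borel"
  shows "(\<integral>\<^sup>+ \<omega>. Y \<omega> * g (D \<omega>) \<partial>M) = (\<integral>\<^sup>+ \<omega>. Y \<omega> \<partial>M) * (\<integral>\<^sup>+ \<omega>. g (D \<omega>) \<partial>M)"
proof -
  have NM: "f \<in> borel_measurable M" if "f \<in> borel_measurable N" for f :: "_ \<Rightarrow> ennreal"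
    using measurable_from_subalg[OF sub that] .
  have [measurable]: "(\<lambda>\<omega>. g (D \<omega>)) \<in> borel_measurable M" by measurable
  from Y show ?thesis
  proof (induction rule: borel_measurable_induct)
    case (cong f h)
    have "space N = space M" using sub by (simp add: subalgebra_def)
    then have "\<And>\<omega>. \<omega> \<in> space M \<Longrightarrow> f \<omega> = h \<omega>" using cong by simp
    then show ?case using cong(4) by (metis (mono_tags, lifting) nn_integral_cong)
  next
    case (set A)
    then have A [measurable]: "A \<in> sets M" using sub by (auto simp: subalgebra_def)
    \<comment> \<open>For an indicator, independence says that restricting to \<open>A\<close> only
      scales the law of \<open>D\<close> by the mass of \<open>A\<close>.\<close>
    have "distr (density M (indicator A)) borel D = density (distr M borel D) (\<lambda>_. emeasure M A)"
    proof (rule measure_eqI)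
      fix B assume "B \<in> sets (distr (density M (indicator A)) borel D)"
      then have [measurable]: "B \<in> sets borel" by simp
      have "D -` B \<inter> space M \<in> sets (vimage_algebra (space M) D borel)"
        by (rule in_vimage_algebra) simp
      from indep_setD[OF indep set this]
      have "emeasure M (A \<inter> (D -` B \<inter> space M)) = emeasure M A * emeasure M (D -` B \<inter> space M)"
        by (simp add: emeasure_eq_measure ennreal_mult)
      moreover have "emeasure (distr (density M (indicator A)) borel D) B = emeasure M (A \<inter> (D -` B \<inter> space M))"
        using A by (simp add: emeasure_distr emeasure_density nn_integral_indicator'[symmetric]
          indicator_inter_arith[symmetric] Int_assoc)
      moreover have "emeasure (density (distr M borel D) (\<lambda>_. emeasure M A)) B
          = emeasure M A * emeasure M (D -` B \<inter> space M)"
        by (simp add: emeasure_density nn_integral_cmult_indicator emeasure_distr)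
      ultimately show "emeasure (distr (density M (indicator A)) borel D) B
          = emeasure (density (distr M borel D) (\<lambda>_. emeasure M A)) B" by simp
    qed simp
    then have "(\<integral>\<^sup>+ x. g x \<partial>distr (density M (indicator A)) borel D)
        = (\<integral>\<^sup>+ x. g x \<partial>density (distr M borel D) (\<lambda>_. emeasure M A))" by simp
    then show ?case
      by (simp add: nn_integral_distr nn_integral_density nn_integral_cmult)
  next
    case (mult u c)
    then show ?case using NM[OF mult(2)] by (simp add: nn_integral_cmult mult.assoc)
  next
    case (add u v)
    note [measurable] = NM[OF add(1)] NM[OF add(3)]
    show ?case using add by (simp add: nn_integral_add distrib_right)
  next
    case (seq U)
    note [measurable] = NM[OF seq(1)]
    have "(\<integral>\<^sup>+ \<omega>. (SUP i. U i \<omega> * g (D \<omega>)) \<partial>M) = (SUP i. \<integral>\<^sup>+ \<omega>. U i \<omega> * g (D \<omega>) \<partial>M)"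
      using seq(3) by (intro nn_integral_monotone_convergence_SUP)
        (auto simp: incseq_def le_fun_def intro!: mult_right_mono)
    moreover have "(\<integral>\<^sup>+ \<omega>. (SUP i. U i \<omega>) \<partial>M) = (SUP i. \<integral>\<^sup>+ \<omega>. U i \<omega> \<partial>M)"
      using seq(3) by (intro nn_integral_monotone_convergence_SUP) auto
    ultimately show ?case using seq
      by (simp add: SUP_mult_right_ennreal image_comp SUP_apply)
  qed
qed

text \<open>Trades a truncated linear quantity for an exponential one, whose mean is under control.
  It rests on \<open>y \<le> (1 + y) * (1 - exp (- y))\<close> and is used with the caps
  \<open>1\<close> and \<open>d\<close>.\<close>

lemma min_le_one_minus_exp:
  fixes c x :: real
  assumes "0 \<le> c" "0 \<le> x"
  shows "min c x \<le> (1 + c) * (1 - exp (- x))"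
proof -
  define y where "y = min c x"
  have y: "0 \<le> y" "y \<le> c" "y \<le> x" using assms by (auto simp: y_def)
  have "exp (- y) * (1 + y) \<le> exp (- y) * exp y"
    using exp_ge_add_one_self[of y] by (intro mult_left_mono) auto
  also have "\<dots> = 1" by (simp add: exp_minus)
  finally have "y \<le> (1 + y) * (1 - exp (- y))" by (simp add: algebra_simps)
  also have "\<dots> \<le> (1 + c) * (1 - exp (- x))" using y by (intro mult_mono) auto
  finally show ?thesis by (simp add: y_def)
qed

text \<open>Telescoping gives the slope between grid points; approaching \<open>s\<close> and
  \<open>t\<close> from the right on the same grids carries it over to them.\<close>

lemma upper_slope_from_grid:
  fixes f :: "real \<Rightarrow> real"
  assumes rc: "\<And>t. 0 \<le> t \<Longrightarrow> (f \<longlongrightarrow> f t) (at_right t)"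
    and step: "\<And>n k. f (grid n (Suc k)) - f (grid n k) \<le> c / 2 ^ n"
    and st: "0 \<le> s" "s \<le> t"
  shows "f t \<le> f s + c * (t - s)"
proof -
  have grid_le: "f (grid n j) - f (grid n i) \<le> c * (grid n j - grid n i)" if "i \<le> j" for n i j
    using that
  proof (induction rule: dec_induct)
    case (step j)
    show ?case using step.IH assms(2)[of n j] by (simp add: grid_Suc algebra_simps)
  qed simp
  have "nat \<lfloor>s * 2 ^ n\<rfloor> + 1 \<le> nat \<lfloor>t * 2 ^ n\<rfloor> + 1" for n using st
    by (intro add_right_mono nat_mono floor_mono mult_right_mono) auto
  from grid_le[OF this]
  have "f (next_grid n t) \<le> f (next_grid n s) + c * (next_grid n t - next_grid n s)" for n
    unfolding next_grid_def by (simp add: diff_le_eq add.commute)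
  then show ?thesis
    using st by (intro LIMSEQ_le[OF right_limit_next_grid[OF _ rc, of t] tendsto_add[OF
      right_limit_next_grid[OF _ rc, of s] tendsto_mult[OF tendsto_const
      tendsto_diff[OF next_grid_tendsto[of t] next_grid_tendsto[of s]]]]]) auto
qed

section \<open>Increments and killing under \<open>P 0\<close>\<close>

locale killed_levy = killed_spectrally_negative_levy P F X e p
  for P :: "real \<Rightarrow> 'a measure" and F :: "ennreal \<Rightarrow> 'a measure" and X :: "real \<Rightarrow> 'a \<Rightarrow> real"
    and e :: "'a \<Rightarrow> ennreal" and p :: real
begin

abbreviation "M \<equiv> P 0"

sublocale prob_space M by (rule prob)

lemma F_M: "f \<in> measurable (F t) N \<Longrightarrow> f \<in> measurable M N"
  by (rule measurable_from_subalg[OF subalg])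

lemma F_mono: "s \<le> t \<Longrightarrow> f \<in> measurable (F s) N \<Longrightarrow> f \<in> measurable (F t) N"
  by (rule measurable_from_subalg) (simp_all add: subalgebra_def space_F sets_F_mono)

lemma X_F: "0 \<le> u \<Longrightarrow> u \<le> t \<Longrightarrow> X u \<in> borel_measurable (F (ennreal t))"
  using F_mono[OF _ adapted] by (simp add: ennreal_leI)

lemma X_M [measurable]: "0 \<le> u \<Longrightarrow> X u \<in> borel_measurable M"
  by (rule F_M[OF adapted])

lemma e_F: "s \<le> t \<Longrightarrow> Measurable.pred (F t) (\<lambda>\<omega>. s < e \<omega>)"
proof -
  assume "s \<le> t"
  have "Measurable.pred (F s) (\<lambda>\<omega>. e \<omega> \<le> s)" using stopping by (simp add: stopping_time_def)
  then have "Measurable.pred (F s) (\<lambda>\<omega>. \<not> e \<omega> \<le> s)" by measurable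
  then show ?thesis using F_mono[OF \<open>s \<le> t\<close>] by (simp add: not_le)
qed

lemma e_M [measurable]: "Measurable.pred M (\<lambda>\<omega>. s < e \<omega>)"
  using F_M[OF e_F[OF order.refl]] .

lemma e_indicator [measurable]:
  "(\<lambda>\<omega>. indicator {\<omega>. s < e \<omega>} \<omega> :: ennreal) \<in> borel_measurable M"
  unfolding indicator_def by measurable

lemma nn_increment:
  assumes "0 \<le> t" "0 \<le> s" and Y: "Y \<in> borel_measurable (F (ennreal t))"
    and g [measurable]: "g \<in> borel_measurable borel"
  shows "(\<integral>\<^sup>+ \<omega>. Y \<omega> * g (X (t + s) \<omega> - X t \<omega>) \<partial>M) = (\<integral>\<^sup>+ \<omega>. Y \<omega> \<partial>M) * (\<integral>\<^sup>+ \<omega>. g (X s \<omega>) \<partial>M)"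
proof -
  have [measurable]: "X t \<in> borel_measurable M" "X (t + s) \<in> borel_measurable M" "X s \<in> borel_measurable M"
    "X 0 \<in> borel_measurable M" using assms by auto
  have "(\<integral>\<^sup>+ \<omega>. Y \<omega> * g (X (t + s) \<omega> - X t \<omega>) \<partial>M)
      = (\<integral>\<^sup>+ \<omega>. Y \<omega> \<partial>M) * (\<integral>\<^sup>+ \<omega>. g (X (t + s) \<omega> - X t \<omega>) \<partial>M)"
    using assms indep_increments[of t "t + s" 0] by (intro indep_set_nn_integral[OF _ subalg _ Y g]) auto
  also have "(\<integral>\<^sup>+ \<omega>. g (X (t + s) \<omega> - X t \<omega>) \<partial>M) = (\<integral>\<^sup>+ x. g x \<partial>distr M borel (\<lambda>\<omega>. X (t + s) \<omega> - X t \<omega>))"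
    by (simp add: nn_integral_distr)
  also have "\<dots> = (\<integral>\<^sup>+ x. g x \<partial>distr M borel (\<lambda>\<omega>. X s \<omega> - X 0 \<omega>))"
    using stationary_increments[of t "t + s" 0] assms by simp
  also have "\<dots> = (\<integral>\<^sup>+ \<omega>. g (X s \<omega> - X 0 \<omega>) \<partial>M)" by (simp add: nn_integral_distr)
  also have "\<dots> = (\<integral>\<^sup>+ \<omega>. g (X s \<omega>) \<partial>M)" using start by (intro nn_integral_cong_AE) auto
  finally show ?thesis .
qed

text \<open>Integrated Markov property at \<open>t\<close>: survival over the next \<open>s\<close>
  units costs the deterministic factor \<open>exp (- p * s)\<close> and separates from the
  increment.\<close>

lemma nn_killed_increment:
  assumes "0 \<le> t" "0 \<le> s" and Y: "Y \<in> borel_measurable (F (ennreal t))"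
    and g [measurable]: "g \<in> borel_measurable borel"
  shows "(\<integral>\<^sup>+ \<omega>. Y \<omega> * (g (X (t + s) \<omega> - X t \<omega>) * indicator {\<omega>. ennreal (t + s) < e \<omega>} \<omega>) \<partial>M)
    = (\<integral>\<^sup>+ \<omega>. Y \<omega> * indicator {\<omega>. ennreal t < e \<omega>} \<omega> \<partial>M) * (ennreal (exp (- p * s)) * (\<integral>\<^sup>+ \<omega>. g (X s \<omega>) \<partial>M))"
proof -
  have [measurable]: "X t \<in> borel_measurable M" "X (t + s) \<in> borel_measurable M" using assms by auto
  interpret finite_measure_subalgebra M "F (ennreal t)"
    by unfold_locales (rule subalg)
  have [measurable]: "Y \<in> borel_measurable M" using F_M[OF Y] .
  let ?Z = "\<lambda>\<omega>. g (X (t + s) \<omega> - X t \<omega>) * indicator {\<omega>. ennreal (t + s) < e \<omega>} \<omega>"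
  have "(\<integral>\<^sup>+ \<omega>. Y \<omega> * ?Z \<omega> \<partial>M) = (\<integral>\<^sup>+ \<omega>. Y \<omega> * nn_cond_exp M (F (ennreal t)) ?Z \<omega> \<partial>M)"
    by (intro nn_cond_exp_intg[symmetric] Y) measurable
  also have "\<dots> = (\<integral>\<^sup>+ \<omega>. (Y \<omega> * indicator {\<omega>. ennreal t < e \<omega>} \<omega>) * (ennreal (exp (- p * s)) * (\<integral>\<^sup>+ \<omega>. g (X s \<omega>) \<partial>M)) \<partial>M)"
    using killing[OF assms(2,1) g, of 0]
    by (intro nn_integral_cong_AE) (auto simp: mult_ac)
  also have "\<dots> = (\<integral>\<^sup>+ \<omega>. Y \<omega> * indicator {\<omega>. ennreal t < e \<omega>} \<omega> \<partial>M) * (ennreal (exp (- p * s)) * (\<integral>\<^sup>+ \<omega>. g (X s \<omega>) \<partial>M))"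
    by (intro nn_integral_multc) measurable
  finally show ?thesis .
qed

text \<open>Independence and stationarity in one product formula. A linear \<open>g\<close> gives
  the exponential moments at mesh times, and minus the absolute value gives the transform of the
  grid variation.\<close>

lemma nn_sum_increments:
  fixes g :: "real \<Rightarrow> real"
  assumes "0 \<le> s" and [measurable]: "g \<in> borel_measurable borel"
  shows "(\<integral>\<^sup>+ \<omega>. ennreal (exp (\<Sum>i<k. g (X (real (Suc i) * s) \<omega> - X (real i * s) \<omega>))) \<partial>M)
    = (\<integral>\<^sup>+ \<omega>. ennreal (exp (g (X s \<omega>))) \<partial>M) ^ k"
proof (induction k)
  case 0
  then show ?case by (simp add: emeasure_space_1)
next
  case (Suc k)
  let ?Y = "\<lambda>\<omega>. ennreal (exp (\<Sum>i<k. g (X (real (Suc i) * s) \<omega> - X (real i * s) \<omega>)))"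
  have Y: "?Y \<in> borel_measurable (F (ennreal (real k * s)))"
  proof -
    have [measurable]: "X (real i * s) \<in> borel_measurable (F (ennreal (real k * s)))" if "i \<le> k" for i
      using assms(1) that by (intro X_F mult_right_mono) auto
    have "(\<lambda>\<omega>. g (X (real (Suc i) * s) \<omega> - X (real i * s) \<omega>)) \<in> borel_measurable (F (ennreal (real k * s)))"
      if "i < k" for i
    proof -
      have "Suc i \<le> k" "i \<le> k" using that by auto
      then show ?thesis by measurable
    qed
    then show ?thesis by (intro measurable_compose[OF _ measurable_ennreal] borel_measurable_exp
      measurable_compose[OF _ borel_measurable_exp] borel_measurable_sum) auto
  qed
  have eq: "real (Suc k) * s = real k * s + s" by (simp add: distrib_right)
  have "(\<integral>\<^sup>+ \<omega>. ennreal (exp (\<Sum>i<Suc k. g (X (real (Suc i) * s) \<omega> - X (real i * s) \<omega>))) \<partial>M)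
    = (\<integral>\<^sup>+ \<omega>. ?Y \<omega> * ennreal (exp (g (X (real k * s + s) \<omega> - X (real k * s) \<omega>))) \<partial>M)"
    by (simp only: sum.lessThan_Suc exp_add ennreal_mult exp_ge_zero eq)
  also have "\<dots> = (\<integral>\<^sup>+ \<omega>. ?Y \<omega> \<partial>M) * (\<integral>\<^sup>+ \<omega>. ennreal (exp (g (X s \<omega>))) \<partial>M)"
    using assms(1) Y by (intro nn_increment) auto
  finally show ?case using Suc by (simp add: mult.commute)
qed

end



section \<open>Consequences of finite variation\<close>

locale killed_levy_fv = killed_levy P F X e p
  for P :: "real \<Rightarrow> 'a measure" and F :: "ennreal \<Rightarrow> 'a measure" and X :: "real \<Rightarrow> 'a \<Rightarrow> real"
    and e :: "'a \<Rightarrow> ennreal" and p :: real +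
  fixes \<mu> \<sigma> :: real and \<nu> :: "real measure"
  assumes triplet: "levy_triplet P X \<mu> \<sigma> \<nu>"
    and fv: "AE \<omega> in M. finite_variation (\<lambda>t. X t \<omega>)"
    and drift_to_minus_inf: "p = 0 \<Longrightarrow> AE \<omega> in M. filterlim (\<lambda>t. X t \<omega>) at_bot at_top"
begin

abbreviation "\<psi> \<equiv> laplace_exponent P X"

lemma nn_exp_X1: "0 \<le> l \<Longrightarrow> (\<integral>\<^sup>+ \<omega>. ennreal (exp (l * X 1 \<omega>)) \<partial>M) = ennreal (exp (\<psi> l))"
proof -
  assume "0 \<le> l"
  then have int: "integrable M (\<lambda>\<omega>. exp (l * X 1 \<omega>))" using triplet by (simp add: levy_triplet_def)
  have "0 \<le> (\<integral>\<omega>. exp (l * X 1 \<omega>) \<partial>M)" by (intro Bochner_Integration.integral_nonneg) auto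
  moreover have "(\<integral>\<omega>. exp (l * X 1 \<omega>) \<partial>M) \<noteq> 0"
  proof
    assume "(\<integral>\<omega>. exp (l * X 1 \<omega>) \<partial>M) = 0"
    then have "AE \<omega> in M. exp (l * X 1 \<omega>) = 0" by (subst (asm) integral_nonneg_eq_0_iff_AE[OF int]) auto
    then have "AE \<omega> in M. False" by eventually_elim simp
    then show False by simp
  qed
  ultimately have "exp (\<psi> l) = (\<integral>\<omega>. exp (l * X 1 \<omega>) \<partial>M)"
    unfolding laplace_exponent_def by (intro exp_ln) linarith
  then show ?thesis by (simp add: nn_integral_eq_integral[OF int])
qed

text \<open>Time 1 consists of \<open>2 ^ n\<close> independent equal steps, so the moment at the
  mesh time is the nonnegative root of order \<open>2 ^ n\<close> of a known number.\<close>

lemma nn_exp_mesh: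
  assumes "0 \<le> l"
  shows "(\<integral>\<^sup>+ \<omega>. ennreal (exp (l * X (1 / 2 ^ n) \<omega>)) \<partial>M) = ennreal (exp (\<psi> l / 2 ^ n))" (is "?A = _")
proof -
  have tele: "(\<Sum>i<2 ^ n. l * (X (real (Suc i) * (1 / 2 ^ n)) \<omega> - X (real i * (1 / 2 ^ n)) \<omega>)) = l * (X 1 \<omega> - X 0 \<omega>)" for \<omega>
    unfolding sum_distrib_left[symmetric]
    by (subst sum_lessThan_telescope[of "\<lambda>i. X (real i * (1 / 2 ^ n)) \<omega>"]) simp
  have "?A ^ 2 ^ n = (\<integral>\<^sup>+ \<omega>. ennreal (exp (l * (X 1 \<omega> - X 0 \<omega>))) \<partial>M)"
    using nn_sum_increments[of "1 / 2 ^ n" "\<lambda>x. l * x" "2 ^ n"] by (simp only: tele) simp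
  also have "\<dots> = (\<integral>\<^sup>+ \<omega>. ennreal (exp (l * X 1 \<omega>)) \<partial>M)"
    using start by (intro nn_integral_cong_AE) auto
  also have "\<dots> = ennreal (exp (\<psi> l))" using nn_exp_X1 assms by simp
  finally have eq: "?A ^ 2 ^ n = ennreal (exp (\<psi> l))" .
  then have "?A \<noteq> \<top>" by (auto simp: power_eq_top_ennreal)
  then obtain a where a: "0 \<le> a" "?A = ennreal a" by (cases ?A) auto
  have "a ^ 2 ^ n = exp (\<psi> l)" using eq a by (simp add: ennreal_power)
  also have "\<dots> = exp (\<psi> l / 2 ^ n) ^ 2 ^ n" by (simp flip: exp_of_nat_mult)
  finally have "a = exp (\<psi> l / 2 ^ n)" using a(1) by (subst (asm) power_eq_iff_eq_base) auto
  then show ?thesis using a by simp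
qed

text \<open>The sum of the absolute grid increments on \<open>[0,1]\<close> is bounded by the variation, and
  its Laplace transform factorises; this controls \<open>E[1 - exp (-|X\<^sub>\<delta>|)]\<close> by the mesh \<open>\<delta>\<close>.\<close>

lemma variation_bound:
  "\<exists>C\<ge>0. \<forall>n. (\<integral>\<^sup>+ \<omega>. ennreal (exp (- \<bar>X (1 / 2 ^ n) \<omega>\<bar>)) \<partial>M) \<ge> ennreal (1 - C / 2 ^ n)"
proof -
  define V where "V n \<omega> = (\<Sum>i<2 ^ n. \<bar>X (real (Suc i) * (1 / 2 ^ n)) \<omega> - X (real i * (1 / 2 ^ n)) \<omega>\<bar>)" for n \<omega>
  have [measurable]: "V n \<in> borel_measurable M" for n unfolding V_def[abs_def] by measurable
  \<comment> \<open>A lower bound of \<open>exp (- V n \<omega>)\<close> for all \<open>n\<close> at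
    once, positive wherever the variation is finite. Its mean is the constant \<open>c\<close>
    below.\<close>
  define W where "W \<omega> = (INF n. ennreal (exp (- V n \<omega>)))" for \<omega>
  have [measurable]: "W \<in> borel_measurable M" unfolding W_def[abs_def] by measurable
  have "AE \<omega> in M. W \<omega> \<noteq> 0"
    using fv
  proof eventually_elim
    case (elim \<omega>)
    then have "bounded_variation_on 0 1 (\<lambda>t. X t \<omega>)" by (simp add: finite_variation_def)
    then obtain b where b: "\<And>(\<tau> :: nat \<Rightarrow> real) n. mono_on {..n} \<tau> \<Longrightarrow> \<tau> ` {..n} \<subseteq> {0..1} \<Longrightarrow>
        (\<Sum>i<n. \<bar>X (\<tau> (Suc i)) \<omega> - X (\<tau> i) \<omega>\<bar>) \<le> b"
      unfolding bounded_variation_on_def bdd_above_def by blast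
    have "V n \<omega> \<le> b" for n
      unfolding V_def
    proof (rule b)
      show "mono_on {..2 ^ n} (\<lambda>i. real i * (1 / 2 ^ n))" by (auto intro!: mono_onI divide_right_mono)
      show "(\<lambda>i. real i * (1 / 2 ^ n)) ` {..2 ^ n} \<subseteq> {0..1}"
      proof
        fix x assume "x \<in> (\<lambda>i. real i * (1 / 2 ^ n)) ` {..2 ^ n :: nat}"
        then obtain i where i: "x = real i * (1 / 2 ^ n)" "i \<le> 2 ^ n" by auto
        have "real i \<le> real (2 ^ n)" using i(2) by (rule of_nat_mono)
        then show "x \<in> {0..1}" using i(1) by simp
      qed
    qed
    then have "ennreal (exp (- b)) \<le> W \<omega>" unfolding W_def by (intro INF_greatest ennreal_leI) auto
    moreover have "0 < ennreal (exp (- b))" by simp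
    ultimately show ?case by (metis not_le)
  qed
  then have "(\<integral>\<^sup>+ \<omega>. W \<omega> \<partial>M) \<noteq> 0"
  proof (rule contrapos_pn)
    assume "(\<integral>\<^sup>+ \<omega>. W \<omega> \<partial>M) = 0"
    then have "AE \<omega> in M. W \<omega> = 0" by (simp add: nn_integral_0_iff_AE)
    show "\<not> (AE \<omega> in M. W \<omega> \<noteq> 0)"
    proof
      assume "AE \<omega> in M. W \<omega> \<noteq> 0"
      with \<open>AE \<omega> in M. W \<omega> = 0\<close> have "AE \<omega> in M. False" by eventually_elim simp
      then show False by simp
    qed
  qed
  moreover have "W \<omega> \<le> 1" for \<omega>
    unfolding W_def by (rule INF_lower2[of 0]) (auto simp: V_def)
  then have "(\<integral>\<^sup>+ \<omega>. W \<omega> \<partial>M) \<le> (\<integral>\<^sup>+ \<omega>. 1 \<partial>M)" by (intro nn_integral_mono)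
  then have W1: "(\<integral>\<^sup>+ \<omega>. W \<omega> \<partial>M) \<le> 1" by (simp add: emeasure_space_1)
  ultimately obtain c where c: "0 < c" "c \<le> 1" "(\<integral>\<^sup>+ \<omega>. W \<omega> \<partial>M) = ennreal c"
    by (cases "\<integral>\<^sup>+ \<omega>. W \<omega> \<partial>M") (auto simp: top_unique)
  show ?thesis
  \<comment> \<open>From \<open>c \<le> a ^ 2 ^ n\<close> and \<open>ln a \<le> a - 1\<close>
    follows \<open>1 - a \<le> - ln c / 2 ^ n\<close>.\<close>
  proof (intro exI[of _ "- ln c"] conjI allI)
    show "0 \<le> - ln c" using c by simp
    fix n
    let ?A = "\<integral>\<^sup>+ \<omega>. ennreal (exp (- \<bar>X (1 / 2 ^ n) \<omega>\<bar>)) \<partial>M"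
    have "?A \<le> (\<integral>\<^sup>+ \<omega>. 1 \<partial>M)" by (intro nn_integral_mono) simp
    then have "?A \<le> 1" by (simp add: emeasure_space_1)
    then obtain a where a: "0 \<le> a" "a \<le> 1" "?A = ennreal a" by (cases ?A) (auto simp: top_unique)
    have "ennreal c \<le> (\<integral>\<^sup>+ \<omega>. ennreal (exp (- V n \<omega>)) \<partial>M)"
      unfolding c(3)[symmetric] W_def by (intro nn_integral_mono INF_lower) simp
    also have "\<dots> = ?A ^ 2 ^ n"
      using nn_sum_increments[of "1 / 2 ^ n" "\<lambda>x. - \<bar>x\<bar>" "2 ^ n"]
      by (simp only: V_def sum_negf) simp
    finally have le: "c \<le> a ^ 2 ^ n" using a by (simp add: ennreal_power)
    then have "0 < a" using a c(1) by (cases "a = 0") (auto simp: power_0_left)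
    have "ln c \<le> ln (a ^ 2 ^ n)" using le c(1) \<open>0 < a\<close> by simp
    also have "\<dots> = 2 ^ n * ln a" using \<open>0 < a\<close> by (simp add: ln_realpow)
    also have "\<dots> \<le> 2 ^ n * (a - 1)" using \<open>0 < a\<close> by (intro mult_left_mono ln_le_minus_one) auto
    finally have "1 - - ln c / 2 ^ n \<le> a" by (simp add: field_simps)
    then show "ennreal (1 - - ln c / 2 ^ n) \<le> ?A" using a by (simp add: ennreal_leI)
  qed
qed

sublocale exponent: levy_exponent \<mu> \<sigma> \<nu> \<psi>
  using triplet by unfold_locales (auto simp: levy_triplet_def)

lemma exp_X_mesh_integrable:
  assumes "0 \<le> l"
  shows "integrable M (\<lambda>\<omega>. exp (l * X (1 / 2 ^ n) \<omega>))"
    "(\<integral>\<omega>. exp (l * X (1 / 2 ^ n) \<omega>) \<partial>M) = exp (\<psi> l / 2 ^ n)"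
proof -
  show "integrable M (\<lambda>\<omega>. exp (l * X (1 / 2 ^ n) \<omega>))"
    using nn_exp_mesh[OF assms, of n] by (intro integrableI_bounded) auto
  show "(\<integral>\<omega>. exp (l * X (1 / 2 ^ n) \<omega>) \<partial>M) = exp (\<psi> l / 2 ^ n)"
    using nn_exp_mesh[OF assms, of n] by (intro integral_eq_nn_integral[THEN trans]) auto
qed

text \<open>By \<open>variation_bound\<close> the mean of \<open>1 - exp (- \<bar>x\<bar>)\<close>,
  for x the step, has the order of the mesh. Up to a multiple of \<open>l\<close> it dominates
  \<open>exp (l * x) - 1\<close> where \<open>l * x \<le> 1\<close>. Larger steps are suppressed by
  an exponential tilt, controlled by \<open>\<psi>_quadratic\<close>.\<close>

lemma exponent_linear_growth: "\<exists>C. \<forall>l\<ge>1. \<psi> l \<le> C * l"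
proof -
  obtain C where C: "C \<ge> 0" "\<And>n. (\<integral>\<^sup>+ \<omega>. ennreal (exp (- \<bar>X (1 / 2 ^ n) \<omega>\<bar>)) \<partial>M) \<ge> ennreal (1 - C / 2 ^ n)"
    using variation_bound by blast
  obtain K where K: "K \<ge> 0" "\<And>l. l \<ge> 1 \<Longrightarrow> \<psi> l \<le> K * l\<^sup>2" using exponent.\<psi>_quadratic by blast
  have int: "integrable M (\<lambda>\<omega>. exp (- \<bar>X (1 / 2 ^ n) \<omega>\<bar>))" for n
    by (intro integrable_const_bound[where B = 1]) auto
  have var: "(\<integral>\<omega>. 1 - exp (- \<bar>X (1 / 2 ^ n) \<omega>\<bar>) \<partial>M) \<le> C / 2 ^ n" for n
  proof -
    have "ennreal (1 - C / 2 ^ n) \<le> ennreal (\<integral>\<omega>. exp (- \<bar>X (1 / 2 ^ n) \<omega>\<bar>) \<partial>M)"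
      using C(2)[of n] by (subst nn_integral_eq_integral[OF int, symmetric]) auto
    then have "1 - C / 2 ^ n \<le> (\<integral>\<omega>. exp (- \<bar>X (1 / 2 ^ n) \<omega>\<bar>) \<partial>M)"
      by (subst (asm) ennreal_le_iff) (auto intro: Bochner_Integration.integral_nonneg)
    then show ?thesis using int by (simp add: prob_space)
  qed
  have "\<psi> l \<le> 4 * C * l" if l: "l \<ge> 1" for l
  proof -
    \<comment> \<open>The 4 is a 2 from
      \<open>exp (l * x) - 1 \<le> 2 * l * min 1 \<bar>x\<bar>\<close> times a 2 from
      \<open>min_le_one_minus_exp\<close>. Where \<open>l * x > 1\<close>, the tilt
      \<open>\<kappa>\<close> gains the factor \<open>exp (- \<kappa> / l)\<close>.\<close>
    have bound: "exp (l * x) - 1 \<le> 4 * l * (1 - exp (- \<bar>x\<bar>)) + exp (- \<kappa> / l) * exp ((l + \<kappa>) * x)"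
      if "\<kappa> \<ge> 0" for x \<kappa> :: real
    proof (cases "l * x \<le> 1")
      case True
      have "exp (l * x) - 1 \<le> 2 * l * min 1 \<bar>x\<bar>"
      proof (cases "x \<le> 0")
        case True
        then have "exp (l * x) \<le> 1" using l by (simp add: mult_nonneg_nonpos)
        then have "exp (l * x) - 1 \<le> 0" by simp
        also have "0 \<le> 2 * l * min 1 \<bar>x\<bar>" using l by simp
        finally show ?thesis .
      next
        case False
        have "exp (l * x) \<le> 1 + l * x + (l * x)\<^sup>2" using True False l by (intro exp_bound) auto
        also have "\<dots> \<le> 1 + l * x + l * x"
          using True False l mult_left_mono[of "l * x" 1 "l * x"] by (simp add: power2_eq_square)
        finally have "exp (l * x) - 1 \<le> 2 * l * x" by simp
        moreover have "x \<le> l * x" using False l by simp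
        then have "x \<le> 1" using True by simp
        ultimately show ?thesis using False by simp
      qed
      also have "min 1 \<bar>x\<bar> \<le> 2 * (1 - exp (- \<bar>x\<bar>))" using min_le_one_minus_exp[of 1 "\<bar>x\<bar>"] by simp
      finally have "exp (l * x) - 1 \<le> 2 * l * (2 * (1 - exp (- \<bar>x\<bar>)))" using l by simp
      moreover have "0 \<le> exp (- \<kappa> / l) * exp ((l + \<kappa>) * x)" by simp
      ultimately show ?thesis by linarith
    next
      case False
      then have "1 / l \<le> x" using l by (simp add: pos_divide_le_eq mult.commute)
      then have "\<kappa> * (1 / l) \<le> \<kappa> * x" using that by (rule mult_left_mono)
      then have "l * x \<le> - \<kappa> / l + (l + \<kappa>) * x" by (simp add: algebra_simps)
      then have "exp (l * x) \<le> exp (- \<kappa> / l) * exp ((l + \<kappa>) * x)" by (simp flip: exp_add)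
      moreover have "0 \<le> 4 * l * (1 - exp (- \<bar>x\<bar>))" using l by simp
      ultimately show ?thesis by linarith
    qed
    \<comment> \<open>The tilt is \<open>2 ^ m\<close> and the mesh its inverse square: quadratic
      growth then keeps the tilted moment below \<open>exp (K * (l + 1)\<^sup>2)\<close>, while
      \<open>exp (- (2 ^ m) / l)\<close> beats the division by the mesh.\<close>
    define err where "err m = (2 ^ m)\<^sup>2 * (exp (- (2 ^ m) / l) * exp (K * (l + 1)\<^sup>2))" for m :: nat
    have "\<psi> l \<le> 4 * C * l + err m" for m
    proof -
      define \<delta> :: real where "\<delta> = 1 / 2 ^ (2 * m)"
      have \<delta>: "\<delta> > 0" "2 ^ m * (2 ^ m * \<delta>) = 1" by (simp_all add: \<delta>_def mult_2 power_add)
      have "\<psi> l * \<delta> \<le> exp (\<psi> l * \<delta>) - 1" using exp_ge_add_one_self[of "\<psi> l * \<delta>"] by linarith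
      also have "\<dots> = (\<integral>\<omega>. exp (l * X (1 / 2 ^ (2 * m)) \<omega>) - 1 \<partial>M)"
        using exp_X_mesh_integrable[of l "2 * m"] l by (simp add: prob_space \<delta>_def)
      also have "\<dots> \<le> (\<integral>\<omega>. 4 * l * (1 - exp (- \<bar>X (1 / 2 ^ (2 * m)) \<omega>\<bar>))
          + exp (- (2 ^ m) / l) * exp ((l + 2 ^ m) * X (1 / 2 ^ (2 * m)) \<omega>) \<partial>M)"
        using exp_X_mesh_integrable(1)[of l "2 * m"] exp_X_mesh_integrable(1)[of "l + 2 ^ m" "2 * m"] l int[of "2 * m"]
        by (intro integral_mono bound) auto
      also have "\<dots> = 4 * l * (\<integral>\<omega>. 1 - exp (- \<bar>X (1 / 2 ^ (2 * m)) \<omega>\<bar>) \<partial>M)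
          + exp (- (2 ^ m) / l) * (\<integral>\<omega>. exp ((l + 2 ^ m) * X (1 / 2 ^ (2 * m)) \<omega>) \<partial>M)"
        using exp_X_mesh_integrable(1)[of "l + 2 ^ m" "2 * m"] l int[of "2 * m"]
        by (subst Bochner_Integration.integral_add) auto
      also have "\<dots> \<le> 4 * l * (C * \<delta>) + exp (- (2 ^ m) / l) * exp (K * (l + 1)\<^sup>2)"
      proof (intro add_mono mult_left_mono)
        show "(\<integral>\<omega>. 1 - exp (- \<bar>X (1 / 2 ^ (2 * m)) \<omega>\<bar>) \<partial>M) \<le> C * \<delta>" using var[of "2 * m"] by (simp add: \<delta>_def)
        have l2: "(1 :: real) \<le> 2 ^ m" by simp
        have "\<psi> (l + 2 ^ m) \<le> K * (l + 2 ^ m)\<^sup>2" using l l2 by (intro K(2)) linarith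
        also have "\<dots> \<le> K * (l * 2 ^ m + 2 ^ m)\<^sup>2"
          using l l2 K(1) mult_left_mono[of 1 "2 ^ m" l] by (intro mult_left_mono power_mono) auto
        also have "\<dots> = K * (l + 1)\<^sup>2 * (2 ^ m * 2 ^ m)" by (simp add: power2_eq_square algebra_simps)
        finally have "\<psi> (l + 2 ^ m) * \<delta> \<le> K * (l + 1)\<^sup>2 * (2 ^ m * 2 ^ m) * \<delta>" using \<delta>(1) by (intro mult_right_mono) auto
        also have "\<dots> = K * (l + 1)\<^sup>2" using \<delta>(2) by (simp add: mult.assoc)
        finally show "(\<integral>\<omega>. exp ((l + 2 ^ m) * X (1 / 2 ^ (2 * m)) \<omega>) \<partial>M) \<le> exp (K * (l + 1)\<^sup>2)"
          using exp_X_mesh_integrable(2)[of "l + 2 ^ m" "2 * m"] l by (simp add: \<delta>_def)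
      qed (use l in auto)
      finally have "\<psi> l * \<delta> * (2 ^ m)\<^sup>2 \<le> (4 * l * (C * \<delta>) + exp (- (2 ^ m) / l) * exp (K * (l + 1)\<^sup>2)) * (2 ^ m)\<^sup>2"
        by (intro mult_right_mono) auto
      moreover have "\<psi> l * \<delta> * (2 ^ m)\<^sup>2 = \<psi> l" using \<delta>(2) by (simp add: power2_eq_square mult_ac)
      moreover have "4 * l * (C * \<delta>) * (2 ^ m)\<^sup>2 = 4 * C * l" using \<delta>(2) by (simp add: power2_eq_square mult_ac)
      ultimately show ?thesis unfolding err_def distrib_right
        by (simp only: mult.commute[of _ "(2 ^ m)\<^sup>2"])
    qed
    moreover have "(\<lambda>m. 4 * C * l + err m) \<longlonglongrightarrow> 4 * C * l + 0"
    proof (intro tendsto_intros)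
      have "((\<lambda>u. u\<^sup>2 * (exp (- u / l) * exp (K * (l + 1)\<^sup>2))) \<longlongrightarrow> 0) at_top"
        using l by real_asymp
      moreover have "filterlim (\<lambda>m. 2 ^ m :: real) at_top sequentially" by real_asymp
      ultimately show "err \<longlonglongrightarrow> 0" unfolding err_def[abs_def] by (rule filterlim_compose)
    qed
    ultimately show ?thesis by (intro LIMSEQ_le_const) auto
  qed
  then show ?thesis by blast
qed

sublocale exponent: levy_exponent_fv \<mu> \<sigma> \<nu> \<psi>
  by unfold_locales (rule exponent_linear_growth)

abbreviation "d \<equiv> exponent.d"

text \<open>Markov's inequality for exponential moments: since \<open>\<psi> k \<le> d * k\<close>,
  exceeding the bound by \<open>1 / Suc m\<close> has probability at most
  \<open>exp (- k / Suc m)\<close> for every natural \<open>k\<close>.\<close>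

lemma mesh_increment_le: "AE \<omega> in M. X (1 / 2 ^ n) \<omega> \<le> d / 2 ^ n"
proof -
  have "AE \<omega> in M. X (1 / 2 ^ n) \<omega> \<le> d / 2 ^ n + 1 / real (Suc m)" for m
  proof -
    let ?A = "{\<omega>\<in>space M. d / 2 ^ n + 1 / real (Suc m) < X (1 / 2 ^ n) \<omega>}"
    have "emeasure M ?A \<le> ennreal (exp (- real k / real (Suc m)))" for k :: nat
    proof -
      have "emeasure M ?A = (\<integral>\<^sup>+ \<omega>. indicator ?A \<omega> \<partial>M)" by simp
      also have "\<dots> \<le> (\<integral>\<^sup>+ \<omega>. ennreal (exp (- real k * (d / 2 ^ n + 1 / real (Suc m)))) *
          ennreal (exp (real k * X (1 / 2 ^ n) \<omega>)) \<partial>M)"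
      proof (intro nn_integral_mono)
        fix \<omega>
        show "indicator ?A \<omega> \<le> ennreal (exp (- real k * (d / 2 ^ n + 1 / real (Suc m)))) *
          ennreal (exp (real k * X (1 / 2 ^ n) \<omega>))"
        proof (cases "\<omega> \<in> ?A")
          case True
          then have "0 \<le> real k * (X (1 / 2 ^ n) \<omega> - (d / 2 ^ n + 1 / real (Suc m)))" by auto
          then have "0 \<le> - real k * (d / 2 ^ n + 1 / real (Suc m)) + real k * X (1 / 2 ^ n) \<omega>"
            by (simp add: right_diff_distrib)
          then show ?thesis using True by (simp flip: ennreal_mult exp_add)
        qed simp
      qed
      also have "\<dots> = ennreal (exp (- real k * (d / 2 ^ n + 1 / real (Suc m)))) * ennreal (exp (\<psi> (real k) / 2 ^ n))"
        by (subst nn_integral_cmult) (auto simp: nn_exp_mesh)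
      also have "\<dots> = ennreal (exp (- real k * (d / 2 ^ n + 1 / real (Suc m)) + \<psi> (real k) / 2 ^ n))"
        by (simp only: ennreal_mult exp_ge_zero exp_add)
      also have "\<dots> \<le> ennreal (exp (- real k / real (Suc m)))"
      proof (intro ennreal_leI, subst exp_le_cancel_iff)
        have "\<psi> (real k) / 2 ^ n \<le> d * real k / 2 ^ n" using exponent.\<psi>_le by (intro divide_right_mono) auto
        then show "- real k * (d / 2 ^ n + 1 / real (Suc m)) + \<psi> (real k) / 2 ^ n \<le> - real k / real (Suc m)"
          by (simp add: algebra_simps)
      qed
      finally show ?thesis .
    qed
    moreover have "(\<lambda>k. exp (- real k / real (Suc m))) \<longlonglongrightarrow> 0" by real_asymp
    then have "(\<lambda>k. ennreal (exp (- real k / real (Suc m)))) \<longlonglongrightarrow> 0"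
      using tendsto_ennrealI by fastforce
    ultimately have "emeasure M ?A \<le> 0" by (intro LIMSEQ_le_const) auto
    then show ?thesis by (intro AE_I[of _ _ ?A]) (auto simp: not_le)
  qed
  then have "AE \<omega> in M. \<forall>m. X (1 / 2 ^ n) \<omega> \<le> d / 2 ^ n + 1 / real (Suc m)"
    by (simp add: AE_all_countable)
  then show ?thesis
  proof eventually_elim
    case (elim \<omega>)
    have "(\<lambda>m. d / 2 ^ n + 1 / real (Suc m)) \<longlonglongrightarrow> d / 2 ^ n" by real_asymp
    then show ?case using elim by (intro LIMSEQ_le_const) auto
  qed
qed

lemma right_continuous: "AE \<omega> in M. \<forall>t\<ge>0. ((\<lambda>u. X u \<omega>) \<longlongrightarrow> X t \<omega>) (at_right t)"
  using cadlag[of 0] by eventually_elim (auto simp: Defs.cadlag_def continuous_within)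

lemma path_upper: "AE \<omega> in M. \<forall>s t. 0 \<le> s \<longrightarrow> s \<le> t \<longrightarrow> X t \<omega> \<le> X s \<omega> + d * (t - s)"
proof -
  have "AE \<omega> in M. X (grid n (Suc k)) \<omega> - X (grid n k) \<omega> \<le> d / 2 ^ n" for n k
  proof -
    have "(\<integral>\<^sup>+ \<omega>. 1 * indicator {d / 2 ^ n<..} (X (grid n k + 1 / 2 ^ n) \<omega> - X (grid n k) \<omega>) \<partial>M)
      = (\<integral>\<^sup>+ \<omega>. 1 \<partial>M) * (\<integral>\<^sup>+ \<omega>. indicator {d / 2 ^ n<..} (X (1 / 2 ^ n) \<omega>) \<partial>M)"
      by (rule nn_increment) auto
    also have "(\<integral>\<^sup>+ \<omega>. indicator {d / 2 ^ n<..} (X (1 / 2 ^ n) \<omega>) \<partial>M) = (\<integral>\<^sup>+ \<omega>. 0 \<partial>M)"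
      using mesh_increment_le[of n] by (intro nn_integral_cong_AE) (auto simp: not_less[symmetric])
    finally have "(\<integral>\<^sup>+ \<omega>. indicator {d / 2 ^ n<..} (X (grid n (Suc k)) \<omega> - X (grid n k) \<omega>) \<partial>M) = 0"
      by (simp add: grid_Suc)
    then have "AE \<omega> in M. (indicator {d / 2 ^ n<..} (X (grid n (Suc k)) \<omega> - X (grid n k) \<omega>) :: ennreal) = 0"
      by (subst (asm) nn_integral_0_iff_AE) auto
    then show ?thesis by eventually_elim (auto simp: indicator_def split: if_splits)
  qed
  then have "AE \<omega> in M. \<forall>n k. X (grid n (Suc k)) \<omega> - X (grid n k) \<omega> \<le> d / 2 ^ n"
    by (simp add: AE_all_countable)
  with right_continuous show ?thesis
    by eventually_elim (intro allI impI upper_slope_from_grid, auto)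
qed

text \<open>With a nonpositive slope bound the paths would be nonincreasing, which
  \<open>non_monotone\<close> excludes.\<close>

lemma d_pos: "0 < d"
proof (rule ccontr)
  assume "\<not> 0 < d"
  then have "d \<le> 0" by simp
  have "AE \<omega> in M. False"
    using non_monotone[of 0] path_upper
  proof eventually_elim
    case (elim \<omega>)
    have "antimono_on {0..} (\<lambda>u. X u \<omega>)"
    proof (rule monotone_onI)
      fix s t :: real assume "s \<in> {0..}" "t \<in> {0..}" "s \<le> t"
      then have "X t \<omega> \<le> X s \<omega> + d * (t - s)" using elim(2) by simp
      also have "\<dots> \<le> X s \<omega>" using \<open>d \<le> 0\<close> \<open>s \<le> t\<close> by (simp add: mult_nonpos_nonneg)
      finally show "X t \<omega> \<le> X s \<omega>" .
    qed
    then show ?case using elim(1) by simp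
  qed
  then show False by simp
qed

end



section \<open>First passage along grids\<close>

lemma indicator_Collect_measurable [measurable (raw)]:
  "Measurable.pred N Q \<Longrightarrow> (\<lambda>\<omega>. indicator {\<omega>. Q \<omega>} \<omega> :: ennreal) \<in> borel_measurable N"
  unfolding indicator_def mem_Collect_eq of_bool_def by measurable

context killed_levy_fv
begin

text \<open>The grid starts at \<open>q\<close>, and the level may depend on the path up to
  \<open>q\<close>: record values as well as running suprema will serve as levels.\<close>

definition reach :: "nat \<Rightarrow> real \<Rightarrow> ('a \<Rightarrow> real) \<Rightarrow> 'a set" where
  "reach n q c = {\<omega>. \<exists>i. ennreal (q + real i / 2 ^ n) < e \<omega> \<and> c \<omega> \<le> X (q + real i / 2 ^ n) \<omega>}"

lemma survival: "0 \<le> t \<Longrightarrow> emeasure M {\<omega>\<in>space M. ennreal t < e \<omega>} = ennreal (exp (- p * t))"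
proof -
  assume t: "0 \<le> t"
  have "(\<integral>\<^sup>+ \<omega>. 1 * (1 * indicator {\<omega>. ennreal (0 + t) < e \<omega>} \<omega>) \<partial>M)
    = (\<integral>\<^sup>+ \<omega>. 1 * indicator {\<omega>. ennreal 0 < e \<omega>} \<omega> \<partial>M) * (ennreal (exp (- p * t)) * (\<integral>\<^sup>+ \<omega>. 1 \<partial>M))"
    using t by (intro nn_killed_increment[where g = "\<lambda>_. 1"]) auto
  also have "(\<integral>\<^sup>+ \<omega>. 1 * indicator {\<omega>. ennreal 0 < e \<omega>} \<omega> \<partial>M) = (\<integral>\<^sup>+ \<omega>. 1 \<partial>M)"
    using e_pos[of 0] by (intro nn_integral_cong_AE) auto
  finally have "(\<integral>\<^sup>+ \<omega>. indicator {\<omega>. ennreal t < e \<omega>} \<omega> \<partial>M) = ennreal (exp (- p * t))"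
    by (simp add: emeasure_space_1)
  also have "(\<integral>\<^sup>+ \<omega>. indicator {\<omega>. ennreal t < e \<omega>} \<omega> \<partial>M)
      = (\<integral>\<^sup>+ \<omega>. indicator {\<omega>\<in>space M. ennreal t < e \<omega>} \<omega> \<partial>M)"
    by (intro nn_integral_cong) (auto simp: indicator_def)
  finally show ?thesis by simp
qed

lemma killed_or_drift:
  "AE \<omega> in M. e \<omega> < \<infinity> \<or> filterlim (\<lambda>t. X t \<omega>) at_bot at_top"
proof (cases "p = 0")
  case True
  then show ?thesis using drift_to_minus_inf by auto
next
  case False
  then have "0 < p" using p_nonneg by simp
  have e_inf: "(e \<omega> = \<infinity>) = (\<forall>k :: nat. of_nat k < e \<omega>)" for \<omega>
  proof
    assume *: "\<forall>k :: nat. of_nat k < e \<omega>"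
    show "e \<omega> = \<infinity>"
    proof (rule ccontr)
      assume "e \<omega> \<noteq> \<infinity>"
      then obtain k :: nat where "e \<omega> < of_nat k" using ennreal_Ex_less_of_nat[of "e \<omega>"] by (auto simp: less_top)
      with * show False by (meson less_asym)
    qed
  qed (simp add: of_nat_less_top)
  have [measurable]: "{\<omega>\<in>space M. e \<omega> = \<infinity>} \<in> sets M" unfolding e_inf by measurable
  have "emeasure M {\<omega>\<in>space M. e \<omega> = \<infinity>} \<le> ennreal (exp (- p * real k))" for k :: nat
    unfolding survival[OF of_nat_0_le_iff, symmetric] by (intro emeasure_mono) auto
  moreover have "(\<lambda>k. exp (- p * real k)) \<longlonglongrightarrow> 0" using \<open>0 < p\<close> by real_asymp
  then have "(\<lambda>k. ennreal (exp (- p * real k))) \<longlonglongrightarrow> 0" using tendsto_ennrealI by fastforce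
  ultimately have "emeasure M {\<omega>\<in>space M. e \<omega> = \<infinity>} \<le> 0" by (intro LIMSEQ_le_const) auto
  then have "AE \<omega> in M. e \<omega> \<noteq> \<infinity>" using \<open>{\<omega>\<in>space M. e \<omega> = \<infinity>} \<in> sets M\<close>
    by (intro AE_I[of _ _ "{\<omega>\<in>space M. e \<omega> = \<infinity>}"]) auto
  then show ?thesis by eventually_elim (auto simp: less_top)
qed

lemma reach_pred:
  assumes [measurable]: "c \<in> borel_measurable M" and "0 \<le> q"
  shows "Measurable.pred M (\<lambda>\<omega>. \<omega> \<in> reach n q c)"
proof -
  have [measurable]: "X (q + real i / 2 ^ n) \<in> borel_measurable M" for i using assms(2) by auto
  show ?thesis unfolding reach_def mem_Collect_eq by measurable
qed

text \<open>Optional stopping for the supermartingale \<open>exp (\<theta> X - (\<psi> \<theta> - p) t)\<close>, killed at \<open>e\<close>,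
  along a grid: the value on first reaching the level exceeds \<open>1\<close> by at most the factor
  \<open>exp (\<theta> d \<delta>)\<close>, since a grid increment is at most \<open>d \<delta>\<close>.\<close>

lemma grid_hitting:
  assumes q: "0 \<le> q" and Y: "Y \<in> borel_measurable (F (ennreal q))" and Y_le: "\<And>\<omega>. Y \<omega> \<le> 1"
    and c: "c \<in> borel_measurable (F (ennreal q))" and \<theta>: "0 \<le> \<theta>" "p \<le> \<psi> \<theta>"
  defines "u0 \<equiv> \<integral>\<^sup>+ \<omega>. Y \<omega> * ennreal (exp (\<theta> * (X q \<omega> - c \<omega>))) * indicator {\<omega>. ennreal q < e \<omega>} \<omega> \<partial>M"
  shows grid_hitting_upper: "\<psi> \<theta> = p \<Longrightarrow> (\<integral>\<^sup>+ \<omega>. Y \<omega> * indicator (reach n q c) \<omega> \<partial>M) \<le> u0"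
    and grid_hitting_lower: "0 < \<theta> \<Longrightarrow> AE \<omega> in M. Y \<omega> \<noteq> 0 \<longrightarrow> X q \<omega> \<le> c \<omega> \<Longrightarrow>
      u0 \<le> ennreal (exp (\<theta> * d / 2 ^ n)) * (\<integral>\<^sup>+ \<omega>. Y \<omega> * indicator (reach n q c) \<omega> \<partial>M)"
proof -
  define T where "T i = q + real i / 2 ^ n" for i
  have T: "0 \<le> T i" "T 0 = q" "T (Suc i) = T i + 1 / 2 ^ n" for i
    using q by (auto simp: T_def add_divide_distrib)
  have T_mono: "i \<le> j \<Longrightarrow> T i \<le> T j" for i j by (simp add: T_def divide_right_mono)
  \<comment> \<open>The discount that, together with the killing factor of one step, compensates the
    mean \<open>exp (\<psi> \<theta> / 2 ^ n)\<close> of the exponential step. It is 1 when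
    \<open>\<psi> \<theta> = p\<close>.\<close>
  define \<rho> where "\<rho> = exp ((p - \<psi> \<theta>) / 2 ^ n)"
  have \<rho>: "0 < \<rho>" "\<rho> \<le> 1" using \<theta> by (auto simp: \<rho>_def divide_nonpos_pos)
  have [measurable]: "Y \<in> borel_measurable M" "c \<in> borel_measurable M" using F_M[OF Y] F_M[OF c] .
  have [measurable]: "X (T i) \<in> borel_measurable M" for i using T by auto
  have [measurable]: "Measurable.pred M (\<lambda>\<omega>. \<forall>j<i. X (T j) \<omega> < c \<omega>)" for i by measurable
  define D where "D i \<omega> = Y \<omega> * ennreal (exp (\<theta> * (X (T i) \<omega> - c \<omega>)) * \<rho> ^ i)" for i \<omega>
  have [measurable]: "D i \<in> borel_measurable M" for i unfolding D_def[abs_def] by measurable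
  define H where "H i = {\<omega>. ennreal (T i) < e \<omega> \<and> c \<omega> \<le> X (T i) \<omega> \<and> (\<forall>j<i. X (T j) \<omega> < c \<omega>)}" for i
  have [measurable]: "(\<lambda>\<omega>. indicator (H i) \<omega> :: ennreal) \<in> borel_measurable M" for i
    unfolding H_def by measurable
  \<comment> \<open>\<open>u i\<close> is the discounted mass alive at step \<open>i\<close> that
    has not reached the level earlier, \<open>h i\<close> the part that reaches it at step
    \<open>i\<close>, and \<open>v i\<close> the rest. One more killed and discounted step preserves
    \<open>v i\<close>, so the masses telescope.\<close>
  define u where "u i = (\<integral>\<^sup>+ \<omega>. D i \<omega> * indicator {\<omega>. \<forall>j<i. X (T j) \<omega> < c \<omega>} \<omega> * indicator {\<omega>. ennreal (T i) < e \<omega>} \<omega> \<partial>M)" for i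
  define v where "v i = (\<integral>\<^sup>+ \<omega>. D i \<omega> * indicator {\<omega>. \<forall>j<Suc i. X (T j) \<omega> < c \<omega>} \<omega> * indicator {\<omega>. ennreal (T i) < e \<omega>} \<omega> \<partial>M)" for i
  define h where "h i = (\<integral>\<^sup>+ \<omega>. D i \<omega> * indicator (H i) \<omega> \<partial>M)" for i
  have u_0: "u 0 = u0" by (simp add: u_def u0_def D_def T(2))
  have u_split: "u i = h i + v i" for i
  proof -
    have "h i + v i = (\<integral>\<^sup>+ \<omega>. D i \<omega> * indicator (H i) \<omega> +
       D i \<omega> * indicator {\<omega>. \<forall>j<Suc i. X (T j) \<omega> < c \<omega>} \<omega> * indicator {\<omega>. ennreal (T i) < e \<omega>} \<omega> \<partial>M)"
      unfolding h_def v_def by (intro nn_integral_add[symmetric]) measurable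
    also have "\<dots> = u i"
      unfolding u_def by (intro nn_integral_cong) (auto simp: H_def indicator_def less_Suc_eq not_le)
    finally show ?thesis by simp
  qed
  have u_Suc: "u (Suc i) = v i" for i
  proof -
    let ?Y = "\<lambda>\<omega>. D i \<omega> * indicator {\<omega>. \<forall>j<Suc i. X (T j) \<omega> < c \<omega>} \<omega>"
    have le: "ennreal q \<le> ennreal (T i)" using T_mono[of 0 i] T(2) by (simp add: ennreal_leI)
    have Y': "?Y \<in> borel_measurable (F (ennreal (T i)))"
    proof -
      note [measurable] = F_mono[OF le Y] F_mono[OF le c]
      have [measurable]: "X (T j) \<in> borel_measurable (F (ennreal (T i)))" if "j < Suc i" for j
        using T_mono[of j i] that T by (intro X_F) auto
      have [measurable]: "Measurable.pred (F (ennreal (T i))) (\<lambda>\<omega>. \<forall>j\<in>{..<Suc i}. X (T j) \<omega> < c \<omega>)"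
        by (intro pred_intros_finite) auto
      then have [measurable]: "Measurable.pred (F (ennreal (T i))) (\<lambda>\<omega>. \<forall>j<Suc i. X (T j) \<omega> < c \<omega>)"
        by (simp add: Ball_def)
      have [measurable]: "X (T i) \<in> borel_measurable (F (ennreal (T i)))" using T by (intro X_F) auto
      show ?thesis unfolding D_def by measurable
    qed
    have "u (Suc i) = (\<integral>\<^sup>+ \<omega>. ?Y \<omega> * (ennreal (exp (\<theta> * (X (T i + 1 / 2 ^ n) \<omega> - X (T i) \<omega>)) * \<rho>)
        * indicator {\<omega>. ennreal (T i + 1 / 2 ^ n) < e \<omega>} \<omega>) \<partial>M)"
      unfolding u_def T(3)
    proof (intro nn_integral_cong)
      fix \<omega>
      have "D (Suc i) \<omega> = D i \<omega> * ennreal (exp (\<theta> * (X (T i + 1 / 2 ^ n) \<omega> - X (T i) \<omega>)) * \<rho>)"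
        using \<rho> unfolding D_def T(3) mult.assoc
        by (simp add: ennreal_mult'[symmetric] exp_add[symmetric] algebra_simps flip: exp_diff)
      then show "D (Suc i) \<omega> * indicator {\<omega>. \<forall>j<Suc i. X (T j) \<omega> < c \<omega>} \<omega> * indicator {\<omega>. ennreal (T i + 1 / 2 ^ n) < e \<omega>} \<omega>
        = ?Y \<omega> * (ennreal (exp (\<theta> * (X (T i + 1 / 2 ^ n) \<omega> - X (T i) \<omega>)) * \<rho>) * indicator {\<omega>. ennreal (T i + 1 / 2 ^ n) < e \<omega>} \<omega>)"
        by (simp add: mult_ac)
    qed
    also have "\<dots> = (\<integral>\<^sup>+ \<omega>. ?Y \<omega> * indicator {\<omega>. ennreal (T i) < e \<omega>} \<omega> \<partial>M) *
        (ennreal (exp (- p * (1 / 2 ^ n))) * (\<integral>\<^sup>+ \<omega>. ennreal (exp (\<theta> * X (1 / 2 ^ n) \<omega>) * \<rho>) \<partial>M))"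
      by (rule nn_killed_increment[OF T(1) _ Y']) auto
    also have "(\<integral>\<^sup>+ \<omega>. ennreal (exp (\<theta> * X (1 / 2 ^ n) \<omega>) * \<rho>) \<partial>M) = ennreal (exp (\<psi> \<theta> / 2 ^ n) * \<rho>)"
      using \<rho> \<theta> by (simp add: ennreal_mult nn_integral_multc nn_exp_mesh)
    also have "ennreal (exp (- p * (1 / 2 ^ n))) * \<dots> = 1"
      by (simp add: \<rho>_def diff_divide_distrib flip: ennreal_mult exp_add)
    finally show ?thesis by (simp add: v_def)
  qed
  have sum: "u0 = (\<Sum>i<N. h i) + u N" for N
  proof (induction N)
    case (Suc N)
    then show ?case by (simp only: sum.lessThan_Suc u_split[of N] u_Suc add.assoc)
  qed (simp add: u_0)
  have disj: "disjoint_family H"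
  proof -
    have "H i \<inter> H j = {}" if "i < j" for i j using that unfolding H_def by (force simp: not_less[symmetric])
    then show ?thesis unfolding disjoint_family_on_def by (metis Int_commute linorder_neqE_nat)
  qed
  have reach: "reach n q c = (\<Union>i. H i)"
  proof
    show "(\<Union>i. H i) \<subseteq> reach n q c" by (auto simp: H_def reach_def T_def)
    show "reach n q c \<subseteq> (\<Union>i. H i)"
    proof
      fix \<omega> assume "\<omega> \<in> reach n q c"
      then obtain k where k: "ennreal (T k) < e \<omega>" "c \<omega> \<le> X (T k) \<omega>" by (auto simp: reach_def T_def)
      define i where "i = (LEAST i. c \<omega> \<le> X (T i) \<omega>)"
      have i: "c \<omega> \<le> X (T i) \<omega>" "i \<le> k" "\<And>j. j < i \<Longrightarrow> X (T j) \<omega> < c \<omega>"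
        unfolding i_def using k(2) LeastI[of "\<lambda>i. c \<omega> \<le> X (T i) \<omega>" k]
          Least_le[of "\<lambda>i. c \<omega> \<le> X (T i) \<omega>" k] by (blast, blast) (rule not_le_imp_less, blast dest: not_less_Least)
      have "ennreal (T i) < e \<omega>" using T_mono[OF i(2)] k(1) by (meson ennreal_leI le_less_trans)
      then show "\<omega> \<in> (\<Union>i. H i)" using i by (auto simp: H_def)
    qed
  qed
  have reach_sum: "(\<integral>\<^sup>+ \<omega>. Y \<omega> * indicator (reach n q c) \<omega> \<partial>M) = (\<Sum>i. \<integral>\<^sup>+ \<omega>. Y \<omega> * indicator (H i) \<omega> \<partial>M)"
  proof -
    have "(\<integral>\<^sup>+ \<omega>. Y \<omega> * indicator (reach n q c) \<omega> \<partial>M) = (\<integral>\<^sup>+ \<omega>. (\<Sum>i. Y \<omega> * indicator (H i) \<omega>) \<partial>M)"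
      by (simp add: reach suminf_indicator[OF disj])
    also have "\<dots> = (\<Sum>i. \<integral>\<^sup>+ \<omega>. Y \<omega> * indicator (H i) \<omega> \<partial>M)"
      by (intro nn_integral_suminf) measurable
    finally show ?thesis .
  qed
  show "(\<integral>\<^sup>+ \<omega>. Y \<omega> * indicator (reach n q c) \<omega> \<partial>M) \<le> u0" if "\<psi> \<theta> = p"
  proof -
    have "\<rho> = 1" using that by (simp add: \<rho>_def)
    have "(\<integral>\<^sup>+ \<omega>. Y \<omega> * indicator (H i) \<omega> \<partial>M) \<le> h i" for i
      unfolding h_def
    proof (intro nn_integral_mono)
      fix \<omega>
      show "Y \<omega> * indicator (H i) \<omega> \<le> D i \<omega> * indicator (H i) \<omega>"
      proof (cases "\<omega> \<in> H i")
        case True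
        then have "1 \<le> exp (\<theta> * (X (T i) \<omega> - c \<omega>))" using \<theta> by (simp add: H_def)
        then have "Y \<omega> * ennreal 1 \<le> D i \<omega>" unfolding D_def \<open>\<rho> = 1\<close>
          by (intro mult_left_mono ennreal_leI) auto
        then show ?thesis using True by simp
      qed simp
    qed
    moreover have "(\<Sum>i<N. h i) \<le> u0" for N by (subst sum[of N]) simp
    ultimately show ?thesis unfolding reach_sum
      by (intro suminf_le_const summableI) (meson order_trans sum_mono)
  qed
  show "u0 \<le> ennreal (exp (\<theta> * d / 2 ^ n)) * (\<integral>\<^sup>+ \<omega>. Y \<omega> * indicator (reach n q c) \<omega> \<partial>M)"
    if \<theta>_pos: "0 < \<theta>" and below: "AE \<omega> in M. Y \<omega> \<noteq> 0 \<longrightarrow> X q \<omega> \<le> c \<omega>"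
  proof -
    have h_le: "h i \<le> ennreal (exp (\<theta> * d / 2 ^ n)) * (\<integral>\<^sup>+ \<omega>. Y \<omega> * indicator (H i) \<omega> \<partial>M)" for i
    proof -
      have "h i \<le> (\<integral>\<^sup>+ \<omega>. ennreal (exp (\<theta> * d / 2 ^ n)) * (Y \<omega> * indicator (H i) \<omega>) \<partial>M)"
        unfolding h_def
      proof (rule nn_integral_mono_AE)
        show "AE \<omega> in M. D i \<omega> * indicator (H i) \<omega> \<le> ennreal (exp (\<theta> * d / 2 ^ n)) * (Y \<omega> * indicator (H i) \<omega>)"
          using below path_upper
        proof eventually_elim
          case (elim \<omega>)
          show ?case
          proof (cases "\<omega> \<in> H i \<and> Y \<omega> \<noteq> 0")
            case True
            \<comment> \<open>At a first hit the previous grid value is below the level, so the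
              overshoot is at most one increment; a hit at the very start has none, by
              \<open>below\<close>.\<close>
            have "X (T i) \<omega> - c \<omega> \<le> d / 2 ^ n"
            proof (cases i)
              case 0
              then show ?thesis using elim(1) True d_pos T(2)
                by (simp add: order_trans[of _ 0])
            next
              case (Suc j)
              have "X (T j) \<omega> < c \<omega>" using True Suc by (simp add: H_def)
              moreover have "X (T i) \<omega> \<le> X (T j) \<omega> + d * (1 / 2 ^ n)"
                using elim(2)[rule_format, of "T j" "T i"] T(1)[of j] T(3)[of j] Suc by simp
              ultimately show ?thesis by simp
            qed
            then have "exp (\<theta> * (X (T i) \<omega> - c \<omega>)) \<le> exp (\<theta> * (d / 2 ^ n))"
              unfolding exp_le_cancel_iff using \<theta>(1) by (rule mult_left_mono)
            then have "exp (\<theta> * (X (T i) \<omega> - c \<omega>)) * \<rho> ^ i \<le> exp (\<theta> * (d / 2 ^ n)) * 1"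
              using \<rho> by (intro mult_mono power_le_one) auto
            then have "D i \<omega> \<le> Y \<omega> * ennreal (exp (\<theta> * d / 2 ^ n))"
              unfolding D_def by (intro mult_left_mono ennreal_leI) auto
            then show ?thesis using True by (simp add: mult.commute)
          qed (auto simp: D_def)
        qed
      qed
      also have "\<dots> = ennreal (exp (\<theta> * d / 2 ^ n)) * (\<integral>\<^sup>+ \<omega>. Y \<omega> * indicator (H i) \<omega> \<partial>M)"
        by (intro nn_integral_cmult) measurable
      finally show ?thesis .
    qed
    \<comment> \<open>No mass escapes to infinity: below the level the integrand is at most 1, and
      on almost every path it dies out, either by killing or because \<open>\<theta> > 0\<close> and
      the path tends to minus infinity.\<close>
    have "v \<longlonglongrightarrow> (\<integral>\<^sup>+ \<omega>. 0 \<partial>M)"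
      unfolding v_def[abs_def]
    proof (rule nn_integral_dominated_convergence)
      fix i
      show "AE \<omega> in M. D i \<omega> * indicator {\<omega>. \<forall>j<Suc i. X (T j) \<omega> < c \<omega>} \<omega> * indicator {\<omega>. ennreal (T i) < e \<omega>} \<omega> \<le> 1"
      proof (rule AE_I2)
        fix \<omega>
        show "D i \<omega> * indicator {\<omega>. \<forall>j<Suc i. X (T j) \<omega> < c \<omega>} \<omega> * indicator {\<omega>. ennreal (T i) < e \<omega>} \<omega> \<le> 1"
        proof (cases "\<forall>j<Suc i. X (T j) \<omega> < c \<omega>")
          case True
          then have "X (T i) \<omega> - c \<omega> \<le> 0" by (simp add: less_imp_le)
          then have "exp (\<theta> * (X (T i) \<omega> - c \<omega>)) \<le> 1" using \<theta> by (simp add: mult_nonneg_nonpos)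
          then have "exp (\<theta> * (X (T i) \<omega> - c \<omega>)) * \<rho> ^ i \<le> 1 * 1" using \<rho> by (intro mult_mono power_le_one) auto
          then have "D i \<omega> \<le> 1 * 1" unfolding D_def using Y_le by (intro mult_mono) auto
          then show ?thesis by (simp add: indicator_def)
        qed simp
      qed
    next
      show "(\<integral>\<^sup>+ \<omega>. 1 \<partial>M) < \<infinity>" by (simp add: emeasure_space_1)
      show "AE \<omega> in M. (\<lambda>i. D i \<omega> * indicator {\<omega>. \<forall>j<Suc i. X (T j) \<omega> < c \<omega>} \<omega> * indicator {\<omega>. ennreal (T i) < e \<omega>} \<omega>) \<longlonglongrightarrow> 0"
        using killed_or_drift
      proof eventually_elim
        case (elim \<omega>)
        have T_inf: "filterlim T at_top sequentially"
          unfolding T_def[abs_def] by real_asymp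
        from elim show ?case
        proof
          assume "e \<omega> < \<infinity>"
          then obtain r where r: "e \<omega> = ennreal r" "0 \<le> r" by (cases "e \<omega>") auto
          have "eventually (\<lambda>i. r \<le> T i) sequentially" using T_inf by (auto simp: filterlim_at_top)
          then have "eventually (\<lambda>i. D i \<omega> * indicator {\<omega>. \<forall>j<Suc i. X (T j) \<omega> < c \<omega>} \<omega> * indicator {\<omega>. ennreal (T i) < e \<omega>} \<omega> = 0) sequentially"
            by eventually_elim (use r in \<open>auto simp: not_less ennreal_leI\<close>)
          then show ?thesis by (rule tendsto_eventually)
        next
          assume low: "filterlim (\<lambda>t. X t \<omega>) at_bot at_top"
          have "filterlim (\<lambda>i. X (T i) \<omega>) at_bot sequentially" by (rule filterlim_compose[OF low T_inf])
          then have "filterlim (\<lambda>i. \<theta> * (X (T i) \<omega> - c \<omega>)) at_bot sequentially"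
            using \<theta>_pos by (intro filterlim_tendsto_pos_mult_at_bot[OF tendsto_const])
              (auto simp: filterlim_at_bot algebra_simps diff_le_eq)
          then have "(\<lambda>i. exp (\<theta> * (X (T i) \<omega> - c \<omega>))) \<longlonglongrightarrow> 0" by (rule filterlim_compose[OF exp_at_bot])
          then have "(\<lambda>i. ennreal (exp (\<theta> * (X (T i) \<omega> - c \<omega>)))) \<longlonglongrightarrow> ennreal 0" by (rule tendsto_ennrealI)
          then have lim: "(\<lambda>i. ennreal (exp (\<theta> * (X (T i) \<omega> - c \<omega>)))) \<longlonglongrightarrow> 0" by simp
          show ?thesis
          proof (rule tendsto_sandwich[OF _ _ tendsto_const lim])
            show "eventually (\<lambda>i. D i \<omega> * indicator {\<omega>. \<forall>j<Suc i. X (T j) \<omega> < c \<omega>} \<omega> * indicator {\<omega>. ennreal (T i) < e \<omega>} \<omega>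
              \<le> ennreal (exp (\<theta> * (X (T i) \<omega> - c \<omega>)))) sequentially"
            proof (intro always_eventually allI)
              fix i
              have "D i \<omega> \<le> 1 * ennreal (exp (\<theta> * (X (T i) \<omega> - c \<omega>)) * 1)"
                unfolding D_def using Y_le \<rho> by (intro mult_mono ennreal_leI mult_left_mono power_le_one) auto
              then show "D i \<omega> * indicator {\<omega>. \<forall>j<Suc i. X (T j) \<omega> < c \<omega>} \<omega> * indicator {\<omega>. ennreal (T i) < e \<omega>} \<omega>
                \<le> ennreal (exp (\<theta> * (X (T i) \<omega> - c \<omega>)))" by (simp add: indicator_def)
            qed
          qed auto
        qed
      qed
    qed measurable
    then have u_lim: "(\<lambda>i. u (Suc i)) \<longlonglongrightarrow> 0" by (simp add: u_Suc)
    define B where "B = ennreal (exp (\<theta> * d / 2 ^ n)) * (\<integral>\<^sup>+ \<omega>. Y \<omega> * indicator (reach n q c) \<omega> \<partial>M)"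
    have "(\<Sum>i<N. h i) \<le> B" for N
    proof -
      have "(\<Sum>i<N. h i) \<le> (\<Sum>i<N. ennreal (exp (\<theta> * d / 2 ^ n)) * (\<integral>\<^sup>+ \<omega>. Y \<omega> * indicator (H i) \<omega> \<partial>M))"
        by (intro sum_mono h_le)
      also have "\<dots> = ennreal (exp (\<theta> * d / 2 ^ n)) * (\<Sum>i<N. \<integral>\<^sup>+ \<omega>. Y \<omega> * indicator (H i) \<omega> \<partial>M)"
        by (simp add: sum_distrib_left)
      also have "\<dots> \<le> B" unfolding B_def reach_sum
        by (intro mult_left_mono sum_le_suminf summableI) auto
      finally show ?thesis .
    qed
    then have "u0 \<le> B + u (Suc N)" for N
      by (subst sum[of "Suc N"]) (intro add_right_mono)
    moreover have "(\<lambda>N. B + u (Suc N)) \<longlonglongrightarrow> B + 0" by (intro tendsto_add tendsto_const u_lim)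
    ultimately show ?thesis unfolding B_def[symmetric] by (intro LIMSEQ_le_const[of _ B]) auto
  qed
qed

end



section \<open>First passage in continuous time\<close>

context killed_levy_fv
begin

abbreviation "\<Phi> \<equiv> Phi P X p"

lemma \<Phi>_root: "0 \<le> \<Phi>" "\<psi> \<Phi> = p"
  using exponent.\<psi>_root[OF d_pos p_nonneg] unfolding Phi_def by auto

text \<open>For \<open>p = 0\<close> a zero root would leave arbitrarily small \<open>l > 0\<close>
  with \<open>0 \<le> \<psi> l\<close>. By \<open>grid_hitting_lower\<close> the level
  \<open>a\<close> would be reached with probability at least \<open>exp (- l * (a + d))\<close>,
  hence almost surely for every \<open>a\<close>, against the drift to minus infinity.\<close>

lemma \<Phi>_pos: "0 < \<Phi>"
proof (cases "p = 0")
  case False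
  then show ?thesis using \<Phi>_root exponent.\<psi>_0 by (metis order_le_less)
next
  case True
  show ?thesis
  proof (rule ccontr)
    assume "\<not> 0 < \<Phi>"
    then have "\<Phi> = 0" using \<Phi>_root by simp
    have ex: "\<exists>l>0. l < \<epsilon> \<and> p \<le> \<psi> l" if pos: "0 < \<epsilon>" for \<epsilon>
    proof -
      obtain l where l: "\<Phi> \<le> l" "l < \<Phi> + \<epsilon>" "p < \<psi> l"
        using exponent.\<psi>_root(3)[OF d_pos p_nonneg pos] unfolding Phi_def by auto
      moreover from l(3) have "l \<noteq> 0" using True by auto
      ultimately show ?thesis using \<open>\<Phi> = 0\<close> by (intro exI[of _ l]) auto
    qed
    have "AE \<omega> in M. \<omega> \<in> reach 0 0 (\<lambda>_. real a)" for a
    proof -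
      let ?R = "{\<omega>\<in>space M. \<omega> \<in> reach 0 0 (\<lambda>_. real a)}"
      have R: "?R \<in> sets M" using reach_pred[of "\<lambda>_. real a" 0 0] by (simp add: pred_def)
      \<comment> \<open>Mesh 1 is fine enough: its overshoot bound \<open>d\<close> stays fixed
        while \<open>l\<close> tends to 0.\<close>
      have "exp (- l * (real a + d)) \<le> prob ?R" if l: "0 < l" "p \<le> \<psi> l" for l
      proof -
        have "ennreal (exp (- l * real a)) = (\<integral>\<^sup>+ \<omega>. ennreal (exp (- l * real a)) \<partial>M)"
          by (simp add: emeasure_space_1)
        also have "\<dots> = (\<integral>\<^sup>+ \<omega>. 1 * ennreal (exp (l * (X 0 \<omega> - real a))) * indicator {\<omega>. ennreal 0 < e \<omega>} \<omega> \<partial>M)"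
          using start e_pos[of 0] by (intro nn_integral_cong_AE) auto
        also have "\<dots> \<le> ennreal (exp (l * d / 2 ^ 0)) * (\<integral>\<^sup>+ \<omega>. 1 * indicator (reach 0 0 (\<lambda>_. real a)) \<omega> \<partial>M)"
          using l start by (intro grid_hitting_lower) (auto elim!: eventually_mono)
        also have "(\<integral>\<^sup>+ \<omega>. 1 * indicator (reach 0 0 (\<lambda>_. real a)) \<omega> \<partial>M) = (\<integral>\<^sup>+ \<omega>. indicator ?R \<omega> \<partial>M)"
          by (intro nn_integral_cong) (auto simp: indicator_def)
        also have "\<dots> = ennreal (prob ?R)" using R by (simp add: emeasure_eq_measure)
        also have "ennreal (exp (l * d / 2 ^ 0)) * \<dots> = ennreal (exp (l * d) * prob ?R)"
          by (simp add: ennreal_mult)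
        finally have "exp (- l * real a) \<le> exp (l * d) * prob ?R" by (subst (asm) ennreal_le_iff) auto
        then have "exp (- l * d) * exp (- l * real a) \<le> exp (- l * d) * (exp (l * d) * prob ?R)"
          by (intro mult_left_mono) auto
        then show ?thesis by (simp add: algebra_simps flip: mult.assoc exp_add)
      qed
      note bound = this
      have "1 \<le> prob ?R"
      proof (rule field_le_epsilon)
        fix \<eta> :: real assume "0 < \<eta>"
        define D where "D = real a + d"
        have D: "0 < D" using d_pos by (simp add: D_def add_nonneg_pos)
        obtain l where l: "0 < l" "l < \<eta> / D" "p \<le> \<psi> l" using ex[of "\<eta> / D"] \<open>0 < \<eta>\<close> D by auto
        have "1 - \<eta> \<le> 1 - l * D" using l D by (simp add: field_simps)
        also have "\<dots> \<le> exp (- l * D)" using exp_ge_add_one_self[of "- l * D"] by simp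
        also have "\<dots> \<le> prob ?R" unfolding D_def by (rule bound[OF l(1,3)])
        finally show "1 \<le> prob ?R + \<eta>" by simp
      qed
      then have "prob ?R = 1" using prob_le_1 antisym by blast
      then show ?thesis using prob_Collect_eq_1[OF R] by simp
    qed
    then have all: "AE \<omega> in M. \<forall>a :: nat. \<omega> \<in> reach 0 0 (\<lambda>_. real a)" by (simp add: AE_all_countable)
    have "AE \<omega> in M. False"
      using all path_upper drift_to_minus_inf[OF True]
    proof eventually_elim
      case (elim \<omega>)
      have "eventually (\<lambda>t. X t \<omega> < 0) at_top" using elim(3) by (simp add: filterlim_at_bot_dense)
      then obtain T where T: "\<And>t. t \<ge> T \<Longrightarrow> X t \<omega> < 0" by (auto simp: eventually_at_top_linorder)
      obtain a :: nat where a: "max 0 (X 0 \<omega> + d * max T 0) < real a" using reals_Archimedean2 by blast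
      obtain i :: nat where i: "real a \<le> X (real i) \<omega>" using elim(1) by (auto simp: reach_def)
      then have "real i < T" using T[of "real i"] a by force
      then have "d * real i \<le> d * max T 0" using d_pos by simp
      moreover have "X (real i) \<omega> \<le> X 0 \<omega> + d * real i" using elim(2)[rule_format, of 0 "real i"] by simp
      ultimately show False using a i by simp
    qed
    then show False by simp
  qed
qed

text \<open>For right continuous paths this is the event that the supremum of \<open>X\<close> over
  live times from \<open>q\<close> on is at least \<open>c\<close>, expressed through countably many
  times. It asks for approach, not attainment, of the level.\<close>

definition reach_limit :: "real \<Rightarrow> ('a \<Rightarrow> real) \<Rightarrow> 'a set" where
  "reach_limit q c = (\<Inter>m :: nat. \<Union>n. reach n q (\<lambda>\<omega>. c \<omega> - 1 / real (Suc m)))"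

lemma reach_limit_pred:
  assumes [measurable]: "c \<in> borel_measurable M" and "0 \<le> q"
  shows "Measurable.pred M (\<lambda>\<omega>. \<omega> \<in> reach_limit q c)"
proof -
  have [measurable]: "X (q + real i / 2 ^ n) \<in> borel_measurable M" for i n using assms(2) by auto
  have eq: "\<omega> \<in> reach_limit q c \<longleftrightarrow> (\<forall>m :: nat. \<exists>n i. ennreal (q + real i / 2 ^ n) < e \<omega> \<and>
      c \<omega> - 1 / real (Suc m) \<le> X (q + real i / 2 ^ n) \<omega>)" for \<omega>
    by (simp add: reach_limit_def reach_def)
  show ?thesis unfolding eq by measurable
qed

lemma reach_refine: "reach n q c \<subseteq> reach (Suc n) q c"
proof
  fix \<omega> assume "\<omega> \<in> reach n q c"
  then obtain i where "ennreal (q + real i / 2 ^ n) < e \<omega>" "c \<omega> \<le> X (q + real i / 2 ^ n) \<omega>"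
    by (auto simp: reach_def)
  moreover have "real i / 2 ^ n = real (2 * i) / 2 ^ Suc n" by simp
  ultimately show "\<omega> \<in> reach (Suc n) q c" unfolding reach_def by (simp only: mem_Collect_eq) blast
qed

lemma reach_subset_limit: "(\<And>\<omega>. c \<omega> \<le> c' \<omega>) \<Longrightarrow> reach n q c' \<subseteq> reach_limit q c"
proof
  fix \<omega> assume le: "\<And>\<omega>. c \<omega> \<le> c' \<omega>" and "\<omega> \<in> reach n q c'"
  then obtain i where i: "ennreal (q + real i / 2 ^ n) < e \<omega>" "c' \<omega> \<le> X (q + real i / 2 ^ n) \<omega>"
    by (auto simp: reach_def)
  have "c \<omega> - 1 / real (Suc m) \<le> X (q + real i / 2 ^ n) \<omega>" for m
  proof -
    have "0 \<le> 1 / real (Suc m)" by simp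
    then show ?thesis using le[of \<omega>] i(2) by linarith
  qed
  then have "\<omega> \<in> reach n q (\<lambda>\<omega>. c \<omega> - 1 / real (Suc m))" for m
    using i(1) unfolding reach_def by blast
  then show "\<omega> \<in> reach_limit q c" unfolding reach_limit_def by blast
qed

lemma reach_limitI:
  assumes rc: "\<forall>t\<ge>0. ((\<lambda>u. X u \<omega>) \<longlongrightarrow> X t \<omega>) (at_right t)"
    and q: "0 \<le> q" and ex: "\<And>y. y < c \<omega> \<Longrightarrow> \<exists>t\<ge>q. ennreal t < e \<omega> \<and> y < X t \<omega>"
  shows "\<omega> \<in> reach_limit q c"
  unfolding reach_limit_def
proof
  fix m :: nat
  obtain t where t: "t \<ge> q" "ennreal t < e \<omega>" "c \<omega> - 1 / real (Suc m) < X t \<omega>"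
    using ex[of "c \<omega> - 1 / real (Suc m)"] by auto
  have "eventually (\<lambda>s. c \<omega> - 1 / real (Suc m) < X s \<omega>) (at_right t)"
    using rc t q by (intro order_tendstoD(1)) auto
  then obtain b where b: "b > t" "\<And>s. t < s \<Longrightarrow> s < b \<Longrightarrow> c \<omega> - 1 / real (Suc m) < X s \<omega>"
    unfolding eventually_at_right_field by blast
  have "\<exists>b'>t. \<forall>s. s < b' \<longrightarrow> ennreal s < e \<omega>"
  proof (cases "e \<omega>")
    case (real r)
    then have "t < r" using t q by (simp add: ennreal_less_iff)
    then have "ennreal s < e \<omega>" if "s < r" for s
      using that real t(1) q by (cases "0 \<le> s") (auto simp: ennreal_less_iff ennreal_neg)
    then show ?thesis using \<open>t < r\<close> by blast
  qed (auto intro: gt_ex)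
  then obtain b' where b': "b' > t" "\<And>s. s < b' \<Longrightarrow> ennreal s < e \<omega>" by blast
  obtain n k where nk: "t - q < grid n k" "grid n k < min b b' - q"
    using ex_grid_between[of "t - q" "min b b' - q"] t(1) b(1) b'(1) by auto
  then have "ennreal (q + grid n k) < e \<omega>" "c \<omega> - 1 / real (Suc m) < X (q + grid n k) \<omega>"
    by (intro b' b; simp add: algebra_simps)+
  then have "\<omega> \<in> reach n q (\<lambda>\<omega>. c \<omega> - 1 / real (Suc m))"
    unfolding reach_def grid_def by (auto intro: less_imp_le)
  then show "\<omega> \<in> (\<Union>n. reach n q (\<lambda>\<omega>. c \<omega> - 1 / real (Suc m)))" by blast
qed

text \<open>The bound in \<open>grid_hitting_upper\<close> is independent of the mesh and so
  survives monotone convergence over refining grids. Lowering the level by \<open>1 / Suc m\<close>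
  costs a factor that tends to 1.\<close>

lemma reach_limit_upper:
  assumes q: "0 \<le> q" and Y: "Y \<in> borel_measurable (F (ennreal q))" and Y_le: "\<And>\<omega>. Y \<omega> \<le> 1"
    and c: "c \<in> borel_measurable (F (ennreal q))"
  shows "(\<integral>\<^sup>+ \<omega>. Y \<omega> * indicator (reach_limit q c) \<omega> \<partial>M) \<le>
    (\<integral>\<^sup>+ \<omega>. Y \<omega> * ennreal (exp (\<Phi> * (X q \<omega> - c \<omega>))) * indicator {\<omega>. ennreal q < e \<omega>} \<omega> \<partial>M)" (is "?L \<le> ?u")
proof -
  have [measurable]: "Y \<in> borel_measurable M" "c \<in> borel_measurable M" "X q \<in> borel_measurable M"
    using F_M[OF Y] F_M[OF c] q by auto
  have "?L \<le> ennreal (exp (\<Phi> / real (Suc m))) * ?u" for m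
  proof -
    let ?c = "\<lambda>\<omega>. c \<omega> - 1 / real (Suc m)"
    have c': "?c \<in> borel_measurable (F (ennreal q))" using c by measurable
    have [measurable]: "Measurable.pred M (\<lambda>\<omega>. \<omega> \<in> reach n q ?c)" for n
      by (intro reach_pred q) measurable
    have inc: "incseq (\<lambda>n. reach n q ?c)" by (intro incseq_SucI reach_refine)
    have "?L \<le> (\<integral>\<^sup>+ \<omega>. (SUP n. Y \<omega> * indicator (reach n q ?c) \<omega>) \<partial>M)"
    proof (intro nn_integral_mono)
      fix \<omega>
      show "Y \<omega> * indicator (reach_limit q c) \<omega> \<le> (SUP n. Y \<omega> * indicator (reach n q ?c) \<omega>)"
      proof (cases "\<omega> \<in> reach_limit q c")
        case True
        then obtain n where "\<omega> \<in> reach n q ?c" by (auto simp: reach_limit_def)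
        then show ?thesis using True by (intro SUP_upper2[of n]) auto
      qed simp
    qed
    also have "\<dots> = (SUP n. \<integral>\<^sup>+ \<omega>. Y \<omega> * indicator (reach n q ?c) \<omega> \<partial>M)"
    proof (intro nn_integral_monotone_convergence_SUP)
      show "incseq (\<lambda>n \<omega>. Y \<omega> * indicator (reach n q ?c) \<omega>)"
        using inc by (auto simp: incseq_def le_fun_def subset_eq indicator_def)
    qed measurable
    also have "\<dots> \<le> (\<integral>\<^sup>+ \<omega>. Y \<omega> * ennreal (exp (\<Phi> * (X q \<omega> - ?c \<omega>))) * indicator {\<omega>. ennreal q < e \<omega>} \<omega> \<partial>M)"
      using \<Phi>_root by (intro SUP_least grid_hitting_upper q Y Y_le c') auto
    also have "\<dots> = (\<integral>\<^sup>+ \<omega>. ennreal (exp (\<Phi> / real (Suc m))) *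
       (Y \<omega> * ennreal (exp (\<Phi> * (X q \<omega> - c \<omega>))) * indicator {\<omega>. ennreal q < e \<omega>} \<omega>) \<partial>M)"
    proof (intro nn_integral_cong)
      fix \<omega>
      have "exp (\<Phi> * (X q \<omega> - ?c \<omega>)) = exp (\<Phi> / real (Suc m)) * exp (\<Phi> * (X q \<omega> - c \<omega>))"
        by (simp add: algebra_simps flip: exp_add)
      then have "ennreal (exp (\<Phi> * (X q \<omega> - ?c \<omega>))) = ennreal (exp (\<Phi> / real (Suc m))) * ennreal (exp (\<Phi> * (X q \<omega> - c \<omega>)))"
        by (simp only: ennreal_mult exp_ge_zero)
      then show "Y \<omega> * ennreal (exp (\<Phi> * (X q \<omega> - ?c \<omega>))) * indicator {\<omega>. ennreal q < e \<omega>} \<omega> =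
        ennreal (exp (\<Phi> / real (Suc m))) * (Y \<omega> * ennreal (exp (\<Phi> * (X q \<omega> - c \<omega>))) * indicator {\<omega>. ennreal q < e \<omega>} \<omega>)"
        by (simp only: mult_ac)
    qed
    also have "\<dots> = ennreal (exp (\<Phi> / real (Suc m))) * ?u"
      by (intro nn_integral_cmult) measurable
    finally show ?thesis .
  qed
  moreover have "(\<lambda>m. ennreal (exp (\<Phi> / real (Suc m))) * ?u) \<longlonglongrightarrow> ennreal 1 * ?u"
  proof (rule tendsto_mult_ennreal[OF tendsto_ennrealI tendsto_const])
    have "(\<lambda>m. exp (a / real (Suc m))) \<longlonglongrightarrow> 1" for a by real_asymp
    then show "(\<lambda>m. exp (\<Phi> / real (Suc m))) \<longlonglongrightarrow> 1" .
  qed simp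
  ultimately show ?thesis by (intro LIMSEQ_le_const[of _ "?u"]) auto
qed

text \<open>The upper bound for approaching \<open>c\<close> and the lower bound for meeting
  \<open>c + \<eta>\<close> on the grid differ only by the factor
  \<open>exp (- (\<Phi> * (d / 2 ^ n + \<eta>)))\<close>, so approach without a grid hit is rare. A
  positive \<open>\<eta>\<close> serves the uniqueness of the maximum, \<open>\<eta> = 0\<close> the
  grid records.\<close>

lemma reach_gap:
  assumes q: "0 \<le> q" and Y: "Y \<in> borel_measurable (F (ennreal q))" and Y_le: "\<And>\<omega>. Y \<omega> \<le> 1"
    and c: "c \<in> borel_measurable (F (ennreal q))" and below: "AE \<omega> in M. Y \<omega> \<noteq> 0 \<longrightarrow> X q \<omega> \<le> c \<omega>"
    and \<eta>: "0 \<le> \<eta>"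
  shows "(\<integral>\<^sup>+ \<omega>. Y \<omega> * indicator (reach_limit q c - reach n q (\<lambda>\<omega>. c \<omega> + \<eta>)) \<omega> \<partial>M) \<le>
    ennreal (1 - exp (- (\<Phi> * (d / 2 ^ n + \<eta>)))) *
    (\<integral>\<^sup>+ \<omega>. Y \<omega> * ennreal (exp (\<Phi> * (X q \<omega> - c \<omega>))) * indicator {\<omega>. ennreal q < e \<omega>} \<omega> \<partial>M)" (is "?G \<le> _ * ?u")
proof -
  have [measurable]: "Y \<in> borel_measurable M" "c \<in> borel_measurable M" "X q \<in> borel_measurable M"
    using F_M[OF Y] F_M[OF c] q by auto
  let ?c = "\<lambda>\<omega>. c \<omega> + \<eta>"
  let ?x = "\<Phi> * (d / 2 ^ n + \<eta>)"
  have c': "?c \<in> borel_measurable (F (ennreal q))" using c by measurable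
  have [measurable]: "Measurable.pred M (\<lambda>\<omega>. \<omega> \<in> reach n q ?c)"
    "Measurable.pred M (\<lambda>\<omega>. \<omega> \<in> reach_limit q c)"
    by (intro reach_pred reach_limit_pred q; measurable)+
  let ?A = "\<integral>\<^sup>+ \<omega>. Y \<omega> * indicator (reach_limit q c) \<omega> \<partial>M"
  let ?B = "\<integral>\<^sup>+ \<omega>. Y \<omega> * indicator (reach n q ?c) \<omega> \<partial>M"
  have "?u \<le> (\<integral>\<^sup>+ \<omega>. 1 \<partial>M)"
  proof (rule nn_integral_mono_AE)
    show "AE \<omega> in M. Y \<omega> * ennreal (exp (\<Phi> * (X q \<omega> - c \<omega>))) * indicator {\<omega>. ennreal q < e \<omega>} \<omega> \<le> 1"
      using below
    proof eventually_elim
      case (elim \<omega>)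
      show ?case
      proof (cases "Y \<omega> = 0")
        case False
        then have "ennreal (exp (\<Phi> * (X q \<omega> - c \<omega>))) \<le> 1" using elim \<Phi>_root(1) by (simp add: mult_nonneg_nonpos)
        then have "Y \<omega> * ennreal (exp (\<Phi> * (X q \<omega> - c \<omega>))) * indicator {\<omega>. ennreal q < e \<omega>} \<omega> \<le> 1 * 1 * 1"
          using Y_le by (intro mult_mono) (auto simp: indicator_def)
        then show ?thesis by simp
      qed simp
    qed
  qed
  then obtain u where u: "0 \<le> u" "?u = ennreal u"
    by (cases ?u) (auto simp: emeasure_space_1 top_unique)
  have A_le: "?A \<le> ennreal u" using reach_limit_upper[OF q Y Y_le c] u by simp
  then obtain A where A: "0 \<le> A" "?A = ennreal A" "A \<le> u" using u(1) by (cases ?A) (auto simp: top_unique)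
  have sub: "reach n q ?c \<subseteq> reach_limit q c" using \<eta> by (intro reach_subset_limit) simp
  have split: "?A = ?G + ?B"
  proof -
    have "?G + ?B = (\<integral>\<^sup>+ \<omega>. Y \<omega> * indicator (reach_limit q c - reach n q ?c) \<omega> + Y \<omega> * indicator (reach n q ?c) \<omega> \<partial>M)"
      unfolding indicator_diff by (intro nn_integral_add[symmetric]) measurable
    also have "\<dots> = ?A" using sub by (intro nn_integral_cong) (auto simp: indicator_def)
    finally show ?thesis by simp
  qed
  have "?B \<le> ennreal A" "?G \<le> ennreal A" unfolding A(2)[symmetric] split by (intro add_increasing add_increasing2; simp)+
  then obtain B G where BG: "0 \<le> B" "?B = ennreal B" "0 \<le> G" "?G = ennreal G"
    by (cases ?B; cases ?G) (auto simp: top_unique)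
  have AGB: "A = G + B" using split A BG by (simp flip: ennreal_plus)
  have "ennreal (exp (- (\<Phi> * \<eta>))) * ?u = (\<integral>\<^sup>+ \<omega>. ennreal (exp (- (\<Phi> * \<eta>))) *
      (Y \<omega> * ennreal (exp (\<Phi> * (X q \<omega> - c \<omega>))) * indicator {\<omega>. ennreal q < e \<omega>} \<omega>) \<partial>M)"
    by (intro nn_integral_cmult[symmetric]) measurable
  also have "\<dots> = (\<integral>\<^sup>+ \<omega>. Y \<omega> * ennreal (exp (\<Phi> * (X q \<omega> - ?c \<omega>))) * indicator {\<omega>. ennreal q < e \<omega>} \<omega> \<partial>M)"
  proof (intro nn_integral_cong)
    fix \<omega>
    have "exp (\<Phi> * (X q \<omega> - ?c \<omega>)) = exp (- (\<Phi> * \<eta>)) * exp (\<Phi> * (X q \<omega> - c \<omega>))"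
      by (simp add: algebra_simps flip: exp_add)
    then have "ennreal (exp (\<Phi> * (X q \<omega> - ?c \<omega>))) = ennreal (exp (- (\<Phi> * \<eta>))) * ennreal (exp (\<Phi> * (X q \<omega> - c \<omega>)))"
      by (simp only: ennreal_mult exp_ge_zero)
    then show "ennreal (exp (- (\<Phi> * \<eta>))) * (Y \<omega> * ennreal (exp (\<Phi> * (X q \<omega> - c \<omega>))) * indicator {\<omega>. ennreal q < e \<omega>} \<omega>)
      = Y \<omega> * ennreal (exp (\<Phi> * (X q \<omega> - ?c \<omega>))) * indicator {\<omega>. ennreal q < e \<omega>} \<omega>"
      by (simp only: mult_ac)
  qed
  also have "\<dots> \<le> ennreal (exp (\<Phi> * d / 2 ^ n)) * ?B"
    using \<Phi>_root \<Phi>_pos below \<eta> by (intro grid_hitting_lower q Y Y_le c') (auto elim!: eventually_mono)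
  finally have "exp (- (\<Phi> * \<eta>)) * u \<le> exp (\<Phi> * d / 2 ^ n) * B"
    using u BG by (simp flip: ennreal_mult)
  then have "exp (- (\<Phi> * d / 2 ^ n)) * (exp (- (\<Phi> * \<eta>)) * u) \<le> exp (- (\<Phi> * d / 2 ^ n)) * (exp (\<Phi> * d / 2 ^ n) * B)"
    by (intro mult_left_mono) auto
  also have "\<dots> = B" by (simp flip: mult.assoc exp_add)
  also have "exp (- (\<Phi> * d / 2 ^ n)) * (exp (- (\<Phi> * \<eta>)) * u) = exp (- ?x) * u"
    by (simp add: distrib_left flip: mult.assoc exp_add)
  finally have "G \<le> (1 - exp (- ?x)) * u" using AGB A(3) by (simp add: left_diff_distrib)
  moreover have "0 \<le> ?x" using \<Phi>_root d_pos \<eta> by simp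
  ultimately show ?thesis using u BG by (simp flip: ennreal_mult add: ennreal_leI)
qed

text \<open>Let c be the supremum up to a grid time q. If the supremum from q on is the same, then c
  is approached after q, while no level \<open>c + 1 / 2 ^ j\<close> is ever reached. By
  \<open>reach_gap\<close> this has probability 0.\<close>

lemma unique_max_time:
  "AE \<omega> in M. \<forall>n k. ennreal (grid n k) < e \<omega> \<longrightarrow>
     (SUP t\<in>{0..grid n k}. X t \<omega>) \<noteq> (SUP t\<in>{t. grid n k \<le> t \<and> ennreal t < e \<omega>}. X t \<omega>)"
proof -
  have "AE \<omega> in M. ennreal (grid n k) < e \<omega> \<longrightarrow>
     (SUP t\<in>{0..grid n k}. X t \<omega>) \<noteq> (SUP t\<in>{t. grid n k \<le> t \<and> ennreal t < e \<omega>}. X t \<omega>)" for n k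
  proof -
    define q where "q = grid n k"
    have q: "0 \<le> q" by (simp add: q_def)
    define D where "D = insert q {grid n' k' | n' k'. grid n' k' \<le> q}"
    have D: "countable D" "D \<noteq> {}" "D \<subseteq> {0..q}"
    proof -
      have "{grid n' k' | n' k'. grid n' k' \<le> q} \<subseteq> (\<lambda>(n', k'). grid n' k') ` UNIV" by auto
      then have "countable {grid n' k' | n' k'. grid n' k' \<le> q}"
        by (rule countable_subset) (intro countable_image countableI_type)
      then show "countable D" unfolding D_def by (rule countable_insert)
    qed (auto simp: D_def q)
    \<comment> \<open>Truncation at \<open>m\<close> keeps the supremum bounded on every path, as
      its measurability requires; on a given path it is inactive once \<open>m\<close> exceeds the
      supremum. The countable set \<open>D\<close> suffices by right continuity.\<close>
    define c where "c m \<omega> = (SUP r\<in>D. min (real m) (X r \<omega>))" for m \<omega>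
    have bddc: "bdd_above ((\<lambda>r. min (real m) (X r \<omega>)) ` D)" for m \<omega>
      by (rule bdd_aboveI2[of _ _ "real m"]) simp
    have c_F: "c m \<in> borel_measurable (F (ennreal q))" for m
      unfolding c_def[abs_def]
    proof (rule borel_measurable_cSUP[OF D(1)])
      fix r assume "r \<in> D"
      then have [measurable]: "X r \<in> borel_measurable (F (ennreal q))" using D(3) by (intro X_F) auto
      show "(\<lambda>\<omega>. min (real m) (X r \<omega>)) \<in> borel_measurable (F (ennreal q))" by measurable
    qed (rule bddc)
    have [measurable]: "c m \<in> borel_measurable M" "X q \<in> borel_measurable M" for m
      using F_M[OF c_F] q by auto
    define B where "B m = {\<omega>. X q \<omega> \<le> real m} \<inter> (reach_limit q (c m) - (\<Union>j. reach j q (\<lambda>\<omega>. c m \<omega> + 1 / 2 ^ j)))" for m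
    have "AE \<omega> in M. \<omega> \<notin> B m" for m
    proof -
      let ?Y = "\<lambda>\<omega>. indicator {\<omega>. X q \<omega> \<le> real m} \<omega> :: ennreal"
      have Y: "?Y \<in> borel_measurable (F (ennreal q))"
      proof -
        have [measurable]: "X q \<in> borel_measurable (F (ennreal q))" using q by (intro X_F) auto
        show ?thesis by measurable
      qed
      have [measurable]: "Measurable.pred M (\<lambda>\<omega>. \<omega> \<in> reach j q (\<lambda>\<omega>. c m \<omega> + 1 / 2 ^ j))"
        "Measurable.pred M (\<lambda>\<omega>. \<omega> \<in> reach_limit q (c m))" for j
        by (intro reach_pred reach_limit_pred q; measurable)+
      have XY: "?Y \<omega> \<noteq> 0 \<longrightarrow> X q \<omega> \<le> c m \<omega>" for \<omega>
      proof
        assume "?Y \<omega> \<noteq> 0"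
        then have "X q \<omega> = min (real m) (X q \<omega>)" by (simp add: indicator_def split: if_splits)
        also have "\<dots> \<le> c m \<omega>" unfolding c_def by (intro cSUP_upper bddc) (simp add: D_def)
        finally show "X q \<omega> \<le> c m \<omega>" .
      qed
      let ?G = "\<lambda>j \<omega>. ?Y \<omega> * indicator (reach_limit q (c m) - reach j q (\<lambda>\<omega>. c m \<omega> + 1 / 2 ^ j)) \<omega>"
      have small: "(\<integral>\<^sup>+ \<omega>. ?G j \<omega> \<partial>M) \<le> ennreal (1 - exp (- (\<Phi> * (d / 2 ^ j + 1 / 2 ^ j))))" for j
      proof -
        have "(\<integral>\<^sup>+ \<omega>. ?G j \<omega> \<partial>M) \<le> ennreal (1 - exp (- (\<Phi> * (d / 2 ^ j + 1 / 2 ^ j)))) *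
          (\<integral>\<^sup>+ \<omega>. ?Y \<omega> * ennreal (exp (\<Phi> * (X q \<omega> - c m \<omega>))) * indicator {\<omega>. ennreal q < e \<omega>} \<omega> \<partial>M)"
          using XY by (intro reach_gap q Y c_F) (auto simp: indicator_def)
        also have "\<dots> \<le> ennreal (1 - exp (- (\<Phi> * (d / 2 ^ j + 1 / 2 ^ j)))) * (\<integral>\<^sup>+ \<omega>. 1 \<partial>M)"
        proof (intro mult_left_mono nn_integral_mono)
          fix \<omega>
          show "?Y \<omega> * ennreal (exp (\<Phi> * (X q \<omega> - c m \<omega>))) * indicator {\<omega>. ennreal q < e \<omega>} \<omega> \<le> 1"
          proof (cases "?Y \<omega> = 0")
            case False
            then have "exp (\<Phi> * (X q \<omega> - c m \<omega>)) \<le> 1" using XY[of \<omega>] \<Phi>_root(1) by (simp add: mult_nonneg_nonpos)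
            then show ?thesis by (simp add: indicator_def)
          qed simp
        qed simp
        finally show ?thesis by (simp add: emeasure_space_1)
      qed
      define H where "H \<omega> = (INF j. ?G j \<omega>)" for \<omega>
      have [measurable]: "H \<in> borel_measurable M"
      proof -
        have [measurable]: "(\<lambda>\<omega>. ?G j \<omega>) \<in> borel_measurable M" for j
        proof -
          show ?thesis unfolding indicator_diff using F_M[OF Y] by measurable
        qed
        show ?thesis unfolding H_def[abs_def] by measurable
      qed
      have "(\<integral>\<^sup>+ \<omega>. H \<omega> \<partial>M) \<le> ennreal (1 - exp (- (\<Phi> * (d / 2 ^ j + 1 / 2 ^ j))))" for j
        using small[of j] by (rule order_trans[rotated]) (auto intro!: nn_integral_mono INF_lower simp: H_def)
      moreover have "(\<lambda>j. ennreal (1 - exp (- (\<Phi> * (d / 2 ^ j + 1 / 2 ^ j))))) \<longlonglongrightarrow> ennreal 0"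
            proof (rule tendsto_ennrealI)
        have "(\<lambda>j. 1 - exp (- (a * (b / 2 ^ j + 1 / 2 ^ j)))) \<longlonglongrightarrow> 0" for a b :: real by real_asymp
        then show "(\<lambda>j. 1 - exp (- (\<Phi> * (d / 2 ^ j + 1 / 2 ^ j)))) \<longlonglongrightarrow> 0" .
      qed
      ultimately have "(\<integral>\<^sup>+ \<omega>. H \<omega> \<partial>M) \<le> ennreal 0" by (intro LIMSEQ_le_const) auto
      then have "AE \<omega> in M. H \<omega> = 0" by (simp add: nn_integral_0_iff_AE)
      then show ?thesis
      proof eventually_elim
        case (elim \<omega>)
        show ?case
        proof
          assume "\<omega> \<in> B m"
          then have "?G j \<omega> = 1" for j by (auto simp: B_def)
          then show False using elim by (simp add: H_def)
        qed
      qed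
    qed
    then have "AE \<omega> in M. \<forall>m. \<omega> \<notin> B m" by (simp add: AE_all_countable)
    then show ?thesis
      using right_continuous path_upper killed_or_drift
    proof eventually_elim
      case (elim \<omega>)
      show ?case
      proof
        assume alive: "ennreal (grid n k) < e \<omega>"
        interpret killed_path "\<lambda>u. X u \<omega>" "e \<omega>" d
          using elim d_pos alive by unfold_locales (auto intro: le_less_trans[of 0 "ennreal (grid n k)"])
        let ?T = "{t. grid n k \<le> t \<and> ennreal t < e \<omega>}"
        have qa: "q \<in> alive" using alive q by (simp add: alive_def q_def)
        have sub: "{0..q} \<subseteq> alive" using alive_down[OF qa] by auto
        have sub2: "?T \<subseteq> alive" using q unfolding alive_def q_def[symmetric] by auto
        show "(SUP t\<in>{0..grid n k}. X t \<omega>) \<noteq> (SUP t\<in>?T. X t \<omega>)"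
        proof
          assume eq: "(SUP t\<in>{0..grid n k}. X t \<omega>) = (SUP t\<in>?T. X t \<omega>)"
          define S where "S = (SUP t\<in>{0..q}. X t \<omega>)"
          have S2: "S = (SUP t\<in>?T. X t \<omega>)" using eq by (simp add: S_def q_def)
          have S_ub: "X t \<omega> \<le> S" if "t \<in> {0..q}" for t
            unfolding S_def by (intro cSUP_upper that bdd_alive sub)
          have S_ub2: "X t \<omega> \<le> S" if "t \<in> ?T" for t
            unfolding S2 by (intro cSUP_upper that bdd_alive sub2)
          obtain m :: nat where m: "S \<le> real m" using real_arch_simple by blast
          have min_eq: "min (real m) (X r \<omega>) = X r \<omega>" if "r \<in> D" for r
            using S_ub[of r] that D(3) m by auto
          have c_eq: "c m \<omega> = S"
          proof (rule antisym)
            show "c m \<omega> \<le> S" unfolding c_def using D S_ub min_eq by (intro cSUP_least) auto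
            show "S \<le> c m \<omega>"
            proof (rule dense_le)
              fix y assume "y < S"
              then obtain t where t: "t \<in> {0..q}" "y < X t \<omega>"
                unfolding S_def using q sub by (subst (asm) less_cSUP_iff) (auto intro: bdd_alive)
              have "\<exists>r\<in>D. y < X r \<omega>"
              proof (cases "t = q")
                case True then show ?thesis using t by (auto simp: D_def)
              next
                case False
                obtain r where r: "r > t" "\<forall>s\<in>{t..<r}. y < X s \<omega>"
                  using right_nbhd[of t y] t sub by blast
                obtain n' k' where "t < grid n' k'" "grid n' k' < min r q"
                  using ex_grid_between[of t "min r q"] t False r(1) by auto
                moreover from this have "grid n' k' \<le> q" by simp
                then have "grid n' k' \<in> D" unfolding D_def by blast
                ultimately show ?thesis using r(2) by (intro bexI[of _ "grid n' k'"]) auto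
              qed
              then obtain r where "r \<in> D" "y < X r \<omega>" by blast
              then show "y \<le> c m \<omega>" unfolding c_def using min_eq[of r]
                by (intro cSUP_upper2[OF bddc, of r]) auto
            qed
          qed
          have "\<omega> \<in> reach_limit q (c m)"
          proof (rule reach_limitI)
            fix y assume "y < c m \<omega>"
            then have "y < (SUP t\<in>?T. X t \<omega>)" using c_eq S2 by simp
            moreover have "?T \<noteq> {}" using alive by auto
            ultimately obtain t where "t \<in> ?T" "y < X t \<omega>"
              using bdd_alive[OF sub2] by (subst (asm) less_cSUP_iff) auto
            then show "\<exists>t\<ge>q. ennreal t < e \<omega> \<and> y < X t \<omega>" by (auto simp: q_def)
          qed (use elim q in auto)
          moreover have "\<omega> \<notin> reach j q (\<lambda>\<omega>. c m \<omega> + 1 / 2 ^ j)" for j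
          proof
            assume "\<omega> \<in> reach j q (\<lambda>\<omega>. c m \<omega> + 1 / 2 ^ j)"
            then obtain i where i: "ennreal (q + real i / 2 ^ j) < e \<omega>" "c m \<omega> + 1 / 2 ^ j \<le> X (q + real i / 2 ^ j) \<omega>"
              by (auto simp: reach_def)
            have "X (q + real i / 2 ^ j) \<omega> \<le> S" using i(1) by (intro S_ub2) (simp add: q_def)
            moreover have "(0 :: real) < 1 / 2 ^ j" by simp
            ultimately show False using i(2) c_eq by linarith
          qed
          moreover have "X q \<omega> \<le> real m" using S_ub[of q] q m by auto
          ultimately have "\<omega> \<in> B m" by (auto simp: B_def)
          then show False using elim by blast
        qed
      qed
    qed
  qed
  then show ?thesis by (simp add: AE_all_countable)
qed

end



section \<open>Asymptotics of a grid step\<close>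

context killed_levy_fv
begin

abbreviation \<delta> :: "nat \<Rightarrow> real" where "\<delta> n \<equiv> 1 / 2 ^ n"

definition neg_mgf :: "real \<Rightarrow> nat \<Rightarrow> real" where
  "neg_mgf l n = (\<integral>\<omega>. exp (l * X (\<delta> n) \<omega>) * indicator {..<0} (X (\<delta> n) \<omega>) \<partial>M)"

text \<open>As \<open>exp 0 = 1\<close>, this is the probability of a negative step.\<close>

abbreviation p_neg :: "nat \<Rightarrow> real" where "p_neg \<equiv> neg_mgf 0"

lemma neg_mgf_integrable:
  "0 \<le> l \<Longrightarrow> integrable M (\<lambda>\<omega>. exp (l * X (\<delta> n) \<omega>) * indicator {..<0} (X (\<delta> n) \<omega>))"
  by (intro integrable_const_bound[where B = 1]) (auto simp: indicator_def mult_nonneg_nonpos)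

lemma nn_neg_mgf:
  assumes "0 \<le> l"
  shows "(\<integral>\<^sup>+ \<omega>. ennreal (exp (l * X (\<delta> n) \<omega>)) * indicator {..<0} (X (\<delta> n) \<omega>) \<partial>M) = ennreal (neg_mgf l n)"
proof -
  have "(\<integral>\<^sup>+ \<omega>. ennreal (exp (l * X (\<delta> n) \<omega>)) * indicator {..<0} (X (\<delta> n) \<omega>) \<partial>M)
    = (\<integral>\<^sup>+ \<omega>. ennreal (exp (l * X (\<delta> n) \<omega>) * indicator {..<0} (X (\<delta> n) \<omega>)) \<partial>M)"
    by (intro nn_integral_cong) (auto simp: indicator_def)
  also have "\<dots> = ennreal (neg_mgf l n)"
    unfolding neg_mgf_def by (intro nn_integral_eq_integral neg_mgf_integrable assms) auto
  finally show ?thesis .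
qed

lemma neg_mgf_bounds:
  assumes "0 \<le> l"
  shows "0 \<le> neg_mgf l n" "neg_mgf l n \<le> p_neg n" "p_neg n \<le> 1"
proof -
  show "0 \<le> neg_mgf l n" unfolding neg_mgf_def by (intro Bochner_Integration.integral_nonneg) auto
  show "neg_mgf l n \<le> p_neg n"
    unfolding neg_mgf_def using assms
    by (intro integral_mono neg_mgf_integrable) (auto simp: indicator_def mult_nonneg_nonpos)
  have "p_neg n \<le> (\<integral>\<omega>. 1 \<partial>M)"
    unfolding neg_mgf_def using neg_mgf_integrable[of 0 n]
    by (intro integral_mono) (auto simp: indicator_def)
  then show "p_neg n \<le> 1" by (simp add: prob_space)
qed

text \<open>\<open>X\<^sub>\<delta> / \<delta>\<close> converges to \<open>d\<close> in probability.\<close>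

lemma shortfall_tendsto: "(\<lambda>n. \<integral>\<omega>. min d (d - X (\<delta> n) \<omega> * 2 ^ n) \<partial>M) \<longlonglongrightarrow> 0"
  and shortfall_integrable: "integrable M (\<lambda>\<omega>. min d (d - X (\<delta> n) \<omega> * 2 ^ n))"
  and shortfall_nonneg: "AE \<omega> in M. 0 \<le> min d (d - X (\<delta> n) \<omega> * 2 ^ n)"
proof -
  have nonneg: "AE \<omega> in M. 0 \<le> d - X (\<delta> n) \<omega> * 2 ^ n" for n
    using mesh_increment_le[of n] by eventually_elim (simp add: pos_le_divide_eq)
  show nonneg': "AE \<omega> in M. 0 \<le> min d (d - X (\<delta> n) \<omega> * 2 ^ n)" for n
    using nonneg[of n] d_pos by auto
  show int: "integrable M (\<lambda>\<omega>. min d (d - X (\<delta> n) \<omega> * 2 ^ n))" for n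
    using nonneg'[of n] by (intro integrable_const_bound[where B = d]) auto
  \<comment> \<open>\<open>min_le_one_minus_exp\<close> with the cap \<open>d\<close> leads to the
    exponential moment at \<open>2 ^ n\<close>, and \<open>\<psi> (2 ^ n) / 2 ^ n\<close> tends to
    \<open>d\<close>, so the bound vanishes.\<close>
  have ub: "(\<integral>\<omega>. min d (d - X (\<delta> n) \<omega> * 2 ^ n) \<partial>M) \<le> (1 + d) * (1 - exp (- d) * exp (\<psi> (2 ^ n) / 2 ^ n))" for n
  proof -
    have intexp: "integrable M (\<lambda>\<omega>. exp (2 ^ n * X (\<delta> n) \<omega>))" by (intro exp_X_mesh_integrable) simp
    have "(\<integral>\<omega>. min d (d - X (\<delta> n) \<omega> * 2 ^ n) \<partial>M)
        \<le> (\<integral>\<omega>. (1 + d) * (1 - exp (- d) * exp (2 ^ n * X (\<delta> n) \<omega>)) \<partial>M)"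
    proof (rule integral_mono_AE[OF int])
      show "integrable M (\<lambda>\<omega>. (1 + d) * (1 - exp (- d) * exp (2 ^ n * X (\<delta> n) \<omega>)))" using intexp by simp
      show "AE \<omega> in M. min d (d - X (\<delta> n) \<omega> * 2 ^ n) \<le> (1 + d) * (1 - exp (- d) * exp (2 ^ n * X (\<delta> n) \<omega>))"
        using nonneg[of n]
      proof eventually_elim
        case (elim \<omega>)
        have "exp (- (d - X (\<delta> n) \<omega> * 2 ^ n)) = exp (- d) * exp (2 ^ n * X (\<delta> n) \<omega>)"
          by (simp add: mult.commute flip: exp_add)
        with min_le_one_minus_exp[OF less_imp_le[OF d_pos] elim] show ?case by (simp only:)
      qed
    qed
    also have "\<dots> = (1 + d) * (1 - exp (- d) * exp (\<psi> (2 ^ n) / 2 ^ n))"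
      using exp_X_mesh_integrable(2)[of "2 ^ n" n] intexp by (simp add: prob_space)
    finally show ?thesis .
  qed
  have "(\<lambda>n. (1 + d) * (1 - exp (- d) * exp (\<psi> (2 ^ n) / 2 ^ n))) \<longlonglongrightarrow> (1 + d) * (1 - exp (- d) * exp d)"
    by (intro tendsto_intros exponent.\<psi>_mesh_tendsto)
  then have lim: "(\<lambda>n. (1 + d) * (1 - exp (- d) * exp (\<psi> (2 ^ n) / 2 ^ n))) \<longlonglongrightarrow> 0"
    by (simp add: exp_minus)
  show "(\<lambda>n. \<integral>\<omega>. min d (d - X (\<delta> n) \<omega> * 2 ^ n) \<partial>M) \<longlonglongrightarrow> 0"
  proof (rule tendsto_sandwich[OF _ _ tendsto_const lim]; intro always_eventually allI)
    show "0 \<le> (\<integral>\<omega>. min d (d - X (\<delta> n) \<omega> * 2 ^ n) \<partial>M)" for n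
      using nonneg'[of n] by (rule integral_nonneg_AE)
  qed (rule ub)
qed

text \<open>A negative step puts the shortfall at its cap \<open>d\<close>, so the mean shortfall is
  at least \<open>d * p_neg n\<close>.\<close>

lemma p_neg_tendsto: "p_neg \<longlonglongrightarrow> 0"
proof -
  have "d * p_neg n \<le> (\<integral>\<omega>. min d (d - X (\<delta> n) \<omega> * 2 ^ n) \<partial>M)" for n
  proof -
    have "d * p_neg n = (\<integral>\<omega>. d * (exp (0 * X (\<delta> n) \<omega>) * indicator {..<0} (X (\<delta> n) \<omega>)) \<partial>M)"
      by (simp add: neg_mgf_def)
    also have "\<dots> \<le> (\<integral>\<omega>. min d (d - X (\<delta> n) \<omega> * 2 ^ n) \<partial>M)"
    proof (rule integral_mono_AE[OF _ shortfall_integrable])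
      show "integrable M (\<lambda>\<omega>. d * (exp (0 * X (\<delta> n) \<omega>) * indicator {..<0} (X (\<delta> n) \<omega>)))"
        using neg_mgf_integrable[of 0 n] by simp
      show "AE \<omega> in M. d * (exp (0 * X (\<delta> n) \<omega>) * indicator {..<0} (X (\<delta> n) \<omega>)) \<le> min d (d - X (\<delta> n) \<omega> * 2 ^ n)"
        using shortfall_nonneg[of n]
        by eventually_elim (auto simp: indicator_def mult_nonpos_nonneg)
    qed
    finally show ?thesis .
  qed
  then have le: "p_neg n \<le> (\<integral>\<omega>. min d (d - X (\<delta> n) \<omega> * 2 ^ n) \<partial>M) / d" for n
    using d_pos by (simp add: pos_le_divide_eq mult.commute)
  have lim: "(\<lambda>n. (\<integral>\<omega>. min d (d - X (\<delta> n) \<omega> * 2 ^ n) \<partial>M) / d) \<longlonglongrightarrow> 0"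
    using tendsto_divide_zero[OF shortfall_tendsto] .
  show ?thesis
  proof (rule tendsto_sandwich[OF _ _ tendsto_const lim])
    show "eventually (\<lambda>n. 0 \<le> p_neg n) sequentially"
      using neg_mgf_bounds(1)[OF order.refl] by (intro always_eventually allI)
    show "eventually (\<lambda>n. p_neg n \<le> (\<integral>\<omega>. min d (d - X (\<delta> n) \<omega> * 2 ^ n) \<partial>M) / d) sequentially"
      using le by (intro always_eventually allI)
  qed
qed

lemma exp_diff_bounds:
  fixes a b x :: real
  assumes "0 \<le> a" "0 \<le> b" "0 \<le> x"
  shows "b * x \<le> exp ((a + b) * x) - exp (a * x)" "exp ((a + b) * x) - exp (a * x) \<le> b * x * exp ((a + b) * x)"
proof -
  have eq: "exp ((a + b) * x) - exp (a * x) = exp (a * x) * (exp (b * x) - 1)"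
    by (simp add: algebra_simps exp_add)
  have "b * x \<le> exp (b * x) - 1" using exp_ge_add_one_self[of "b * x"] by linarith
  also have "\<dots> \<le> exp (a * x) * (exp (b * x) - 1)"
    using assms mult_right_mono[of 1 "exp (a * x)" "exp (b * x) - 1"] by simp
  finally show "b * x \<le> exp ((a + b) * x) - exp (a * x)" by (simp only: eq)
  have "1 - exp (- (b * x)) \<le> b * x" using exp_ge_add_one_self[of "- (b * x)"] by linarith
  then have "exp ((a + b) * x) * (1 - exp (- (b * x))) \<le> exp ((a + b) * x) * (b * x)" by (intro mult_left_mono) auto
  moreover have "exp ((a + b) * x) * (1 - exp (- (b * x))) = exp ((a + b) * x) - exp (a * x)"
    by (simp add: right_diff_distrib algebra_simps flip: exp_add)
  moreover have "b * x * exp ((a + b) * x) = exp ((a + b) * x) * (b * x)" by (rule mult.commute)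
  ultimately show "exp ((a + b) * x) - exp (a * x) \<le> b * x * exp ((a + b) * x)" by linarith
qed

lemma exp_mesh_deriv: "(\<lambda>n. (exp (c / 2 ^ n) - 1) * 2 ^ n) \<longlonglongrightarrow> (c :: real)"
  by real_asymp

text \<open>The full exponential moments are known, so only nonnegative steps remain. These are at
  most \<open>d / 2 ^ n\<close>, where the two exponentials differ by \<Phi> times the step to first
  order, and the mean positive part of the step is asymptotically \<open>d / 2 ^ n\<close>.\<close>

lemma neg_mgf_diff_tendsto:
  assumes l: "0 \<le> l"
  shows "(\<lambda>n. (neg_mgf l n - neg_mgf (l + \<Phi>) n) * 2 ^ n) \<longlonglongrightarrow> \<psi> l - \<psi> (l + \<Phi>) + \<Phi> * d"
proof -
  define f where "f x = exp ((l + \<Phi>) * x) - exp (l * x)" for x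
  define E where "E n = (\<integral>\<omega>. f (X (\<delta> n) \<omega>) * indicator {0..} (X (\<delta> n) \<omega>) \<partial>M)" for n
  define S where "S n = (\<integral>\<omega>. min d (d - X (\<delta> n) \<omega> * 2 ^ n) \<partial>M)" for n
  have l\<Phi>: "0 \<le> l + \<Phi>" using l \<Phi>_root by simp
  note ints = exp_X_mesh_integrable(1)[OF l] exp_X_mesh_integrable(1)[OF l\<Phi>]
    neg_mgf_integrable[OF l] neg_mgf_integrable[OF l\<Phi>]
  have f_split: "f x * indicator {0..} x = (exp ((l + \<Phi>) * x) - exp ((l + \<Phi>) * x) * indicator {..<0} x)
      - (exp (l * x) - exp (l * x) * indicator {..<0} x)" for x
    by (auto simp: f_def indicator_def)
  have intE: "integrable M (\<lambda>\<omega>. f (X (\<delta> n) \<omega>) * indicator {0..} (X (\<delta> n) \<omega>))" for n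
    unfolding f_split using ints by (intro Bochner_Integration.integrable_diff)
  have E_eq: "neg_mgf l n - neg_mgf (l + \<Phi>) n = exp (\<psi> l / 2 ^ n) - exp (\<psi> (l + \<Phi>) / 2 ^ n) + E n" for n
    unfolding E_def f_split neg_mgf_def using ints
      exp_X_mesh_integrable(2)[OF l] exp_X_mesh_integrable(2)[OF l\<Phi>]
    by (simp add: Bochner_Integration.integral_diff Bochner_Integration.integrable_diff)
  have E_lim: "(\<lambda>n. E n * 2 ^ n) \<longlonglongrightarrow> \<Phi> * d"
  proof (rule tendsto_sandwich)
    \<comment> \<open>The positive part of the scaled step is \<open>d\<close> minus the capped
      shortfall; so \<open>shortfall_tendsto\<close> gives its mean.\<close>
    have pos_part: "indicator {0..} x * x * 2 ^ n = d - min d (d - x * 2 ^ n)" for x :: real and n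
    proof (cases "0 \<le> x")
      case True
      then have "0 \<le> x * 2 ^ n" by simp
      then show ?thesis using True by simp
    next
      case False
      then have "x * 2 ^ n < 0" by (simp add: mult_neg_pos)
      then show ?thesis using False by simp
    qed
    have int_pos: "integrable M (\<lambda>\<omega>. \<Phi> * (d - min d (d - X (\<delta> n) \<omega> * 2 ^ n)))" for n
      using shortfall_integrable[of n] by simp
    have pos_int: "(\<integral>\<omega>. \<Phi> * (d - min d (d - X (\<delta> n) \<omega> * 2 ^ n)) \<partial>M) = \<Phi> * (d - S n)" for n
      using shortfall_integrable[of n] by (simp add: S_def prob_space)
    have E_2: "E n * 2 ^ n = (\<integral>\<omega>. f (X (\<delta> n) \<omega>) * indicator {0..} (X (\<delta> n) \<omega>) * 2 ^ n \<partial>M)" for n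
      by (simp add: E_def)
    show "eventually (\<lambda>n. \<Phi> * (d - S n) \<le> E n * 2 ^ n) sequentially"
    proof (intro always_eventually allI)
      fix n
      show "\<Phi> * (d - S n) \<le> E n * 2 ^ n"
        unfolding E_2 pos_int[symmetric]
      proof (intro integral_mono int_pos)
        show "integrable M (\<lambda>\<omega>. f (X (\<delta> n) \<omega>) * indicator {0..} (X (\<delta> n) \<omega>) * 2 ^ n)" using intE by simp
        fix \<omega>
        show "\<Phi> * (d - min d (d - X (\<delta> n) \<omega> * 2 ^ n)) \<le> f (X (\<delta> n) \<omega>) * indicator {0..} (X (\<delta> n) \<omega>) * 2 ^ n"
          unfolding pos_part[symmetric]
          using exp_diff_bounds(1)[of l \<Phi> "X (\<delta> n) \<omega>"] l \<Phi>_root(1)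
          by (auto simp: indicator_def f_def mult.assoc[symmetric] intro!: mult_right_mono)
      qed
    qed
    show "eventually (\<lambda>n. E n * 2 ^ n \<le> exp ((l + \<Phi>) * d / 2 ^ n) * (\<Phi> * (d - S n))) sequentially"
    proof (intro always_eventually allI)
      fix n
      show "E n * 2 ^ n \<le> exp ((l + \<Phi>) * d / 2 ^ n) * (\<Phi> * (d - S n))"
        unfolding E_2 pos_int[symmetric] Bochner_Integration.integral_mult_right_zero[symmetric]
      proof (intro integral_mono_AE)
        show "integrable M (\<lambda>\<omega>. f (X (\<delta> n) \<omega>) * indicator {0..} (X (\<delta> n) \<omega>) * 2 ^ n)" using intE by simp
        show "integrable M (\<lambda>\<omega>. exp ((l + \<Phi>) * d / 2 ^ n) * (\<Phi> * (d - min d (d - X (\<delta> n) \<omega> * 2 ^ n))))"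
          using int_pos by simp
        show "AE \<omega> in M. f (X (\<delta> n) \<omega>) * indicator {0..} (X (\<delta> n) \<omega>) * 2 ^ n
          \<le> exp ((l + \<Phi>) * d / 2 ^ n) * (\<Phi> * (d - min d (d - X (\<delta> n) \<omega> * 2 ^ n)))"
          using mesh_increment_le[of n]
        proof eventually_elim
          case (elim \<omega>)
          let ?x = "X (\<delta> n) \<omega>"
          show ?case
            unfolding pos_part[symmetric]
          proof (cases "0 \<le> ?x")
            case True
            have "f ?x \<le> \<Phi> * ?x * exp ((l + \<Phi>) * ?x)"
              unfolding f_def using True l \<Phi>_root(1) by (intro exp_diff_bounds(2))
            also have "(l + \<Phi>) * ?x \<le> (l + \<Phi>) * (d / 2 ^ n)" using elim l\<Phi> by (rule mult_left_mono)
            then have "\<Phi> * ?x * exp ((l + \<Phi>) * ?x) \<le> \<Phi> * ?x * exp ((l + \<Phi>) * d / 2 ^ n)"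
              using True \<Phi>_root(1) by (intro mult_left_mono) auto
            finally have "f ?x * 2 ^ n \<le> \<Phi> * ?x * exp ((l + \<Phi>) * d / 2 ^ n) * 2 ^ n" by (intro mult_right_mono) auto
            then show "f ?x * indicator {0..} ?x * 2 ^ n \<le> exp ((l + \<Phi>) * d / 2 ^ n) * (\<Phi> * (indicator {0..} ?x * ?x * 2 ^ n))"
              using True by (simp add: mult_ac)
          qed simp
        qed
      qed
    qed
    have S: "S \<longlonglongrightarrow> 0" unfolding S_def[abs_def] by (rule shortfall_tendsto)
    from tendsto_mult[OF tendsto_const[of \<Phi>] tendsto_diff[OF tendsto_const[of d] S]]
    show 1: "(\<lambda>n. \<Phi> * (d - S n)) \<longlonglongrightarrow> \<Phi> * d" by simp
    have "(\<lambda>n. exp (a / 2 ^ n)) \<longlonglongrightarrow> 1" for a :: real by real_asymp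
    from tendsto_mult[OF this 1] show "(\<lambda>n. exp ((l + \<Phi>) * d / 2 ^ n) * (\<Phi> * (d - S n))) \<longlonglongrightarrow> \<Phi> * d" by simp
  qed
  have "(\<lambda>n. (exp (\<psi> l / 2 ^ n) - 1) * 2 ^ n - (exp (\<psi> (l + \<Phi>) / 2 ^ n) - 1) * 2 ^ n + E n * 2 ^ n)
      \<longlonglongrightarrow> \<psi> l - \<psi> (l + \<Phi>) + \<Phi> * d"
    by (intro tendsto_intros exp_mesh_deriv E_lim)
  moreover have "(exp (\<psi> l / 2 ^ n) - 1) * 2 ^ n - (exp (\<psi> (l + \<Phi>) / 2 ^ n) - 1) * 2 ^ n + E n * 2 ^ n
      = (neg_mgf l n - neg_mgf (l + \<Phi>) n) * 2 ^ n" for n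
    unfolding E_eq by (simp add: algebra_simps)
  ultimately show ?thesis by simp
qed

text \<open>\<open>weight l n\<close> is, up to \<open>slack n\<close>, the contribution of one grid record to
  \<open>E[exp (l R)]\<close>, where \<open>R\<close> is the increment after the last grid record.\<close>

definition weight :: "real \<Rightarrow> nat \<Rightarrow> real" where
  "weight l n = (1 - exp (- p * \<delta> n)) + exp (- p * \<delta> n) * (neg_mgf l n - neg_mgf (l + \<Phi>) n)"

text \<open>The overshoot changes the probability of regaining the level by a relative error of the
  order of the mesh, and only after a negative step. The vanishing factor \<open>p_neg n\<close>
  makes the product negligible against \<open>weight 0 n\<close>.\<close>

definition slack :: "nat \<Rightarrow> real" where
  "slack n = (1 - exp (- (\<Phi> * (d / 2 ^ n)))) * p_neg n"

lemma weight_tendsto: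
  assumes "0 \<le> l"
  shows "(\<lambda>n. weight l n * 2 ^ n) \<longlonglongrightarrow> p + \<psi> l - \<psi> (l + \<Phi>) + \<Phi> * d"
proof -
  have 1: "(\<lambda>n. exp (- p / 2 ^ n)) \<longlonglongrightarrow> 1" by real_asymp
  have "(\<lambda>n. - ((exp (- p / 2 ^ n) - 1) * 2 ^ n) + exp (- p / 2 ^ n) * ((neg_mgf l n - neg_mgf (l + \<Phi>) n) * 2 ^ n))
      \<longlonglongrightarrow> - (- p) + 1 * (\<psi> l - \<psi> (l + \<Phi>) + \<Phi> * d)"
    by (intro tendsto_intros exp_mesh_deriv 1 neg_mgf_diff_tendsto assms)
  moreover have "- ((exp (- p / 2 ^ n) - 1) * 2 ^ n) + exp (- p / 2 ^ n) * ((neg_mgf l n - neg_mgf (l + \<Phi>) n) * 2 ^ n)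
      = weight l n * 2 ^ n" for n
    by (simp add: weight_def algebra_simps)
  ultimately show ?thesis by (simp add: algebra_simps)
qed

lemma slack_nonneg: "0 \<le> slack n"
  using neg_mgf_bounds(1)[of 0 n] \<Phi>_root(1) d_pos by (simp add: slack_def)

lemma slack_tendsto: "(\<lambda>n. slack n * 2 ^ n) \<longlonglongrightarrow> 0"
proof -
  have "(\<lambda>n. - ((exp (- (\<Phi> * d) / 2 ^ n) - 1) * 2 ^ n) * p_neg n) \<longlonglongrightarrow> - (- (\<Phi> * d)) * 0"
    by (intro tendsto_intros exp_mesh_deriv p_neg_tendsto)
  moreover have "- ((exp (- (\<Phi> * d) / 2 ^ n) - 1) * 2 ^ n) * p_neg n = slack n * 2 ^ n" for n
    by (simp add: slack_def algebra_simps)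
  ultimately show ?thesis by simp
qed

end



section \<open>Decomposition at the last grid record\<close>

context killed_levy_fv
begin

lemma killed_path: "AE \<omega> in M. killed_path (\<lambda>u. X u \<omega>) (e \<omega>) d"
  using right_continuous path_upper killed_or_drift e_pos[of 0] d_pos
  by (auto elim!: eventually_elim2 simp: killed_path_def)

text \<open>Decided at time \<open>grid n k\<close>, unlike \<open>last_record\<close>, which looks
  into the future; so the Markov property applies at this time.\<close>

definition grid_record :: "nat \<Rightarrow> nat \<Rightarrow> 'a set" where
  "grid_record n k = {\<omega>. ennreal (grid n k) < e \<omega> \<and> (\<forall>i\<in>{..k}. X (grid n i) \<omega> \<le> X (grid n k) \<omega>)}"

definition record_step :: "nat \<Rightarrow> nat \<Rightarrow> 'a \<Rightarrow> real" where
  "record_step n k \<omega> = (if ennreal (grid n (Suc k)) < e \<omega> then X (grid n (Suc k)) \<omega> - X (grid n k) \<omega> else 0)"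

abbreviation last_at :: "nat \<Rightarrow> nat \<Rightarrow> 'a set" where
  "last_at n k \<equiv> {\<omega>. last_record (\<lambda>u. X u \<omega>) (e \<omega>) n k}"

abbreviation record_prob :: "nat \<Rightarrow> nat \<Rightarrow> ennreal" where
  "record_prob n k \<equiv> \<integral>\<^sup>+ \<omega>. indicator (grid_record n k) \<omega> \<partial>M"

lemma X_grid_F: "i \<le> k \<Longrightarrow> X (grid n i) \<in> borel_measurable (F (ennreal (grid n k)))"
  by (intro X_F) auto

lemma grid_record_F: "(\<lambda>\<omega>. indicator (grid_record n k) \<omega> :: ennreal) \<in> borel_measurable (F (ennreal (grid n k)))"
proof -
  have [measurable]: "X (grid n k) \<in> borel_measurable (F (ennreal (grid n k)))" by (rule X_grid_F) simp
  have [measurable]: "X (grid n i) \<in> borel_measurable (F (ennreal (grid n k)))" if "i \<in> {..k}" for i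
    using that by (intro X_grid_F) simp
  have [measurable]: "Measurable.pred (F (ennreal (grid n k))) (\<lambda>\<omega>. ennreal (grid n k) < e \<omega>)" by (rule e_F) simp
  have "Measurable.pred (F (ennreal (grid n k))) (\<lambda>\<omega>. \<forall>i\<in>{..k}. X (grid n i) \<omega> \<le> X (grid n k) \<omega>)"
    by (intro pred_intros_finite) auto
  then show ?thesis unfolding grid_record_def by measurable
qed

lemma last_at_pred [measurable]: "Measurable.pred M (\<lambda>\<omega>. last_record (\<lambda>u. X u \<omega>) (e \<omega>) n k)"
proof -
  have [measurable]: "X (grid n i) \<in> borel_measurable M" for i by simp
  show ?thesis unfolding last_record_def by measurable
qed

lemma record_step_M [measurable]: "record_step n k \<in> borel_measurable M"
  unfolding record_step_def[abs_def] by measurable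

lemma record_next:
  assumes [measurable]: "g \<in> borel_measurable borel"
  shows "(\<integral>\<^sup>+ \<omega>. indicator (grid_record n k) \<omega> * (g (X (grid n (Suc k)) \<omega> - X (grid n k) \<omega>) *
      indicator {\<omega>. ennreal (grid n (Suc k)) < e \<omega>} \<omega>) \<partial>M)
    = record_prob n k * (ennreal (exp (- p * \<delta> n)) * (\<integral>\<^sup>+ \<omega>. g (X (\<delta> n) \<omega>) \<partial>M))"
proof -
  have "(\<integral>\<^sup>+ \<omega>. indicator (grid_record n k) \<omega> * (g (X (grid n k + \<delta> n) \<omega> - X (grid n k) \<omega>) *
      indicator {\<omega>. ennreal (grid n k + \<delta> n) < e \<omega>} \<omega>) \<partial>M)
    = (\<integral>\<^sup>+ \<omega>. indicator (grid_record n k) \<omega> * indicator {\<omega>. ennreal (grid n k) < e \<omega>} \<omega> \<partial>M) *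
      (ennreal (exp (- p * \<delta> n)) * (\<integral>\<^sup>+ \<omega>. g (X (\<delta> n) \<omega>) \<partial>M))"
    by (intro nn_killed_increment grid_record_F) auto
  also have "(\<integral>\<^sup>+ \<omega>. indicator (grid_record n k) \<omega> * indicator {\<omega>. ennreal (grid n k) < e \<omega>} \<omega> \<partial>M) = record_prob n k"
    by (intro nn_integral_cong) (auto simp: indicator_def grid_record_def)
  finally show ?thesis by (simp add: grid_Suc)
qed

text \<open>Measurable at the next grid time, as the factor \<open>Y\<close> in
  \<open>grid_hitting\<close> must be; survival of the step is kept as a separate indicator.\<close>

definition down_weight :: "real \<Rightarrow> nat \<Rightarrow> nat \<Rightarrow> 'a \<Rightarrow> ennreal" where
  "down_weight l n k \<omega> = indicator (grid_record n k) \<omega> *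
     (ennreal (exp (l * (X (grid n (Suc k)) \<omega> - X (grid n k) \<omega>))) * indicator {..<0} (X (grid n (Suc k)) \<omega> - X (grid n k) \<omega>))"

lemma down_weight_F: "down_weight l n k \<in> borel_measurable (F (ennreal (grid n (Suc k))))"
proof -
  have [measurable]: "X (grid n (Suc k)) \<in> borel_measurable (F (ennreal (grid n (Suc k))))"
    "X (grid n k) \<in> borel_measurable (F (ennreal (grid n (Suc k))))" by (intro X_grid_F; simp)+
  have [measurable]: "(\<lambda>\<omega>. indicator (grid_record n k) \<omega> :: ennreal) \<in> borel_measurable (F (ennreal (grid n (Suc k))))"
    by (rule F_mono[OF _ grid_record_F]) (simp add: ennreal_leI)
  show ?thesis unfolding down_weight_def[abs_def] by measurable
qed

lemma down_weight_le: "0 \<le> l \<Longrightarrow> down_weight l n k \<omega> \<le> 1"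
  by (auto simp: down_weight_def indicator_def mult_nonneg_nonpos)

lemma down_weight_below: "down_weight l n k \<omega> \<noteq> 0 \<longrightarrow> X (grid n (Suc k)) \<omega> \<le> X (grid n k) \<omega>"
  by (auto simp: down_weight_def indicator_def split: if_splits)

lemma nn_down_weight:
  assumes "0 \<le> l"
  shows "(\<integral>\<^sup>+ \<omega>. down_weight l n k \<omega> * indicator {\<omega>. ennreal (grid n (Suc k)) < e \<omega>} \<omega> \<partial>M)
    = record_prob n k * ennreal (exp (- p * \<delta> n) * neg_mgf l n)"
proof -
  have "(\<integral>\<^sup>+ \<omega>. down_weight l n k \<omega> * indicator {\<omega>. ennreal (grid n (Suc k)) < e \<omega>} \<omega> \<partial>M)
    = record_prob n k * (ennreal (exp (- p * \<delta> n)) * (\<integral>\<^sup>+ \<omega>. ennreal (exp (l * X (\<delta> n) \<omega>)) * indicator {..<0} (X (\<delta> n) \<omega>) \<partial>M))"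
    unfolding down_weight_def mult.assoc[of "indicator (grid_record n k) _"] by (rule record_next) measurable
  then show ?thesis using neg_mgf_bounds(1)[OF assms, of n] by (simp add: nn_neg_mgf[OF assms] ennreal_mult)
qed

text \<open>The exponential of \<Phi> times the step only moves \<open>l\<close> to
  \<open>l + \<Phi>\<close>. This is the origin of \<open>neg_mgf (l + \<Phi>)\<close> in
  \<open>weight\<close>.\<close>

lemma nn_down_weight_exp:
  assumes "0 \<le> l"
  shows "(\<integral>\<^sup>+ \<omega>. down_weight l n k \<omega> * ennreal (exp (\<Phi> * (X (grid n (Suc k)) \<omega> - X (grid n k) \<omega>))) *
      indicator {\<omega>. ennreal (grid n (Suc k)) < e \<omega>} \<omega> \<partial>M)
    = record_prob n k * ennreal (exp (- p * \<delta> n) * neg_mgf (l + \<Phi>) n)"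
proof -
  have "down_weight l n k \<omega> * ennreal (exp (\<Phi> * (X (grid n (Suc k)) \<omega> - X (grid n k) \<omega>))) = down_weight (l + \<Phi>) n k \<omega>" for \<omega>
    by (auto simp: down_weight_def indicator_def distrib_right exp_add ennreal_mult)
  then show ?thesis using nn_down_weight[of "l + \<Phi>" n k] assms \<Phi>_root(1) by simp
qed

lemma reach_grid:
  "reach n (grid n j) c = {\<omega>. \<exists>i\<ge>j. ennreal (grid n i) < e \<omega> \<and> c \<omega> \<le> X (grid n i) \<omega>}"
proof -
  have "grid n j + real i / 2 ^ n = grid n (j + i)" for i by (simp add: grid_def add_divide_distrib)
  then show ?thesis unfolding reach_def by (auto simp: le_iff_add)
qed

lemma e_mono: "ennreal (grid n i) < e \<omega> \<Longrightarrow> j \<le> i \<Longrightarrow> ennreal (grid n j) < e \<omega>"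
  by (meson ennreal_leI grid_le_iff le_less_trans)

text \<open>If the next grid time is dead, the record is the last one and its step is 0. If it is
  alive, the record is last exactly when its level is never reached again on the grid, and then the
  step is negative. After a negative step the two alternatives, last and regained, make up
  survival.\<close>

lemma record_decomposition:
  "indicator (last_at n k) \<omega> * ennreal (exp (l * record_step n k \<omega>)) +
     down_weight l n k \<omega> * indicator (reach n (grid n (Suc k)) (X (grid n k))) \<omega>
   = indicator (grid_record n k) \<omega> * indicator {\<omega>. \<not> ennreal (grid n (Suc k)) < e \<omega>} \<omega> +
     down_weight l n k \<omega> * indicator {\<omega>. ennreal (grid n (Suc k)) < e \<omega>} \<omega>"
proof (cases "\<omega> \<in> grid_record n k")
  case False
  then have "\<omega> \<notin> last_at n k" using e_mono[of n k \<omega>]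
    by (auto simp: grid_record_def dest: last_recordD)
  then show ?thesis using False by (simp add: down_weight_def)
next
  case rec: True
  have last_iff: "\<omega> \<in> last_at n k \<longleftrightarrow> \<omega> \<notin> reach n (grid n (Suc k)) (X (grid n k))"
  proof
    assume "\<omega> \<in> last_at n k"
    then have "last_record (\<lambda>u. X u \<omega>) (e \<omega>) n k" by simp
    from last_recordD(3)[OF this] show "\<omega> \<notin> reach n (grid n (Suc k)) (X (grid n k))"
      unfolding reach_grid by (force simp: not_le[symmetric])
  next
    assume "\<omega> \<notin> reach n (grid n (Suc k)) (X (grid n k))"
    then have "X (grid n i) \<omega> < X (grid n k) \<omega>" if "ennreal (grid n i) < e \<omega>" "\<not> i \<le> k" for i
      using that unfolding reach_grid by (auto simp: not_le[symmetric] Suc_le_eq)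
    then show "\<omega> \<in> last_at n k" using rec unfolding last_record_def grid_record_def by auto
  qed
  show ?thesis
  proof (cases "ennreal (grid n (Suc k)) < e \<omega>")
    case False
    then have "\<omega> \<notin> reach n (grid n (Suc k)) (X (grid n k))" unfolding reach_grid using e_mono by blast
    then show ?thesis using False rec last_iff by (simp add: record_step_def)
  next
    case True
    show ?thesis
    proof (cases "\<omega> \<in> reach n (grid n (Suc k)) (X (grid n k))")
      case False
      then have "X (grid n (Suc k)) \<omega> < X (grid n k) \<omega>" using True unfolding reach_grid by force
      then show ?thesis using False True rec last_iff by (simp add: record_step_def down_weight_def)
    qed (use True rec last_iff in simp)
  qed
qed

text \<open>Integrating \<open>record_decomposition\<close> gives the sought integral as explicit
  terms minus the regained mass. \<open>grid_hitting\<close> confines that mass up to the overshoot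
  factor, which accounts for \<open>slack\<close>.\<close>

lemma record_term:
  fixes n k :: nat
  assumes l: "0 \<le> l"
  defines "T \<equiv> \<integral>\<^sup>+ \<omega>. indicator (last_at n k) \<omega> * ennreal (exp (l * record_step n k \<omega>)) \<partial>M"
  shows "ennreal (weight l n) * record_prob n k \<le> T"
    and "T \<le> ennreal (weight l n + slack n) * record_prob n k"
proof -
  let ?q = "grid n (Suc k)" and ?c = "X (grid n k)"
  let ?R = "reach n ?q ?c"
  note [measurable] = F_M[OF down_weight_F[of l n k]] F_M[OF grid_record_F[of n k]]
  have [measurable]: "Measurable.pred M (\<lambda>\<omega>. \<omega> \<in> ?R)" by (intro reach_pred) auto
  define E where "E = exp (- p * \<delta> n)"
  have E: "0 < E" "E \<le> 1" using p_nonneg by (auto simp: E_def divide_nonpos_pos)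
  have "record_prob n k \<le> (\<integral>\<^sup>+ \<omega>. 1 \<partial>M)" by (intro nn_integral_mono) (simp add: indicator_def)
  then obtain r where r: "0 \<le> r" "record_prob n k = ennreal r"
    by (cases "record_prob n k") (auto simp: emeasure_space_1 top_unique)
  define b where "b = (\<integral>\<^sup>+ \<omega>. down_weight l n k \<omega> * indicator ?R \<omega> \<partial>M)"
  have c_F: "?c \<in> borel_measurable (F (ennreal ?q))" by (intro X_grid_F) simp
  have u0: "(\<integral>\<^sup>+ \<omega>. down_weight l n k \<omega> * ennreal (exp (\<Phi> * (X ?q \<omega> - ?c \<omega>))) * indicator {\<omega>. ennreal ?q < e \<omega>} \<omega> \<partial>M)
      = ennreal (r * (E * neg_mgf (l + \<Phi>) n))"
    using nn_down_weight_exp[OF l, of n k] r by (simp add: E_def ennreal_mult')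
  have m: "0 \<le> neg_mgf l n" "0 \<le> neg_mgf (l + \<Phi>) n" "neg_mgf (l + \<Phi>) n \<le> p_neg n"
    using neg_mgf_bounds l \<Phi>_root(1) by (auto intro: add_nonneg_nonneg)
  have b_ub: "b \<le> ennreal (r * (E * neg_mgf (l + \<Phi>) n))"
    unfolding b_def u0[symmetric] using \<Phi>_root
    by (intro grid_hitting_upper down_weight_F down_weight_le l c_F) auto
  have b_lb: "ennreal (r * (E * neg_mgf (l + \<Phi>) n)) \<le> ennreal (exp (\<Phi> * d / 2 ^ n)) * b"
    unfolding b_def u0[symmetric] using \<Phi>_root \<Phi>_pos down_weight_below
    by (intro grid_hitting_lower down_weight_F down_weight_le l c_F) auto
  obtain b' where b': "0 \<le> b'" "b = ennreal b'" using b_ub by (cases b) (auto simp: top_unique)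
  have dead: "(\<integral>\<^sup>+ \<omega>. indicator (grid_record n k) \<omega> * indicator {\<omega>. \<not> ennreal ?q < e \<omega>} \<omega> \<partial>M) = ennreal (r * (1 - E))" (is "?D = _")
  proof -
    have "?D + (\<integral>\<^sup>+ \<omega>. indicator (grid_record n k) \<omega> * (1 * indicator {\<omega>. ennreal ?q < e \<omega>} \<omega>) \<partial>M)
      = (\<integral>\<^sup>+ \<omega>. indicator (grid_record n k) \<omega> * indicator {\<omega>. \<not> ennreal ?q < e \<omega>} \<omega>
        + indicator (grid_record n k) \<omega> * (1 * indicator {\<omega>. ennreal ?q < e \<omega>} \<omega>) \<partial>M)"
      by (intro nn_integral_add[symmetric]) measurable
    also have "\<dots> = ennreal r" unfolding r(2)[symmetric]
      by (intro nn_integral_cong) (auto simp: indicator_def)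
    also have "(\<integral>\<^sup>+ \<omega>. indicator (grid_record n k) \<omega> * (1 * indicator {\<omega>. ennreal ?q < e \<omega>} \<omega>) \<partial>M) = ennreal (r * E)"
      using record_next[of "\<lambda>_. 1" n k] r by (simp add: E_def emeasure_space_1 ennreal_mult')
    finally have "?D = ennreal r - ennreal (r * E)" by (metis ennreal_add_diff_cancel_right ennreal_neq_top)
    then show ?thesis using r E by (simp add: ennreal_minus right_diff_distrib)
  qed
  have "T + b = ennreal (r * (1 - E)) + ennreal (r * (E * neg_mgf l n))"
  proof -
    have "T + b = (\<integral>\<^sup>+ \<omega>. indicator (grid_record n k) \<omega> * indicator {\<omega>. \<not> ennreal ?q < e \<omega>} \<omega> +
       down_weight l n k \<omega> * indicator {\<omega>. ennreal ?q < e \<omega>} \<omega> \<partial>M)"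
      unfolding T_def b_def record_decomposition[symmetric] by (intro nn_integral_add[symmetric]) measurable
    also have "\<dots> = ?D + (\<integral>\<^sup>+ \<omega>. down_weight l n k \<omega> * indicator {\<omega>. ennreal ?q < e \<omega>} \<omega> \<partial>M)"
      by (intro nn_integral_add) measurable
    finally show ?thesis using dead nn_down_weight[OF l, of n k] r by (simp add: E_def ennreal_mult')
  qed
  then have Tb: "T + ennreal b' = ennreal (r * (1 - E) + r * (E * neg_mgf l n))"
    using b' r E m by (subst ennreal_plus) auto
  then obtain t where t: "0 \<le> t" "T = ennreal t" by (cases T) auto
  have teq: "t + b' = r * (1 - E) + r * (E * neg_mgf l n)"
    using Tb t b' r E m by (simp flip: ennreal_plus)
  have b'_ub: "b' \<le> r * (E * neg_mgf (l + \<Phi>) n)" using b_ub b' r E m by simp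
  have "r * (E * neg_mgf (l + \<Phi>) n) \<le> exp (\<Phi> * d / 2 ^ n) * b'"
    using b_lb b' by (simp flip: ennreal_mult)
  then have "exp (- (\<Phi> * (d / 2 ^ n))) * (r * (E * neg_mgf (l + \<Phi>) n)) \<le> exp (- (\<Phi> * (d / 2 ^ n))) * (exp (\<Phi> * d / 2 ^ n) * b')"
    by (intro mult_left_mono) auto
  then have b'_lb: "exp (- (\<Phi> * (d / 2 ^ n))) * (r * (E * neg_mgf (l + \<Phi>) n)) \<le> b'"
    by (simp flip: mult.assoc exp_add)
  have w: "weight l n * r = r * (1 - E) + r * (E * neg_mgf l n) - r * (E * neg_mgf (l + \<Phi>) n)"
    by (simp add: weight_def E_def algebra_simps)
  have "weight l n * r \<le> t" using w teq b'_ub by linarith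
  then show "ennreal (weight l n) * record_prob n k \<le> T"
    using r t by (simp add: ennreal_leI flip: ennreal_mult'')
  have "r * (E * neg_mgf (l + \<Phi>) n) * (1 - exp (- (\<Phi> * (d / 2 ^ n)))) \<le> r * (1 * p_neg n) * (1 - exp (- (\<Phi> * (d / 2 ^ n))))"
    using r E m \<Phi>_root(1) d_pos by (intro mult_right_mono mult_left_mono mult_mono) auto
  also have "\<dots> = slack n * r" by (simp add: slack_def mult_ac)
  finally have "t \<le> (weight l n + slack n) * r" using w teq b'_lb by (simp add: algebra_simps)
  then show "T \<le> ennreal (weight l n + slack n) * record_prob n k"
    using r t by (simp add: ennreal_leI flip: ennreal_mult'')
qed

lemma last_at_sum:
  fixes f :: "nat \<Rightarrow> ennreal"
  assumes "killed_path (\<lambda>u. X u \<omega>) (e \<omega>) d"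
  shows "(\<Sum>k. indicator (last_at n k) \<omega> * f k) = f (last_record_idx (\<lambda>u. X u \<omega>) (e \<omega>) n)"
proof -
  interpret killed_path "\<lambda>u. X u \<omega>" "e \<omega>" d by fact
  let ?k = "last_record_idx (\<lambda>u. X u \<omega>) (e \<omega>) n"
  have "(\<Sum>k. indicator (last_at n k) \<omega> * f k) = (\<Sum>k\<in>{?k}. indicator (last_at n k) \<omega> * f k)"
    by (intro suminf_finite) (auto simp: indicator_def dest: last_record_idx_eq)
  then show ?thesis using last_record_idx[of n] by simp
qed

lemma record_step_idx: "record_step n (last_record_idx (\<lambda>u. X u \<omega>) (e \<omega>) n) \<omega> = record_drop (\<lambda>u. X u \<omega>) (e \<omega>) n"
  by (simp add: record_step_def record_drop_def Let_def)

text \<open>The expected number of grid records before \<open>e\<close>, as an extended number: its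
  finiteness will follow from the transform at \<open>l = 0\<close>.\<close>

definition record_sum :: "nat \<Rightarrow> ennreal" where
  "record_sum n = (\<Sum>k. record_prob n k)"

lemma record_drop_M [measurable]: "(\<lambda>\<omega>. record_drop (\<lambda>u. X u \<omega>) (e \<omega>) n) \<in> borel_measurable M"
proof -
  have [measurable]: "(\<lambda>\<omega>. last_record_idx (\<lambda>u. X u \<omega>) (e \<omega>) n) \<in> measurable M (count_space UNIV)"
    unfolding last_record_idx_def by measurable
  have "(\<lambda>\<omega>. record_step n (last_record_idx (\<lambda>u. X u \<omega>) (e \<omega>) n) \<omega>) \<in> borel_measurable M"
    by (rule measurable_compose_countable) measurable
  then show ?thesis by (simp only: record_step_idx)
qed

text \<open>Almost surely exactly one index carries the last record, so the transform is the sum of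
  the terms bounded in \<open>record_term\<close>.\<close>

lemma drop_laplace_bounds:
  fixes n :: nat
  assumes "0 \<le> l"
  defines "V \<equiv> \<integral>\<^sup>+ \<omega>. ennreal (exp (l * record_drop (\<lambda>u. X u \<omega>) (e \<omega>) n)) \<partial>M"
  shows "ennreal (weight l n) * record_sum n \<le> V" "V \<le> ennreal (weight l n + slack n) * record_sum n"
proof -
  have "V = (\<integral>\<^sup>+ \<omega>. (\<Sum>k. indicator (last_at n k) \<omega> * ennreal (exp (l * record_step n k \<omega>))) \<partial>M)"
    unfolding V_def using killed_path
    by (intro nn_integral_cong_AE) (auto elim!: eventually_mono simp: last_at_sum record_step_idx)
  also have "\<dots> = (\<Sum>k. \<integral>\<^sup>+ \<omega>. indicator (last_at n k) \<omega> * ennreal (exp (l * record_step n k \<omega>)) \<partial>M)"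
    by (intro nn_integral_suminf) measurable
  finally have V: "V = \<dots>" .
  show "ennreal (weight l n) * record_sum n \<le> V"
    unfolding V record_sum_def ennreal_suminf_cmult[symmetric]
    using record_term(1)[OF assms(1)] by (intro suminf_le summableI)
  show "V \<le> ennreal (weight l n + slack n) * record_sum n"
    unfolding V record_sum_def ennreal_suminf_cmult[symmetric]
    using record_term(2)[OF assms(1)] by (intro suminf_le summableI)
qed

text \<open>\<open>reach_gap\<close> with \<open>\<eta> = 0\<close> and the record value as level;
  bounding \<open>neg_mgf \<Phi> n\<close> by \<open>p_neg n\<close> brings out
  \<open>slack\<close>.\<close>

lemma neg_part_bad:
  "(\<integral>\<^sup>+ \<omega>. down_weight 0 n k \<omega> * indicator (reach_limit (grid n (Suc k)) (X (grid n k)) - reach n (grid n (Suc k)) (X (grid n k))) \<omega> \<partial>M)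
    \<le> ennreal (slack n) * record_prob n k"
proof -
  let ?q = "grid n (Suc k)" and ?c = "X (grid n k)"
  let ?x = "\<Phi> * (d / 2 ^ n)"
  have c_F: "?c \<in> borel_measurable (F (ennreal ?q))" by (intro X_grid_F) simp
  have "(\<integral>\<^sup>+ \<omega>. down_weight 0 n k \<omega> * indicator (reach_limit ?q ?c - reach n ?q (\<lambda>\<omega>. ?c \<omega> + 0)) \<omega> \<partial>M) \<le>
    ennreal (1 - exp (- (\<Phi> * (d / 2 ^ n + 0)))) *
    (\<integral>\<^sup>+ \<omega>. down_weight 0 n k \<omega> * ennreal (exp (\<Phi> * (X ?q \<omega> - ?c \<omega>))) * indicator {\<omega>. ennreal ?q < e \<omega>} \<omega> \<partial>M)"
    using down_weight_below by (intro reach_gap down_weight_F down_weight_le c_F) auto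
  also have "\<dots> = ennreal (1 - exp (- ?x)) * (record_prob n k * ennreal (exp (- p * \<delta> n) * neg_mgf \<Phi> n))"
    using nn_down_weight_exp[of 0 n k] by simp
  also have "\<dots> = ennreal ((1 - exp (- ?x)) * (exp (- p * \<delta> n) * neg_mgf \<Phi> n)) * record_prob n k"
    using \<Phi>_root(1) d_pos neg_mgf_bounds(1)[OF \<Phi>_root(1), of n] by (simp add: ennreal_mult' mult_ac)
  also have "\<dots> \<le> ennreal ((1 - exp (- ?x)) * (1 * p_neg n)) * record_prob n k"
    using \<Phi>_root(1) d_pos neg_mgf_bounds[OF \<Phi>_root(1), of n] p_nonneg
    by (intro mult_right_mono ennreal_leI mult_left_mono mult_mono) (auto simp: divide_nonpos_pos)
  finally show ?thesis by (simp add: slack_def)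
qed

end



section \<open>The law of the drop from the maximum\<close>

context killed_levy_fv
begin

abbreviation last_drop :: "nat \<Rightarrow> 'a \<Rightarrow> real" where
  "last_drop n \<omega> \<equiv> record_drop (\<lambda>u. X u \<omega>) (e \<omega>) n"

lemma weight_0_tendsto: "(\<lambda>n. weight 0 n * 2 ^ n) \<longlonglongrightarrow> \<Phi> * d"
  using weight_tendsto[of 0] \<Phi>_root by simp

lemma \<Phi>d_pos: "0 < \<Phi> * d"
  using \<Phi>_pos d_pos by simp

lemma weight_0_pos: "eventually (\<lambda>n. 0 < weight 0 n) sequentially"
  using order_tendstoD(1)[OF weight_0_tendsto \<Phi>d_pos]
  by eventually_elim (simp add: zero_less_mult_iff)

text \<open>The transform at \<open>l = 0\<close> is 1, which pins the expected number of records
  between two reciprocals.\<close>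

lemma record_sum_bounds:
  assumes w: "0 < weight 0 n"
  obtains u where "0 \<le> u" "record_sum n = ennreal u" "u \<le> 1 / weight 0 n" "1 / (weight 0 n + slack n) \<le> u"
proof -
  have 1: "ennreal (weight 0 n) * record_sum n \<le> 1" "1 \<le> ennreal (weight 0 n + slack n) * record_sum n"
    using drop_laplace_bounds[of 0 n] by (simp_all add: emeasure_space_1)
  have "record_sum n \<noteq> \<top>" using 1(1) w by (auto simp: ennreal_mult_top top_unique)
  then obtain u where u: "0 \<le> u" "record_sum n = ennreal u" by (cases "record_sum n") auto
  have ws: "0 < weight 0 n + slack n" using w slack_nonneg[of n] by linarith
  have "weight 0 n * u \<le> 1" using 1(1) u w by (simp flip: ennreal_mult)
  moreover have "1 \<le> (weight 0 n + slack n) * u" using 1(2) u ws by (simp flip: ennreal_mult)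
  ultimately show ?thesis using that[OF u] w ws
    by (simp add: pos_le_divide_eq pos_divide_le_eq mult.commute)
qed

text \<open>\<open>record_sum n\<close> grows like \<open>2 ^ n / (\<Phi> * d)\<close>, and
  \<open>weight l n\<close> multiplied by \<open>2 ^ n\<close> converges. The powers cancel and
  \<open>slack\<close> drops out.\<close>

lemma drop_laplace_tendsto:
  assumes l: "0 \<le> l"
  shows "(\<lambda>n. \<integral>\<^sup>+ \<omega>. ennreal (exp (l * last_drop n \<omega>)) \<partial>M)
    \<longlonglongrightarrow> ennreal ((p + \<psi> l - \<psi> (l + \<Phi>) + \<Phi> * d) / (\<Phi> * d))"
proof -
  define u where "u n = enn2real (record_sum n)" for n
  have u: "eventually (\<lambda>n. 0 \<le> u n \<and> record_sum n = ennreal (u n) \<and> u n \<le> 1 / weight 0 n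
      \<and> 1 / (weight 0 n + slack n) \<le> u n) sequentially"
    using weight_0_pos
  proof eventually_elim
    case (elim n)
    show ?case by (rule record_sum_bounds[OF elim]) (auto simp: u_def)
  qed
  have lim_u: "(\<lambda>n. u n / 2 ^ n) \<longlonglongrightarrow> 1 / (\<Phi> * d)"
  proof (rule tendsto_sandwich)
    have "(\<lambda>n. weight 0 n * 2 ^ n + slack n * 2 ^ n) \<longlonglongrightarrow> \<Phi> * d + 0"
      by (intro tendsto_add weight_0_tendsto slack_tendsto)
    then show "(\<lambda>n. 1 / (weight 0 n * 2 ^ n + slack n * 2 ^ n)) \<longlonglongrightarrow> 1 / (\<Phi> * d)"
      using \<Phi>d_pos by (intro tendsto_divide tendsto_const) auto
    show "(\<lambda>n. 1 / (weight 0 n * 2 ^ n)) \<longlonglongrightarrow> 1 / (\<Phi> * d)"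
      using \<Phi>d_pos by (intro tendsto_divide tendsto_const weight_0_tendsto) auto
    show "eventually (\<lambda>n. 1 / (weight 0 n * 2 ^ n + slack n * 2 ^ n) \<le> u n / 2 ^ n) sequentially"
      using u
    proof eventually_elim
      case (elim n)
      then have "1 / (weight 0 n + slack n) / 2 ^ n \<le> u n / 2 ^ n" by (intro divide_right_mono) auto
      then show ?case by (simp add: distrib_right)
    qed
    show "eventually (\<lambda>n. u n / 2 ^ n \<le> 1 / (weight 0 n * 2 ^ n)) sequentially"
      using u
    proof eventually_elim
      case (elim n)
      then have "u n / 2 ^ n \<le> 1 / weight 0 n / 2 ^ n" by (intro divide_right_mono) auto
      then show ?case by simp
    qed
  qed
  have lo: "(\<lambda>n. weight l n * u n) \<longlonglongrightarrow> (p + \<psi> l - \<psi> (l + \<Phi>) + \<Phi> * d) / (\<Phi> * d)"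
    using tendsto_mult[OF weight_tendsto[OF l] lim_u] by simp
  have "(\<lambda>n. slack n * u n) \<longlonglongrightarrow> 0 * (1 / (\<Phi> * d))"
    using tendsto_mult[OF slack_tendsto lim_u] by simp
  from tendsto_add[OF lo this]
  have hi: "(\<lambda>n. (weight l n + slack n) * u n) \<longlonglongrightarrow> (p + \<psi> l - \<psi> (l + \<Phi>) + \<Phi> * d) / (\<Phi> * d)"
    by (simp add: distrib_right)
  show ?thesis
  proof (rule tendsto_sandwich[OF _ _ tendsto_ennrealI[OF lo] tendsto_ennrealI[OF hi]])
    show "eventually (\<lambda>n. ennreal (weight l n * u n) \<le> (\<integral>\<^sup>+ \<omega>. ennreal (exp (l * last_drop n \<omega>)) \<partial>M)) sequentially"
      using u
    proof eventually_elim
      case (elim n)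
      then show ?case using drop_laplace_bounds(1)[OF l, of n] by (auto simp: ennreal_mult'')
    qed
    show "eventually (\<lambda>n. (\<integral>\<^sup>+ \<omega>. ennreal (exp (l * last_drop n \<omega>)) \<partial>M) \<le> ennreal ((weight l n + slack n) * u n)) sequentially"
      using u
    proof eventually_elim
      case (elim n)
      then show ?case using drop_laplace_bounds(2)[OF l, of n] by (auto simp: ennreal_mult'')
    qed
  qed
qed

text \<open>On \<open>late_max n\<close> the path returns to the level of its last grid record, but only between grid
  times; on \<open>killing_jump n\<close> it may jump at the killing time. Outside these events the increment after the
  last grid record sees the jump at the last maximum.\<close>

definition late_max :: "nat \<Rightarrow> 'a set" where
  "late_max n = {\<omega>\<in>space M. \<exists>k. last_record (\<lambda>u. X u \<omega>) (e \<omega>) n k \<and>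
     ennreal (grid n (Suc k)) < e \<omega> \<and> \<omega> \<in> reach_limit (grid n (Suc k)) (X (grid n k))}"

definition killing_jump :: "nat \<Rightarrow> 'a set" where
  "killing_jump n = {\<omega>\<in>space M. \<exists>k. ennreal (grid n k) < e \<omega> \<and> \<not> ennreal (grid n (Suc k)) < e \<omega> \<and>
     X (grid n (Suc k)) \<omega> < X (grid n k) \<omega>}"

lemma late_max_sets [measurable]: "late_max n \<in> sets M"
proof -
  have [measurable]: "Measurable.pred M (\<lambda>\<omega>. \<omega> \<in> reach_limit (grid n (Suc k)) (X (grid n k)))" for k
    by (intro reach_limit_pred) auto
  show ?thesis unfolding late_max_def by measurable
qed

lemma killing_jump_sets [measurable]: "killing_jump n \<in> sets M"
  unfolding killing_jump_def by measurable

text \<open>The level of a last record is not met again on the grid, so the events bounded in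
  \<open>neg_part_bad\<close> cover \<open>late_max\<close> as \<open>k\<close> varies.\<close>

lemma late_max_prob: "emeasure M (late_max n) \<le> ennreal (slack n) * record_sum n"
proof -
  let ?B = "\<lambda>k. reach_limit (grid n (Suc k)) (X (grid n k)) - reach n (grid n (Suc k)) (X (grid n k))"
  have [measurable]: "Measurable.pred M (\<lambda>\<omega>. \<omega> \<in> reach_limit (grid n (Suc k)) (X (grid n k)))"
    "Measurable.pred M (\<lambda>\<omega>. \<omega> \<in> reach n (grid n (Suc k)) (X (grid n k)))" for k
    by (intro reach_limit_pred reach_pred; simp)+
  note [measurable] = F_M[OF down_weight_F]
  have "emeasure M (late_max n) = (\<integral>\<^sup>+ \<omega>. indicator (late_max n) \<omega> \<partial>M)" by simp
  also have "\<dots> \<le> (\<integral>\<^sup>+ \<omega>. (\<Sum>k. down_weight 0 n k \<omega> * indicator (?B k) \<omega>) \<partial>M)"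
  proof (intro nn_integral_mono)
    fix \<omega>
    show "indicator (late_max n) \<omega> \<le> (\<Sum>k. down_weight 0 n k \<omega> * indicator (?B k) \<omega>)"
    proof (cases "\<omega> \<in> late_max n")
      case True
      then obtain k where k: "last_record (\<lambda>u. X u \<omega>) (e \<omega>) n k" "ennreal (grid n (Suc k)) < e \<omega>"
          "\<omega> \<in> reach_limit (grid n (Suc k)) (X (grid n k))" by (auto simp: late_max_def)
      have "X (grid n (Suc k)) \<omega> < X (grid n k) \<omega>" using last_recordD(3)[OF k(1,2)] by simp
      moreover have "\<omega> \<in> grid_record n k" using last_recordD(1,2)[OF k(1)] e_mono
        by (auto simp: grid_record_def)
      moreover have "\<omega> \<notin> reach n (grid n (Suc k)) (X (grid n k))"
        using last_recordD(3)[OF k(1)] unfolding reach_grid by (force simp: not_le[symmetric])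
      ultimately have 1: "down_weight 0 n k \<omega> * indicator (?B k) \<omega> = 1" using k(3) by (simp add: down_weight_def)
      have "(\<Sum>k'\<in>{k}. down_weight 0 n k' \<omega> * indicator (?B k') \<omega>) \<le> (\<Sum>k. down_weight 0 n k \<omega> * indicator (?B k) \<omega>)"
        by (intro sum_le_suminf summableI) auto
      then show ?thesis using 1 True by simp
    qed simp
  qed
  also have "\<dots> = (\<Sum>k. \<integral>\<^sup>+ \<omega>. down_weight 0 n k \<omega> * indicator (?B k) \<omega> \<partial>M)"
    by (intro nn_integral_suminf) measurable
  also have "\<dots> \<le> (\<Sum>k. ennreal (slack n) * record_prob n k)"
    by (intro suminf_le neg_part_bad summableI)
  finally show ?thesis by (simp add: record_sum_def)
qed

text \<open>Subtracting \<open>nn_killed_increment\<close> from \<open>nn_increment\<close> shows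
  that killing during a step is independent of the sign of its increment. Each step contributes
  \<open>p_neg n\<close> times its killing probability, and the latter telescope to at most
  1.\<close>

lemma killing_jump_prob: "emeasure M (killing_jump n) \<le> ennreal (p_neg n)"
proof -
  define q where "q k = exp (- p * grid n k)" for k
  have q: "0 < q k" "q k \<le> 1" for k
    using p_nonneg by (auto simp: q_def)
  have q_Suc: "q (Suc k) = q k * exp (- p * \<delta> n)" for k
    by (simp add: q_def grid_Suc distrib_left flip: exp_add)
  have q_dec: "q (Suc k) \<le> q k" for k using p_nonneg by (simp add: q_def mult_left_mono)
  define A where "A k = {\<omega>. ennreal (grid n k) < e \<omega> \<and> \<not> ennreal (grid n (Suc k)) < e \<omega> \<and> X (grid n (Suc k)) \<omega> < X (grid n k) \<omega>}" for k
  have [measurable]: "Measurable.pred M (\<lambda>\<omega>. \<omega> \<in> A k)" for k unfolding A_def mem_Collect_eq by measurable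
  have A_int: "(\<integral>\<^sup>+ \<omega>. indicator (A k) \<omega> \<partial>M) = ennreal (p_neg n * (q k - q (Suc k)))" for k
  proof -
    let ?a = "\<lambda>\<omega>. indicator {\<omega>. ennreal (grid n k) < e \<omega>} \<omega> :: ennreal"
    let ?g = "indicator {..<0} :: real \<Rightarrow> ennreal"
    have a_F: "?a \<in> borel_measurable (F (ennreal (grid n k)))" using e_F[OF order.refl] by measurable
    have a_int: "(\<integral>\<^sup>+ \<omega>. ?a \<omega> \<partial>M) = ennreal (q k)"
    proof -
      have "(\<integral>\<^sup>+ \<omega>. ?a \<omega> \<partial>M) = (\<integral>\<^sup>+ \<omega>. indicator {\<omega>\<in>space M. ennreal (grid n k) < e \<omega>} \<omega> \<partial>M)"
        by (intro nn_integral_cong) (auto simp: indicator_def)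
      then show ?thesis using survival[of "grid n k"] by (simp add: q_def)
    qed
    have g_int: "(\<integral>\<^sup>+ \<omega>. ?g (X (\<delta> n) \<omega>) \<partial>M) = ennreal (p_neg n)" using nn_neg_mgf[of 0 n] by simp
    have m1: "(\<integral>\<^sup>+ \<omega>. ?a \<omega> * ?g (X (grid n k + \<delta> n) \<omega> - X (grid n k) \<omega>) \<partial>M) = ennreal (q k) * ennreal (p_neg n)"
      unfolding a_int[symmetric] g_int[symmetric] by (intro nn_increment a_F) auto
    have m2: "(\<integral>\<^sup>+ \<omega>. ?a \<omega> * (?g (X (grid n k + \<delta> n) \<omega> - X (grid n k) \<omega>) * indicator {\<omega>. ennreal (grid n k + \<delta> n) < e \<omega>} \<omega>) \<partial>M)
        = ennreal (q (Suc k) * p_neg n)"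
    proof -
      have "?a \<omega> * ?a \<omega> = ?a \<omega>" for \<omega> by (simp add: indicator_def)
      then have "(\<integral>\<^sup>+ \<omega>. ?a \<omega> * (?g (X (grid n k + \<delta> n) \<omega> - X (grid n k) \<omega>) * indicator {\<omega>. ennreal (grid n k + \<delta> n) < e \<omega>} \<omega>) \<partial>M)
        = ennreal (q k) * (ennreal (exp (- p * \<delta> n)) * ennreal (p_neg n))"
        using nn_killed_increment[OF grid_nonneg _ a_F, of "\<delta> n" ?g] a_int g_int by simp
      also have "\<dots> = ennreal (q (Suc k) * p_neg n)"
        unfolding q_Suc using q(1)[of k] neg_mgf_bounds(1)[of 0 n] by (simp add: ennreal_mult mult.assoc)
      finally show ?thesis .
    qed
    have m3: "(\<integral>\<^sup>+ \<omega>. ?a \<omega> * ?g (X (grid n k + \<delta> n) \<omega> - X (grid n k) \<omega>) \<partial>M)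
      = (\<integral>\<^sup>+ \<omega>. indicator (A k) \<omega> \<partial>M) + (\<integral>\<^sup>+ \<omega>. ?a \<omega> * (?g (X (grid n k + \<delta> n) \<omega> - X (grid n k) \<omega>) * indicator {\<omega>. ennreal (grid n k + \<delta> n) < e \<omega>} \<omega>) \<partial>M)"
    proof -
      have [measurable]: "X (grid n k + \<delta> n) \<in> borel_measurable M" by (intro X_M) simp
      show ?thesis
        using e_mono[of n "Suc k" _ k]
        by (subst nn_integral_add[symmetric], measurable)
          (auto intro!: nn_integral_cong simp: A_def indicator_def grid_Suc)
    qed
    have "(\<integral>\<^sup>+ \<omega>. indicator (A k) \<omega> \<partial>M) + ennreal (q (Suc k) * p_neg n) = ennreal (q k * p_neg n)"
      using q(1)[of k] m3 unfolding m1 m2 by (simp add: ennreal_mult')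
    then have "(\<integral>\<^sup>+ \<omega>. indicator (A k) \<omega> \<partial>M) = ennreal (q k * p_neg n) - ennreal (q (Suc k) * p_neg n)"
      by (metis ennreal_add_diff_cancel_right ennreal_neq_top)
    then show ?thesis using q(1)[of "Suc k"] neg_mgf_bounds(1)[of 0 n]
      by (simp add: ennreal_minus algebra_simps)
  qed
  have "emeasure M (killing_jump n) = (\<integral>\<^sup>+ \<omega>. indicator (killing_jump n) \<omega> \<partial>M)" by simp
  also have "\<dots> \<le> (\<integral>\<^sup>+ \<omega>. (\<Sum>k. indicator (A k) \<omega>) \<partial>M)"
  proof (intro nn_integral_mono)
    fix \<omega>
    show "indicator (killing_jump n) \<omega> \<le> (\<Sum>k. indicator (A k) \<omega> :: ennreal)"
    proof (cases "\<omega> \<in> killing_jump n")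
      case True
      then obtain k where k: "\<omega> \<in> A k" by (auto simp: killing_jump_def A_def)
      have "(\<Sum>k\<in>{k}. indicator (A k) \<omega> :: ennreal) \<le> (\<Sum>k. indicator (A k) \<omega>)"
        by (intro sum_le_suminf summableI) auto
      then show ?thesis using k True by simp
    qed simp
  qed
  also have "\<dots> = (\<Sum>k. ennreal (p_neg n * (q k - q (Suc k))))"
    unfolding A_int[symmetric] by (intro nn_integral_suminf) measurable
  also have "\<dots> \<le> ennreal (p_neg n)"
  proof (intro suminf_le_const summableI)
    fix N
    have "(\<Sum>k<N. ennreal (p_neg n * (q k - q (Suc k)))) = ennreal (\<Sum>k<N. p_neg n * (q k - q (Suc k)))"
      using neg_mgf_bounds(1)[of 0 n] q_dec by (intro sum_ennreal) simp
    also have "(\<Sum>k<N. p_neg n * (q k - q (Suc k))) = p_neg n * (q 0 - q N)"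
      by (simp add: sum_lessThan_telescope' flip: sum_distrib_left)
    also have "ennreal (p_neg n * (q 0 - q N)) \<le> ennreal (p_neg n)"
      using neg_mgf_bounds(1)[of 0 n] q(1)[of N] q(2)[of 0]
      by (intro ennreal_leI mult_left_le) auto
    finally show "(\<Sum>k<N. ennreal (p_neg n * (q k - q (Suc k)))) \<le> ennreal (p_neg n)" .
  qed
  finally show ?thesis .
qed

lemma exceptional_tendsto: "(\<lambda>n. prob (late_max n \<union> killing_jump n)) \<longlonglongrightarrow> 0"
proof -
  have "eventually (\<lambda>n. prob (late_max n \<union> killing_jump n) \<le> slack n * 2 ^ n / (weight 0 n * 2 ^ n) + p_neg n) sequentially"
    using weight_0_pos
  proof eventually_elim
    case (elim n)
    obtain u where u: "0 \<le> u" "record_sum n = ennreal u" "u \<le> 1 / weight 0 n" by (rule record_sum_bounds[OF elim])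
    have "ennreal (prob (late_max n)) \<le> ennreal (slack n * u)"
      using late_max_prob[of n] u by (simp add: emeasure_eq_measure ennreal_mult'')
    then have "prob (late_max n) \<le> slack n * u" using u slack_nonneg by simp
    also have "\<dots> \<le> slack n * (1 / weight 0 n)" using u slack_nonneg by (intro mult_left_mono) auto
    finally have 1: "prob (late_max n) \<le> slack n * 2 ^ n / (weight 0 n * 2 ^ n)" by simp
    have 2: "prob (killing_jump n) \<le> p_neg n"
      using killing_jump_prob[of n] neg_mgf_bounds(1)[of 0 n] by (simp add: emeasure_eq_measure)
    have "prob (late_max n \<union> killing_jump n) \<le> prob (late_max n) + prob (killing_jump n)"
      by (intro measure_Un_le) measurable
    then show ?case using 1 2 by linarith
  qed
  moreover have "(\<lambda>n. slack n * 2 ^ n / (weight 0 n * 2 ^ n) + p_neg n) \<longlonglongrightarrow> 0 / (\<Phi> * d) + 0"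
    using \<Phi>d_pos by (intro tendsto_intros slack_tendsto weight_0_tendsto p_neg_tendsto) auto
  then have lim: "(\<lambda>n. slack n * 2 ^ n / (weight 0 n * 2 ^ n) + p_neg n) \<longlonglongrightarrow> 0" by simp
  ultimately show ?thesis
    using measure_nonneg by (intro tendsto_sandwich[OF _ _ tendsto_const lim]) simp_all
qed

text \<open>Making the exceptional probabilities smaller than \<open>(1 / 2) ^ j\<close> along a
  subsequence makes them summable, so Borel-Cantelli applies.\<close>

lemma good_subsequence:
  obtains r where "strict_mono r"
    "AE \<omega> in M. eventually (\<lambda>j. \<omega> \<notin> late_max (r j) \<union> killing_jump (r j)) sequentially"
proof -
  let ?P = "\<lambda>j n. prob (late_max n \<union> killing_jump n) < (1 / 2) ^ j"
  have ev: "\<exists>n>m. ?P j n" for j m :: nat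
  proof -
    have "eventually (?P j) sequentially" by (rule order_tendstoD(2)[OF exceptional_tendsto]) simp
    then obtain N where "\<And>n. n \<ge> N \<Longrightarrow> ?P j n" by (auto simp: eventually_sequentially)
    then show ?thesis by (intro exI[of _ "max N (Suc m)"]) auto
  qed
  have "\<exists>r. \<forall>j. ?P j (r j) \<and> r j < r (Suc j)"
    using ev by (intro dependent_nat_choice) blast+
  then obtain r where r: "strict_mono r" "\<And>j. ?P j (r j)" by (auto simp: strict_mono_Suc_iff)
  have "summable (\<lambda>j. prob (late_max (r j) \<union> killing_jump (r j)))"
    by (rule summable_comparison_test'[OF summable_geometric[of "1 / 2 :: real"]])
      (use r(2) in \<open>auto intro: less_imp_le\<close>)
  then have "AE \<omega> in M. eventually (\<lambda>j. \<omega> \<in> space M - (late_max (r j) \<union> killing_jump (r j))) sequentially"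
    by (intro borel_cantelli_AE1) (auto simp: emeasure_eq_measure)
  then show ?thesis by (intro that[OF r(1)]) (auto elim!: eventually_mono)
qed

text \<open>Absence of \<open>killing_jump\<close> along the subsequence gives left continuity at
  \<open>e\<close>, since \<open>no_jump\<close> asks for infinitely many grids only. Absence of
  \<open>late_max\<close> gives the premise \<open>good\<close> of
  \<open>record_drop_tendsto\<close>.\<close>

lemma
  shows path_unique_max: "AE \<omega> in M. killed_path_unique_max (\<lambda>u. X u \<omega>) (e \<omega>) d"
    and drop_subsequence: "\<exists>r. strict_mono r \<and> (AE \<omega> in M. (\<lambda>j. last_drop (r j) \<omega>) \<longlonglongrightarrow>
      X (enn2real (last_max_time X e \<omega>)) \<omega> - run_sup X (e \<omega>) \<omega>)"
proof -
  obtain r where r: "strict_mono r"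
    "AE \<omega> in M. eventually (\<lambda>j. \<omega> \<notin> late_max (r j) \<union> killing_jump (r j)) sequentially"
    by (rule good_subsequence)
  have r_top: "filterlim r at_top sequentially" using r(1) by (rule filterlim_subseq)
  show unique: "AE \<omega> in M. killed_path_unique_max (\<lambda>u. X u \<omega>) (e \<omega>) d"
    using killed_path unique_max_time cadlag[of 0] r(2) AE_space
  proof eventually_elim
    case (elim \<omega>)
    interpret killed_path "\<lambda>u. X u \<omega>" "e \<omega>" d by fact
    show ?case
    proof
      fix n k assume "grid n k \<in> alive"
      then have 1: "ennreal (grid n k) < e \<omega>" by (simp add: alive_def)
      have 2: "{t \<in> alive. grid n k \<le> t} = {t. grid n k \<le> t \<and> ennreal t < e \<omega>}"
        using order_trans[OF grid_nonneg[of n k]] by (auto simp: alive_def)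
      show "(SUP t\<in>{0..grid n k}. X t \<omega>) \<noteq> (SUP t\<in>{t \<in> alive. grid n k \<le> t}. X t \<omega>)"
        unfolding 2 using elim(2) 1 by blast
    next
      fix t assume t: "e \<omega> = ennreal t" "0 < t"
      obtain l where l: "((\<lambda>u. X u \<omega>) \<longlongrightarrow> l) (at_left t)"
        using elim(3) t(2) by (auto simp: Defs.cadlag_def)
      show "((\<lambda>u. X u \<omega>) \<longlongrightarrow> X t \<omega>) (at_left t)"
      proof (rule no_jump[OF t l])
        show "\<exists>\<^sub>F n in sequentially. \<forall>k. grid n k < t \<and> t \<le> grid n (Suc k) \<longrightarrow> X (grid n k) \<omega> \<le> X (grid n (Suc k)) \<omega>" (is "\<exists>\<^sub>F n in _. ?Q n")
          unfolding frequently_def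
        proof
          assume "eventually (\<lambda>n. \<not> ?Q n) sequentially"
          then have "eventually (\<lambda>j. \<not> ?Q (r j)) sequentially" by (rule eventually_compose_filterlim[OF _ r_top])
          with elim(4) have "eventually (\<lambda>j. False) sequentially"
          proof eventually_elim
            case (elim j)
            from elim(2) obtain k where k: "grid (r j) k < t" "t \<le> grid (r j) (Suc k)"
              "X (grid (r j) (Suc k)) \<omega> < X (grid (r j) k) \<omega>" by (auto simp: not_le)
            have "ennreal (grid (r j) k) < e \<omega>" "\<not> ennreal (grid (r j) (Suc k)) < e \<omega>"
              unfolding t(1) using k(1,2) t(2) by (auto simp: ennreal_less_iff not_less intro!: ennreal_leI)
            then have "\<omega> \<in> killing_jump (r j)" using k(3) \<open>\<omega> \<in> space M\<close> unfolding killing_jump_def by blast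
            then show False using elim(1) by blast
          qed
          then show False by simp
        qed
      qed
    qed
  qed
  show "\<exists>r. strict_mono r \<and> (AE \<omega> in M. (\<lambda>j. last_drop (r j) \<omega>) \<longlonglongrightarrow> X (enn2real (last_max_time X e \<omega>)) \<omega> - run_sup X (e \<omega>) \<omega>)"
  proof (intro exI[of _ r] conjI r(1))
    show "AE \<omega> in M. (\<lambda>j. last_drop (r j) \<omega>) \<longlonglongrightarrow> X (enn2real (last_max_time X e \<omega>)) \<omega> - run_sup X (e \<omega>) \<omega>"
      using unique r(2) right_continuous AE_space
    proof eventually_elim
      case (elim \<omega>)
      interpret killed_path_unique_max "\<lambda>u. X u \<omega>" "e \<omega>" d by fact
      have G: "last_max_time X e \<omega> = ennreal top_time"
        unfolding last_max_time_def run_sup_def using Sup_records by simp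
      have S: "run_sup X (e \<omega>) \<omega> = top_value"
        unfolding run_sup_def by (rule SUP_closed)
      have "(\<lambda>j. last_drop (r j) \<omega>) \<longlonglongrightarrow> X top_time \<omega> - top_value"
      proof (rule record_drop_tendsto[OF r_top])
        from elim(2)
        show "eventually (\<lambda>j. \<not> (\<exists>t\<in>alive. grid (r j) (Suc (last_record_idx (\<lambda>u. X u \<omega>) (e \<omega>) (r j))) < t \<and>
          X (grid (r j) (last_record_idx (\<lambda>u. X u \<omega>) (e \<omega>) (r j))) \<omega> \<le> X t \<omega>)) sequentially"
        proof eventually_elim
          case (elim j)
          let ?k = "last_record_idx (\<lambda>u. X u \<omega>) (e \<omega>) (r j)"
          show ?case
          proof
            assume "\<exists>t\<in>alive. grid (r j) (Suc ?k) < t \<and> X (grid (r j) ?k) \<omega> \<le> X t \<omega>"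
            then obtain t where t: "ennreal t < e \<omega>" "grid (r j) (Suc ?k) < t" "X (grid (r j) ?k) \<omega> \<le> X t \<omega>"
              by (auto simp: alive_def)
            have "ennreal (grid (r j) (Suc ?k)) < e \<omega>"
              using t by (meson ennreal_leI le_less_trans less_imp_le)
            moreover have "\<omega> \<in> reach_limit (grid (r j) (Suc ?k)) (X (grid (r j) ?k))"
            proof (rule reach_limitI[OF \<open>\<forall>t\<ge>0. ((\<lambda>u. X u \<omega>) \<longlongrightarrow> X t \<omega>) (at_right t)\<close> grid_nonneg])
              show "\<exists>t\<ge>grid (r j) (Suc ?k). ennreal t < e \<omega> \<and> y < X t \<omega>" if "y < X (grid (r j) ?k) \<omega>" for y
                using t that by (intro exI[of _ t]) auto
            qed
            ultimately have "\<omega> \<in> late_max (r j)"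
              using last_record_idx[of "r j"] \<open>\<omega> \<in> space M\<close> unfolding late_max_def by blast
            then show False using elim by blast
          qed
        qed
      qed
      then show ?case using G S top_time(1) by simp
    qed
  qed
qed

lemma drop_nonpos: "AE \<omega> in M. last_drop n \<omega> \<le> 0"
  using killed_path
proof eventually_elim
  case (elim \<omega>)
  interpret killed_path "\<lambda>u. X u \<omega>" "e \<omega>" d by fact
  show ?case unfolding record_drop_def Let_def
    using last_recordD(3)[OF last_record_idx[of n], of "Suc (last_record_idx (\<lambda>u. X u \<omega>) (e \<omega>) n)"]
    by (auto intro: less_imp_le)
qed

text \<open>The drops are almost surely nonpositive, so dominated convergence carries their
  transforms to the limit. \<open>jump_integral\<close> recognises the result as the transform of
  the claimed law, and \<open>laplace_determines_mixture\<close> concludes.\<close>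

lemma
  shows law_of_drop: "h \<in> borel_measurable borel \<Longrightarrow>
    (\<integral>\<^sup>+ \<omega>. h (X (enn2real (last_max_time X e \<omega>)) \<omega> - run_sup X (e \<omega>) \<omega>) \<partial>M)
    = ennreal (1 / (\<Phi> * d)) * (ennreal p * h 0 + (\<integral>\<^sup>+ z. h z * ennreal (1 - exp (\<Phi> * z)) \<partial>\<nu>))"
    and drop_limit_nonpos: "AE \<omega> in M. X (enn2real (last_max_time X e \<omega>)) \<omega> - run_sup X (e \<omega>) \<omega> \<le> 0"
proof -
  define Z where "Z \<omega> = X (enn2real (last_max_time X e \<omega>)) \<omega> - run_sup X (e \<omega>) \<omega>" for \<omega>
  obtain r where r: "strict_mono r" "AE \<omega> in M. (\<lambda>j. last_drop (r j) \<omega>) \<longlonglongrightarrow> Z \<omega>"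
    using drop_subsequence unfolding Z_def by blast
  \<comment> \<open>A version of \<open>Z\<close> that is measurable as a limit of measurable drops
    and agrees with \<open>Z\<close> almost surely.\<close>
  define Z' where "Z' \<omega> = lim (\<lambda>j. last_drop (r j) \<omega>)" for \<omega>
  have [measurable]: "Z' \<in> borel_measurable M" unfolding Z'_def[abs_def] by measurable
  have eq: "AE \<omega> in M. Z' \<omega> = Z \<omega>"
    using r(2) by eventually_elim (simp add: Z'_def limI)
  have "AE \<omega> in M. \<forall>n. last_drop n \<omega> \<le> 0" using drop_nonpos by (simp add: AE_all_countable)
  with r(2) have nonpos: "AE \<omega> in M. Z \<omega> \<le> 0"
    by eventually_elim (rule LIMSEQ_le_const2, auto)
  then show "AE \<omega> in M. Z \<omega> \<le> 0" .
  have laplace: "(\<integral>\<^sup>+ \<omega>. ennreal (exp (l * Z' \<omega>)) \<partial>M) = ennreal ((p + \<psi> l - \<psi> (l + \<Phi>) + \<Phi> * d) / (\<Phi> * d))"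
    if "0 \<le> l" for l
  proof (rule LIMSEQ_unique)
    show "(\<lambda>j. \<integral>\<^sup>+ \<omega>. ennreal (exp (l * last_drop (r j) \<omega>)) \<partial>M) \<longlonglongrightarrow> (\<integral>\<^sup>+ \<omega>. ennreal (exp (l * Z' \<omega>)) \<partial>M)"
    proof (rule nn_integral_dominated_convergence[where w = "\<lambda>_. 1"])
      show "AE \<omega> in M. ennreal (exp (l * last_drop (r j) \<omega>)) \<le> 1" for j
        using drop_nonpos[of "r j"] by eventually_elim (use that in \<open>simp add: mult_nonneg_nonpos\<close>)
      show "(\<integral>\<^sup>+ \<omega>. 1 \<partial>M) < \<infinity>" by (simp add: emeasure_space_1)
      show "AE \<omega> in M. (\<lambda>j. ennreal (exp (l * last_drop (r j) \<omega>))) \<longlonglongrightarrow> ennreal (exp (l * Z' \<omega>))"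
        using r(2) eq by eventually_elim (auto intro!: tendsto_ennrealI tendsto_intros)
    qed measurable
    show "(\<lambda>j. \<integral>\<^sup>+ \<omega>. ennreal (exp (l * last_drop (r j) \<omega>)) \<partial>M) \<longlonglongrightarrow> ennreal ((p + \<psi> l - \<psi> (l + \<Phi>) + \<Phi> * d) / (\<Phi> * d))"
      using LIMSEQ_subseq_LIMSEQ[OF drop_laplace_tendsto[OF that] r(1)] by (simp add: comp_def)
  qed
  define a where "a = ennreal (1 / (\<Phi> * d)) * ennreal p"
  define \<rho> where "\<rho> z = ennreal (1 / (\<Phi> * d)) * ennreal (1 - exp (\<Phi> * z))" for z
  have [measurable]: "\<rho> \<in> borel_measurable borel" unfolding \<rho>_def[abs_def] by measurable
  have mixture: "(\<integral>\<^sup>+ \<omega>. h (Z' \<omega>) \<partial>M) = a * h 0 + (\<integral>\<^sup>+ z. h z * \<rho> z \<partial>\<nu>)"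
    if "h \<in> borel_measurable borel" for h
  proof (rule laplace_determines_mixture[OF _ _ exponent.sets_\<nu> _ _ _ that])
    show "AE \<omega> in M. Z' \<omega> \<le> 0" using eq nonpos by eventually_elim simp
    show "AE z in \<nu>. z \<le> 0" using exponent.\<nu>_neg by eventually_elim simp
    fix k :: nat
    have "(\<integral>\<^sup>+ z. ennreal (exp (real k * z)) * \<rho> z \<partial>\<nu>)
      = (\<integral>\<^sup>+ z. ennreal (1 / (\<Phi> * d)) * (ennreal (exp (real k * z)) * ennreal (1 - exp (\<Phi> * z))) \<partial>\<nu>)"
      by (simp add: \<rho>_def mult_ac)
    also have "\<dots> = ennreal (1 / (\<Phi> * d)) * (\<integral>\<^sup>+ z. ennreal (exp (real k * z)) * ennreal (1 - exp (\<Phi> * z)) \<partial>\<nu>)"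
      by (intro nn_integral_cmult) measurable
    also have "\<dots> = ennreal (1 / (\<Phi> * d)) * ennreal (\<psi> (real k) - \<psi> (real k + \<Phi>) + d * \<Phi>)"
      using exponent.jump_integral[OF of_nat_0_le_iff \<Phi>_root(1), of k] by simp
    finally have int: "(\<integral>\<^sup>+ z. ennreal (exp (real k * z)) * \<rho> z \<partial>\<nu>) = \<dots>" .
    have nn: "0 \<le> \<psi> (real k) - \<psi> (real k + \<Phi>) + d * \<Phi>" by (rule exponent.jump_integral_nonneg[OF of_nat_0_le_iff \<Phi>_root(1)])
    have "a + (\<integral>\<^sup>+ z. ennreal (exp (real k * z)) * \<rho> z \<partial>\<nu>)
      = ennreal (1 / (\<Phi> * d)) * (ennreal p + ennreal (\<psi> (real k) - \<psi> (real k + \<Phi>) + d * \<Phi>))"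
      unfolding int a_def by (simp add: distrib_left)
    also have "\<dots> = ennreal (1 / (\<Phi> * d) * (p + (\<psi> (real k) - \<psi> (real k + \<Phi>) + d * \<Phi>)))"
      using \<Phi>d_pos p_nonneg nn by (simp only: ennreal_plus ennreal_mult' zero_le_divide_1_iff less_imp_le)
    also have "\<dots> = (\<integral>\<^sup>+ \<omega>. ennreal (exp (real k * Z' \<omega>)) \<partial>M)"
      unfolding laplace[OF of_nat_0_le_iff] by (intro arg_cong[where f = ennreal]) (simp add: mult.commute)
    finally show "(\<integral>\<^sup>+ \<omega>. ennreal (exp (real k * Z' \<omega>)) \<partial>M) = a + (\<integral>\<^sup>+ z. ennreal (exp (real k * z)) * \<rho> z \<partial>\<nu>)" by simp
  qed measurable
  show "(\<integral>\<^sup>+ \<omega>. h (Z \<omega>) \<partial>M)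
    = ennreal (1 / (\<Phi> * d)) * (ennreal p * h 0 + (\<integral>\<^sup>+ z. h z * ennreal (1 - exp (\<Phi> * z)) \<partial>\<nu>))"
    if h: "h \<in> borel_measurable borel"
  proof -
    note [measurable] = h
    have "(\<integral>\<^sup>+ \<omega>. h (Z \<omega>) \<partial>M) = (\<integral>\<^sup>+ \<omega>. h (Z' \<omega>) \<partial>M)"
      using eq by (intro nn_integral_cong_AE) auto
    also have "\<dots> = a * h 0 + (\<integral>\<^sup>+ z. ennreal (1 / (\<Phi> * d)) * (h z * ennreal (1 - exp (\<Phi> * z))) \<partial>\<nu>)"
      unfolding mixture[OF h] by (simp add: \<rho>_def mult_ac)
    also have "(\<integral>\<^sup>+ z. ennreal (1 / (\<Phi> * d)) * (h z * ennreal (1 - exp (\<Phi> * z))) \<partial>\<nu>)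
        = ennreal (1 / (\<Phi> * d)) * (\<integral>\<^sup>+ z. h z * ennreal (1 - exp (\<Phi> * z)) \<partial>\<nu>)"
      by (intro nn_integral_cmult) measurable
    finally show ?thesis by (simp add: a_def distrib_left mult.assoc)
  qed
qed

end



section \<open>The Lamperti transform\<close>

locale lamperti_path = killed_path_unique_max +
  fixes \<alpha> :: real
  assumes \<alpha>_pos: "0 < \<alpha>"
begin

section \<open>The clock of the time change and its inverse\<close>

definition clock :: "ennreal \<Rightarrow> ennreal" where
  "clock t = (\<integral>\<^sup>+ u\<in>{u. 0 \<le> u \<and> ennreal u \<le> t}. ennreal (exp (\<alpha> * f u)) \<partial>lborel)"

definition rclock :: "real \<Rightarrow> real" where
  "rclock t = enn2real (clock (ennreal t))"

definition Y :: "real \<Rightarrow> real" where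
  "Y s = (if ennreal s < clock e
     then exp (f (enn2real (Inf {ennreal t | t. 0 \<le> t \<and> clock (ennreal t) > ennreal s}))) else 0)"

text \<open>Right continuity makes the path a pointwise limit of step functions evaluated at
  \<open>next_grid\<close>.\<close>

lemma f_measurable: "(\<lambda>u. if 0 \<le> u then f u else 0) \<in> borel_measurable borel"
proof (rule borel_measurable_LIMSEQ_real)
  fix u :: real assume "u \<in> space borel"
  show "(\<lambda>n. if 0 \<le> u then f (next_grid n u) else 0) \<longlonglongrightarrow> (if 0 \<le> u then f u else 0)"
    using right_limit_next_grid[OF _ right_cont, of u] by simp
next
  fix n
  have "(\<lambda>u :: real. nat \<lfloor>u * 2 ^ n\<rfloor>) \<in> measurable borel (count_space UNIV)" by measurable
  then have "(\<lambda>u. f (next_grid n u)) \<in> borel_measurable borel"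
    unfolding next_grid_def by (rule measurable_compose[where g = "\<lambda>k. f (grid n (k + 1))"]) simp
  then show "(\<lambda>u. if 0 \<le> u then f (next_grid n u) else 0) \<in> borel_measurable borel"
    by measurable
qed

text \<open>Values of \<open>f\<close> at negative arguments are arbitrary; setting them to 0 gives
  a Borel function on the whole line, as integration against \<open>lborel\<close> needs.\<close>

definition rate :: "real \<Rightarrow> ennreal" where
  "rate u = ennreal (exp (\<alpha> * (if 0 \<le> u then f u else 0)))"

lemma rate_measurable [measurable]: "rate \<in> borel_measurable borel"
  unfolding rate_def[abs_def] using f_measurable by measurable

lemma clock_eq: "0 \<le> t \<Longrightarrow> clock (ennreal t) = (\<integral>\<^sup>+ u\<in>{0..t}. rate u \<partial>lborel)"
  unfolding clock_def by (intro nn_integral_cong) (auto simp: rate_def indicator_def)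

lemma clock_split:
  assumes "0 \<le> s" "s \<le> t"
  shows "clock (ennreal t) = clock (ennreal s) + (\<integral>\<^sup>+ u\<in>{s<..t}. rate u \<partial>lborel)"
proof -
  have "(\<integral>\<^sup>+ u\<in>{0..t}. rate u \<partial>lborel) = (\<integral>\<^sup>+ u. rate u * indicator {0..s} u + rate u * indicator {s<..t} u \<partial>lborel)"
    using assms by (intro nn_integral_cong) (auto simp: indicator_def)
  also have "\<dots> = (\<integral>\<^sup>+ u\<in>{0..s}. rate u \<partial>lborel) + (\<integral>\<^sup>+ u\<in>{s<..t}. rate u \<partial>lborel)"
    by (intro nn_integral_add) measurable
  finally show ?thesis using assms by (simp add: clock_eq)
qed

lemma slice_upper:
  assumes "0 \<le> s" "s \<le> t" "t \<le> T"
  shows "(\<integral>\<^sup>+ u\<in>{s<..t}. rate u \<partial>lborel) \<le> ennreal (exp (\<alpha> * (f 0 + c * T)) * (t - s))"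
proof -
  have "rate u \<le> ennreal (exp (\<alpha> * (f 0 + c * T)))" if "u \<in> {s<..t}" for u
  proof -
    have "f u \<le> f 0 + c * (u - 0)" using that assms by (intro upper) auto
    also have "c * (u - 0) \<le> c * T" using that assms c_nonneg by (intro mult_left_mono) auto
    finally show ?thesis using that assms \<alpha>_pos by (simp add: rate_def)
  qed
  then have "(\<integral>\<^sup>+ u\<in>{s<..t}. rate u \<partial>lborel) \<le> (\<integral>\<^sup>+ u. ennreal (exp (\<alpha> * (f 0 + c * T))) * indicator {s<..t} u \<partial>lborel)"
    by (intro nn_integral_mono) (auto simp: indicator_def)
  also have "\<dots> = ennreal (exp (\<alpha> * (f 0 + c * T)) * (t - s))"
    using assms by (simp add: nn_integral_cmult_indicator ennreal_mult)
  finally show ?thesis .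
qed

lemma slice_pos: "s < t \<Longrightarrow> 0 < (\<integral>\<^sup>+ u\<in>{s<..t}. rate u \<partial>lborel)"
proof (rule ccontr)
  assume "s < t" and "\<not> 0 < (\<integral>\<^sup>+ u\<in>{s<..t}. rate u \<partial>lborel)"
  then have "(\<integral>\<^sup>+ u\<in>{s<..t}. rate u \<partial>lborel) = 0" by simp
  then have "AE u in lborel. rate u * indicator {s<..t} u = 0"
    by (subst (asm) nn_integral_0_iff_AE) measurable
  then have "AE u in lborel. u \<notin> {s<..t}"
    by eventually_elim (auto simp: rate_def indicator_def split: if_splits)
  then have "emeasure lborel {s<..t} = 0" by (subst (asm) AE_iff_measurable[of "{s<..t}"]) auto
  then show False using \<open>s < t\<close> by simp
qed

lemma clock_0: "clock (ennreal 0) = 0"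
proof -
  have "(\<integral>\<^sup>+ u\<in>{0..0}. rate u \<partial>lborel) = (\<integral>\<^sup>+ u. rate 0 * indicator {0 :: real} u \<partial>lborel)"
    by (intro nn_integral_cong) (auto simp: indicator_def)
  also have "\<dots> = 0" by (simp add: nn_integral_cmult_indicator)
  finally show ?thesis using clock_eq[of 0] by simp
qed

lemma clock_finite: "0 \<le> t \<Longrightarrow> clock (ennreal t) = ennreal (rclock t)"
proof -
  assume t: "0 \<le> t"
  have "clock (ennreal t) = clock (ennreal 0) + (\<integral>\<^sup>+ u\<in>{0<..t}. rate u \<partial>lborel)"
    using t by (intro clock_split) auto
  also have "\<dots> = (\<integral>\<^sup>+ u\<in>{0<..t}. rate u \<partial>lborel)" using clock_0 by simp
  also have "\<dots> < \<infinity>" using slice_upper[of 0 t t] t by (metis ennreal_less_top infinity_ennreal_def le_less_trans order.refl)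
  finally show ?thesis by (simp add: rclock_def)
qed

lemma rclock_0 [simp]: "rclock 0 = 0"
  using clock_0 by (simp add: rclock_def)

lemma rclock_nonneg [simp]: "0 \<le> rclock t"
  by (simp add: rclock_def)

lemma rclock_increment:
  assumes "0 \<le> s" "s \<le> t"
  shows "(\<integral>\<^sup>+ u\<in>{s<..t}. rate u \<partial>lborel) = ennreal (rclock t - rclock s)" "rclock s \<le> rclock t"
proof -
  have eq: "ennreal (rclock t) = ennreal (rclock s) + (\<integral>\<^sup>+ u\<in>{s<..t}. rate u \<partial>lborel)"
    using clock_split[OF assms] clock_finite assms by simp
  have "ennreal (rclock s) \<le> ennreal (rclock t)" unfolding eq by simp
  then show "rclock s \<le> rclock t" by simp
  have "(\<integral>\<^sup>+ u\<in>{s<..t}. rate u \<partial>lborel) = ennreal (rclock t) - ennreal (rclock s)"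
    unfolding eq by simp
  then show "(\<integral>\<^sup>+ u\<in>{s<..t}. rate u \<partial>lborel) = ennreal (rclock t - rclock s)" by (simp add: ennreal_minus)
qed

lemma rclock_strict: "0 \<le> s \<Longrightarrow> s < t \<Longrightarrow> rclock s < rclock t"
  using slice_pos[of s t] rclock_increment(1)[of s t] by simp

lemma rclock_less_iff: "0 \<le> s \<Longrightarrow> 0 \<le> t \<Longrightarrow> rclock s < rclock t \<longleftrightarrow> s < t"
  using rclock_strict[of s t] rclock_increment(2)[of t s] by force

lemma rclock_le_iff: "0 \<le> s \<Longrightarrow> 0 \<le> t \<Longrightarrow> rclock s \<le> rclock t \<longleftrightarrow> s \<le> t"
  using rclock_less_iff[of t s] by (simp add: not_less[symmetric])

text \<open>On bounded intervals \<open>upper\<close> bounds the rate, so the clock is Lipschitz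
  there.\<close>

lemma rclock_continuous: "continuous_on {0..T} rclock"
proof (cases "0 \<le> T")
  case True
  let ?L = "exp (\<alpha> * (f 0 + c * T))"
  have le: "\<bar>rclock t - rclock s\<bar> \<le> ?L * \<bar>t - s\<bar>" if "s \<in> {0..T}" "t \<in> {0..T}" "s \<le> t" for s t
  proof -
    have "ennreal (rclock t - rclock s) \<le> ennreal (?L * (t - s))"
      using slice_upper[of s t T] rclock_increment(1)[of s t] that by simp
    then have "rclock t - rclock s \<le> ?L * (t - s)" using that by (subst (asm) ennreal_le_iff) auto
    then show ?thesis using rclock_increment(2)[of s t] that by simp
  qed
  have "?L-lipschitz_on {0..T} rclock"
  proof (rule lipschitz_onI)
    fix s t assume "s \<in> {0..T}" "t \<in> {0..T}"
    then show "dist (rclock s) (rclock t) \<le> ?L * dist s t"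
      using le[of s t] le[of t s] by (cases "s \<le> t") (simp_all add: dist_real_def abs_minus_commute)
  qed simp
  then show ?thesis by (rule lipschitz_on_continuous_on)
qed simp

lemma rclock_onto:
  assumes "0 \<le> y" "y \<le> rclock T" "0 \<le> T"
  shows "\<exists>t. 0 \<le> t \<and> t \<le> T \<and> rclock t = y"
  using IVT'[of rclock 0 y T] assms rclock_continuous by auto

lemma clock_mono: "s \<le> t \<Longrightarrow> clock s \<le> clock t"
  unfolding clock_def by (intro nn_integral_mono) (auto simp: indicator_def dest: order_trans)

lemma clock_infinity: "clock \<infinity> = (SUP n. clock (ennreal (real n)))"
proof -
  have "clock \<infinity> = (\<integral>\<^sup>+ u. (SUP n. rate u * indicator {0..real n} u) \<partial>lborel)"
    unfolding clock_def
  proof (intro nn_integral_cong antisym)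
    fix u :: real
    show "ennreal (exp (\<alpha> * f u)) * indicator {u. 0 \<le> u \<and> ennreal u \<le> \<infinity>} u \<le> (SUP n. rate u * indicator {0..real n} u)"
    proof (cases "0 \<le> u")
      case True
      obtain n :: nat where "u \<le> real n" using real_arch_simple by blast
      then show ?thesis using True by (intro SUP_upper2[of n]) (auto simp: rate_def)
    qed simp
    show "(SUP n. rate u * indicator {0..real n} u) \<le> ennreal (exp (\<alpha> * f u)) * indicator {u. 0 \<le> u \<and> ennreal u \<le> \<infinity>} u"
      by (intro SUP_least) (auto simp: rate_def indicator_def)
  qed
  also have "\<dots> = (SUP n. \<integral>\<^sup>+ u. rate u * indicator {0..real n} u \<partial>lborel)"
    by (intro nn_integral_monotone_convergence_SUP) (auto simp: incseq_def le_fun_def indicator_def)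
  finally show ?thesis by (simp add: clock_eq)
qed

lemma alive_clock: "t \<in> alive \<Longrightarrow> ennreal (rclock t) < clock e"
proof -
  assume t: "t \<in> alive"
  then obtain r where r: "r > t" "{t..<r} \<subseteq> alive" using alive_right by blast
  obtain u where u: "t < u" "u < r" using dense[OF r(1)] by blast
  then have "u \<in> alive" using r by auto
  have "ennreal (rclock t) < ennreal (rclock u)"
    using rclock_strict[of t u] u t by (simp add: alive_def ennreal_less_iff)
  also have "\<dots> = clock (ennreal u)" using \<open>u \<in> alive\<close> by (simp add: alive_def clock_finite)
  also have "\<dots> \<le> clock e" using \<open>u \<in> alive\<close> by (intro clock_mono) (auto simp: alive_def intro: less_imp_le)
  finally show ?thesis .
qed

text \<open>The intermediate value theorem inverts the clock, and strictness of the bound keeps the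
  resulting time before \<open>e\<close>.\<close>

lemma clock_alive:
  assumes "0 \<le> s" "ennreal s < clock e"
  shows "\<exists>t\<in>alive. rclock t = s"
proof (cases "e = \<infinity>")
  case True
  then have "ennreal s < (SUP n. clock (ennreal (real n)))" using assms(2) clock_infinity by simp
  then obtain n where "ennreal s < clock (ennreal (real n))" by (auto simp: less_SUP_iff)
  then have "s \<le> rclock (real n)" using assms(1) by (simp add: clock_finite ennreal_less_iff)
  then obtain t where "0 \<le> t" "rclock t = s" using rclock_onto[OF assms(1) \<open>s \<le> rclock (real n)\<close>] by auto
  moreover have "t \<in> alive" unfolding alive_def using True \<open>0 \<le> t\<close> by auto
  ultimately show ?thesis by blast
next
  case False
  then obtain r where r: "e = ennreal r" "0 < r" "alive = {0..<r}" by (rule alive_ennrealE)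
  have "clock e = ennreal (rclock r)" using clock_finite[of r] r(1,2) by simp
  then have s: "s < rclock r" using assms by (simp add: ennreal_less_iff)
  then obtain t where t: "0 \<le> t" "t \<le> r" "rclock t = s" using rclock_onto[OF assms(1), of r] r(2) by auto
  then have "t \<noteq> r" using s by auto
  then show ?thesis using t r(3) by auto
qed

text \<open>The clock is strictly increasing, so the infimum in the time change runs over the times
  after \<open>t\<close>, and the path is read at \<open>t\<close> exactly.\<close>

lemma Y_rclock: "t \<in> alive \<Longrightarrow> Y (rclock t) = exp (f t)"
proof -
  assume t: "t \<in> alive"
  then have t0: "0 \<le> t" by (simp add: alive_def)
  have "Inf {ennreal u | u. 0 \<le> u \<and> clock (ennreal u) > ennreal (rclock t)} = ennreal t" (is "Inf ?S = _")
  proof -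
    have S: "?S = {ennreal u | u. t < u}"
      using t0 by (auto simp: clock_finite ennreal_less_iff rclock_less_iff)
    show ?thesis unfolding S
    proof (rule antisym)
      show "Inf {ennreal u | u. t < u} \<le> ennreal t"
      proof (rule ennreal_le_epsilon)
        fix \<epsilon> :: real assume "0 < \<epsilon>"
        then have "Inf {ennreal u | u. t < u} \<le> ennreal (t + \<epsilon>)" by (intro Inf_lower) auto
        then show "Inf {ennreal u | u. t < u} \<le> ennreal t + ennreal \<epsilon>" using t0 \<open>0 < \<epsilon>\<close> by simp
      qed
      show "ennreal t \<le> Inf {ennreal u | u. t < u}" by (intro Inf_greatest) (auto intro: ennreal_leI)
    qed
  qed
  then show ?thesis using alive_clock[OF t] t0 by (simp add: Y_def)
qed

section \<open>Records and extrema of the transformed path\<close>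

lemma Y_cases:
  assumes "0 \<le> s"
  obtains t where "t \<in> alive" "s = rclock t" "Y s = exp (f t)" | "clock e \<le> ennreal s" "Y s = 0"
  using clock_alive[OF assms] Y_rclock by (metis Y_def not_le)

lemma Y_le: "0 \<le> s \<Longrightarrow> Y s \<le> exp top_value"
  by (rule Y_cases[of s]) (auto intro: le_top)

lemma bdd_Y: "S \<subseteq> {0..} \<Longrightarrow> bdd_above (Y ` S)"
  using Y_le by (auto simp: bdd_above_def)

lemma hit_zero_Y: "Inf {ennreal s | s. 0 < s \<and> Y s = 0} = clock e"
proof -
  have "0 < clock e" using alive_clock[OF zero_alive] by simp
  have S: "{ennreal s | s. 0 < s \<and> Y s = 0} = {ennreal s | s. 0 < s \<and> clock e \<le> ennreal s}"
  proof -
    have "Y s = 0 \<longleftrightarrow> clock e \<le> ennreal s" for s by (auto simp: Y_def not_le)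
    then show ?thesis by simp
  qed
  show ?thesis unfolding S
  proof (rule antisym)
    show "Inf {ennreal s | s. 0 < s \<and> clock e \<le> ennreal s} \<le> clock e"
    proof (cases "clock e")
      case (real r)
      then have "0 < r" using \<open>0 < clock e\<close> by simp
      then show ?thesis using real by (intro Inf_lower) auto
    qed simp
  qed (auto intro: Inf_greatest)
qed

text \<open>The clock is an increasing bijection, so records of \<open>Y\<close> are records of
  \<open>f\<close> read on the clock. After absorption at 0 there are none, because
  \<open>Y 0\<close> is positive.\<close>

lemma Y_record:
  assumes "0 \<le> s"
  shows "(SUP u\<in>{u. 0 \<le> u \<and> ennreal u \<le> ennreal s}. Y u) = Y s \<longleftrightarrow>
    (\<exists>t\<in>alive. s = rclock t \<and> (\<forall>v. 0 \<le> v \<longrightarrow> v \<le> t \<longrightarrow> f v \<le> f t))" (is "?sup = _ \<longleftrightarrow> ?R")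
proof -
  have int: "{u. 0 \<le> u \<and> ennreal u \<le> ennreal s} = {0..s}" using assms by auto
  have bdd: "bdd_above (Y ` {0..s})" by (intro bdd_Y) auto
  show ?thesis
    unfolding int
  proof
    assume eq: "(SUP u\<in>{0..s}. Y u) = Y s"
    have le: "Y u \<le> Y s" if "u \<in> {0..s}" for u
      unfolding eq[symmetric] using that bdd by (rule cSUP_upper)
    from assms show ?R
    proof (cases rule: Y_cases)
      case 2
      have "Y 0 = exp (f 0)" using Y_rclock[OF zero_alive] by simp
      then show ?thesis using le[of 0] 2 assms by (simp add: not_le[symmetric])
    next
      case (1 t)
      have t0: "0 \<le> t" using 1 by (simp add: alive_def)
      have "f v \<le> f t" if "0 \<le> v" "v \<le> t" for v
      proof -
        have "v \<in> alive" using alive_down[OF 1(1)] that by simp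
        then show ?thesis using le[of "rclock v"] Y_rclock[of v] 1 that t0 by (simp add: rclock_le_iff)
      qed
      then show ?thesis using 1 by blast
    qed
  next
    assume ?R
    then obtain t where t: "t \<in> alive" "s = rclock t" "\<And>v. 0 \<le> v \<Longrightarrow> v \<le> t \<Longrightarrow> f v \<le> f t" by blast
    have t0: "0 \<le> t" using t by (simp add: alive_def)
    show "(SUP u\<in>{0..s}. Y u) = Y s"
    proof (rule antisym)
      show "(SUP u\<in>{0..s}. Y u) \<le> Y s"
      proof (rule cSUP_least)
        fix u assume u: "u \<in> {0..s}"
        then have "u \<le> rclock t" "0 \<le> u" using t by auto
        then obtain v where v: "0 \<le> v" "v \<le> t" "rclock v = u" using rclock_onto[of u t] t0 by auto
        then have "v \<in> alive" using alive_down[OF t(1)] by simp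
        then show "Y u \<le> Y s" using Y_rclock[of v] Y_rclock[OF t(1)] t(2,3) v by auto
      qed (use assms in auto)
      show "Y s \<le> (SUP u\<in>{0..s}. Y u)" using assms bdd by (intro cSUP_upper) auto
    qed
  qed
qed

text \<open>This is L = I_G: the clock carries records to records, and its continuity carries their
  accumulation at \<open>top_time\<close> along.\<close>

lemma Sup_Y_records:
  "Sup {ennreal s | s. 0 \<le> s \<and> ennreal s < \<infinity> \<and> (SUP u\<in>{u. 0 \<le> u \<and> ennreal u \<le> ennreal s}. Y u) = Y s}
    = ennreal (rclock top_time)" (is "Sup ?S = _")
proof -
  have S: "?S = {ennreal (rclock t) | t. t \<in> alive \<and> (\<forall>v. 0 \<le> v \<longrightarrow> v \<le> t \<longrightarrow> f v \<le> f t)}"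
  proof (intro equalityI subsetI)
    fix x assume "x \<in> ?S"
    then obtain s where s: "x = ennreal s" "0 \<le> s" "(SUP u\<in>{u. 0 \<le> u \<and> ennreal u \<le> ennreal s}. Y u) = Y s"
      by blast
    from s(3) show "x \<in> {ennreal (rclock t) | t. t \<in> alive \<and> (\<forall>v. 0 \<le> v \<longrightarrow> v \<le> t \<longrightarrow> f v \<le> f t)}"
      unfolding Y_record[OF s(2)] using s(1) by blast
  next
    fix x assume "x \<in> {ennreal (rclock t) | t. t \<in> alive \<and> (\<forall>v. 0 \<le> v \<longrightarrow> v \<le> t \<longrightarrow> f v \<le> f t)}"
    then obtain t where t: "x = ennreal (rclock t)" "t \<in> alive" "\<forall>v. 0 \<le> v \<longrightarrow> v \<le> t \<longrightarrow> f v \<le> f t" by blast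
    have "(SUP u\<in>{u. 0 \<le> u \<and> ennreal u \<le> ennreal (rclock t)}. Y u) = Y (rclock t)"
      unfolding Y_record[OF rclock_nonneg] using t(2,3) by blast
    then show "x \<in> ?S" using t(1) by (intro CollectI exI[of _ "rclock t"]) simp
  qed
  show ?thesis unfolding S
  proof (rule antisym)
    show "Sup {ennreal (rclock t) | t. t \<in> alive \<and> (\<forall>v. 0 \<le> v \<longrightarrow> v \<le> t \<longrightarrow> f v \<le> f t)} \<le> ennreal (rclock top_time)"
    proof (rule Sup_least)
      fix x assume "x \<in> {ennreal (rclock t) | t. t \<in> alive \<and> (\<forall>v. 0 \<le> v \<longrightarrow> v \<le> t \<longrightarrow> f v \<le> f t)}"
      then obtain t where t: "x = ennreal (rclock t)" "t \<in> alive" "\<forall>v. 0 \<le> v \<longrightarrow> v \<le> t \<longrightarrow> f v \<le> f t" by blast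
      then have "t \<le> top_time" by (intro record_le_top_time) auto
      then show "x \<le> ennreal (rclock top_time)" using t top_time(1)
        by (auto simp: alive_def rclock_le_iff intro!: ennreal_leI)
    qed
    show "ennreal (rclock top_time) \<le> Sup {ennreal (rclock t) | t. t \<in> alive \<and> (\<forall>v. 0 \<le> v \<longrightarrow> v \<le> t \<longrightarrow> f v \<le> f t)}"
    proof (rule dense_le)
      fix x assume "x < ennreal (rclock top_time)"
      then obtain y where y: "x = ennreal y" "0 \<le> y" "y < rclock top_time" by (cases x) (auto simp: ennreal_less_iff)
      then obtain t where t: "0 \<le> t" "t \<le> top_time" "rclock t = y"
        using rclock_onto[of y top_time] top_time(1) by auto
      then have "t < top_time" using y by (cases "t = top_time") auto
      from ex_record_near_top_time[OF t(1) this] obtain u where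
        u: "u\<in>alive" "t < u" "\<forall>s. 0 \<le> s \<longrightarrow> s \<le> u \<longrightarrow> f s \<le> f u" by blast
      have "x \<le> ennreal (rclock u)" using y(1) t rclock_strict[OF t(1) u(2)] by (auto intro: ennreal_leI)
      also have "\<dots> \<le> Sup {ennreal (rclock t) | t. t \<in> alive \<and> (\<forall>v. 0 \<le> v \<longrightarrow> v \<le> t \<longrightarrow> f v \<le> f t)}"
        using u by (intro Sup_upper) blast
      finally show "x \<le> Sup {ennreal (rclock t) | t. t \<in> alive \<and> (\<forall>v. 0 \<le> v \<longrightarrow> v \<le> t \<longrightarrow> f v \<le> f t)}" .
    qed
  qed
qed

lemma SUP_Y: "(SUP u\<in>{u. 0 \<le> u \<and> ennreal u \<le> \<infinity>}. Y u) = exp top_value"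
proof (rule antisym)
  show "(SUP u\<in>{u. 0 \<le> u \<and> ennreal u \<le> \<infinity>}. Y u) \<le> exp top_value"
    using Y_le by (intro cSUP_least) (auto intro: exI[of _ 0])
  have bdd: "bdd_above (Y ` {u. 0 \<le> u \<and> ennreal u \<le> \<infinity>})" by (intro bdd_Y) auto
  have ge: "exp (f t) \<le> (SUP u\<in>{u. 0 \<le> u \<and> ennreal u \<le> \<infinity>}. Y u)" if "t \<in> alive" for t
    unfolding Y_rclock[OF that, symmetric] by (intro cSUP_upper bdd) simp
  show "exp top_value \<le> (SUP u\<in>{u. 0 \<le> u \<and> ennreal u \<le> \<infinity>}. Y u)" (is "_ \<le> ?S")
  proof (rule ccontr)
    assume "\<not> exp top_value \<le> ?S"
    have pos: "0 < ?S" using ge[OF zero_alive] exp_gt_zero[of "f 0"] by linarith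
    then have "ln ?S < top_value" using \<open>\<not> exp top_value \<le> ?S\<close> ln_less_cancel_iff[of ?S "exp top_value"] by simp
    then obtain t where "t \<in> alive" "ln ?S < f t" using near_top by blast
    then have "exp (ln ?S) < exp (f t)" by simp
    then show False using ge[OF \<open>t \<in> alive\<close>] exp_ln[OF pos] by linarith
  qed
qed

end

text \<open>If \<open>top_time\<close> lies before \<open>e\<close>, then L < T_0 and a quotient of
  exponentials is the exponential of the drop. Otherwise L = T_0, the ratio is 1 by definition, and
  the drop is 0 by \<open>top_time_eq_e\<close>.\<close>

lemma J_ratio_eq:
  fixes X :: "real \<Rightarrow> 'a \<Rightarrow> real" and e :: "'a \<Rightarrow> ennreal"
  assumes "killed_path_unique_max (\<lambda>u. X u \<omega>) (e \<omega>) c" "0 < \<alpha>"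
  shows "J_ratio (lamperti \<alpha> X e) \<omega> = exp (X (enn2real (last_max_time X e \<omega>)) \<omega> - run_sup X (e \<omega>) \<omega>)"
proof -
  interpret killed_path_unique_max "\<lambda>u. X u \<omega>" "e \<omega>" c by fact
  interpret lamperti_path "\<lambda>u. X u \<omega>" "e \<omega>" c \<alpha> by unfold_locales fact
  have G: "last_max_time X e \<omega> = ennreal top_time"
    unfolding last_max_time_def run_sup_def using Sup_records by simp
  have S: "run_sup X (e \<omega>) \<omega> = top_value"
    unfolding run_sup_def by (rule SUP_closed)
  have Y: "lamperti \<alpha> X e s \<omega> = Y s" for s
    unfolding lamperti_def Y_def time_change_def exp_functional_def clock_def ..
  have L: "last_max_time (lamperti \<alpha> X e) (\<lambda>_. \<infinity>) \<omega> = ennreal (rclock top_time)"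
    unfolding last_max_time_def run_sup_def Y using Sup_Y_records by simp
  have T: "hit_zero (lamperti \<alpha> X e) \<omega> = clock (e \<omega>)"
    unfolding hit_zero_def Y by (rule hit_zero_Y)
  have R: "run_sup (lamperti \<alpha> X e) \<infinity> \<omega> = exp top_value"
    unfolding run_sup_def Y by (rule SUP_Y)
  show ?thesis
  proof (cases "ennreal top_time < e \<omega>")
    case True
    then have ta: "top_time \<in> alive" using top_time(1) by (simp add: alive_def)
    from alive_clock[OF this] have "ennreal (rclock top_time) < clock (e \<omega>)" .
    then show ?thesis unfolding J_ratio_def L T R G S Let_def
      using Y_rclock[OF ta] top_time(1) by (simp add: Y exp_diff)
  next
    case False
    then have eq: "e \<omega> = ennreal top_time" using top_time(2) by simp
    have "clock (e \<omega>) = ennreal (rclock top_time)" 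
      by (rule trans[OF arg_cong[OF eq, of clock] clock_finite[OF top_time(1)]])
    then show ?thesis unfolding J_ratio_def L T R G S Let_def
      using top_time_eq_e[OF eq] top_time(1) by simp
  qed
qed

theorem proposition4p3:
  fixes P :: "real \<Rightarrow> 'a measure" and F :: "ennreal \<Rightarrow> 'a measure" and X :: "real \<Rightarrow> 'a \<Rightarrow> real"
    and e :: "'a \<Rightarrow> ennreal" and p \<alpha> \<mu> \<sigma> :: real and \<nu> :: "real measure"
  assumes "killed_spectrally_negative_levy P F X e p"
    and "levy_triplet P X \<mu> \<sigma> \<nu>"
    and "p = 0 \<Longrightarrow> \<forall>x. AE \<omega> in P x. filterlim (\<lambda>t. X t \<omega>) at_bot at_top"
    and "\<alpha> > 0"
    and "\<forall>x. AE \<omega> in P x. finite_variation (\<lambda>t. X t \<omega>)"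
  defines "\<Phi> \<equiv> Phi P X p"
    and "d \<equiv> levy_drift \<mu> \<nu>"
    and "G \<equiv> last_max_time X e"
    and "J \<equiv> J_ratio (lamperti \<alpha> X e)"
  shows "(\<forall>h :: real \<Rightarrow> ennreal. h \<in> borel_measurable (restrict_space borel {..0}) \<longrightarrow>
            (\<integral>\<^sup>+ \<omega>. h (X (enn2real (G \<omega>)) \<omega> - run_sup X (e \<omega>) \<omega>) \<partial>P 0)
            = ennreal (1 / (\<Phi> * d)) *
                (ennreal p * h 0 + (\<integral>\<^sup>+ z. h z * ennreal (1 - exp (\<Phi> * z)) \<partial>\<nu>)))
       \<and> (\<forall>g :: real \<Rightarrow> ennreal. g \<in> borel_measurable (restrict_space borel {0<..1}) \<longrightarrow>
            (\<integral>\<^sup>+ \<omega>. g (J \<omega>) \<partial>Q_meas P 1)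
            = ennreal (1 / (\<Phi> * d)) *
                (ennreal p * g 1 + (\<integral>\<^sup>+ z. g (exp z) * ennreal (1 - exp (\<Phi> * z)) \<partial>\<nu>)))"
proof -
  interpret killed_levy_fv P F X e p \<mu> \<sigma> \<nu>
    using assms(1-5) by (intro killed_levy_fv.intro killed_levy.intro killed_levy_fv_axioms.intro) auto
  have d_eq: "d = exponent.d" by (simp add: d_def exponent.d_def)
  have law: "(\<integral>\<^sup>+ \<omega>. h (X (enn2real (G \<omega>)) \<omega> - run_sup X (e \<omega>) \<omega>) \<partial>P 0)
      = ennreal (1 / (\<Phi> * d)) * (ennreal p * h 0 + (\<integral>\<^sup>+ z. h z * ennreal (1 - exp (\<Phi> * z)) \<partial>\<nu>))"
    if h: "h \<in> borel_measurable (restrict_space borel {..0})" for h :: "real \<Rightarrow> ennreal"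
  proof -
    \<comment> \<open>Extension by 0 changes no integral: the drop is almost surely nonpositive, and
      \<nu> is carried by the negative numbers.\<close>
    define h' where "h' z = h z * indicator {..0} z" for z
    have h': "h' \<in> borel_measurable borel"
      unfolding h'_def[abs_def] using h by (subst (asm) borel_measurable_restrict_space_iff_ennreal) auto
    have "(\<integral>\<^sup>+ \<omega>. h (X (enn2real (G \<omega>)) \<omega> - run_sup X (e \<omega>) \<omega>) \<partial>P 0)
        = (\<integral>\<^sup>+ \<omega>. h' (X (enn2real (G \<omega>)) \<omega> - run_sup X (e \<omega>) \<omega>) \<partial>P 0)"
      unfolding G_def using drop_limit_nonpos by (intro nn_integral_cong_AE) (auto simp: h'_def)
    also have "\<dots> = ennreal (1 / (\<Phi> * d)) * (ennreal p * h' 0 + (\<integral>\<^sup>+ z. h' z * ennreal (1 - exp (\<Phi> * z)) \<partial>\<nu>))"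
      unfolding G_def \<Phi>_def d_eq by (rule law_of_drop[OF h'])
    also have "(\<integral>\<^sup>+ z. h' z * ennreal (1 - exp (\<Phi> * z)) \<partial>\<nu>) = (\<integral>\<^sup>+ z. h z * ennreal (1 - exp (\<Phi> * z)) \<partial>\<nu>)"
      using exponent.\<nu>_neg by (intro nn_integral_cong_AE) (auto simp: h'_def)
    finally show ?thesis by (simp add: h'_def)
  qed
  have "(\<integral>\<^sup>+ \<omega>. g (J \<omega>) \<partial>Q_meas P 1)
      = ennreal (1 / (\<Phi> * d)) * (ennreal p * g 1 + (\<integral>\<^sup>+ z. g (exp z) * ennreal (1 - exp (\<Phi> * z)) \<partial>\<nu>))"
    if g: "g \<in> borel_measurable (restrict_space borel {0<..1})" for g :: "real \<Rightarrow> ennreal"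
  proof -
    have "(\<integral>\<^sup>+ \<omega>. g (J \<omega>) \<partial>Q_meas P 1)
        = (\<integral>\<^sup>+ \<omega>. g (exp (X (enn2real (G \<omega>)) \<omega> - run_sup X (e \<omega>) \<omega>)) \<partial>P 0)"
      unfolding Q_meas_def ln_one G_def J_def using path_unique_max
      by (intro nn_integral_cong_AE) (auto elim!: eventually_mono simp: J_ratio_eq[OF _ \<open>\<alpha> > 0\<close>])
    moreover have "(\<lambda>z. g (exp z)) \<in> borel_measurable (restrict_space borel {..0})"
      by (rule measurable_compose[OF _ g]) (auto intro!: measurable_restrict_space3)
    ultimately show ?thesis using law[of "\<lambda>z. g (exp z)"] by simp
  qed
  with law show ?thesis by blast
qed

end
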